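(* Let $(E,A)$ be a system of linear maps $M\to V$ between finite-dimensional complex vector spaces, with defects $\alpha_k,\beta_k^+,\beta_k^-$ ($k\ge1$). Then $(E,A)$ admits a Kronecker decomposition which contains, for every integer $k\ge1$, exactly - $\alpha_k$ blocks of type $N_k$, - $\beta_k^+$ blocks of type $L_k$, - $\beta_k^-$ blocks of type $L_k^{\mathsf T}$.
   Context: A system $(E,A)$ is a pair of linear maps $E,A:M\to V$ with the same finite-dimensional domain $M$ and the same finite-dimensional codomain $V$. Reduction: put $V'=EM$ and $M'=A^{-1}V'=\{x\in M: Ax\in V'\}$. Then $E$ and $A$ map $M'$ into $V'$; let $E',A':M'\to V'$ be the restrictions. The reduced system is $(E,A)'=(E',A')$. Define $(E^{(0)},A^{(0)})=(E,A)$ and $(E^{(k+1)},A^{(k+1)})=(E^{(k)},A^{(k)})'$, with domain $M^{(k)}$ and codomain $V^{(k)}$ of $(E^{(k)},A^{(k)})$; so $V''=V^{(2)}=EM'$. The index $n$ is the smallest integer $n\ge 0$ with $(E^{(n+1)},A^{(n+1)})=(E^{(n)},A^{(n)})$ (it always exists), and $(E^{(\infty)},A^{(\infty)}):=(E^{(n)},A^{(n)})$. Defects: let $[A]:M/M'\to V/V'$ and $[E]:M/M'\to V'/V''$ be the maps induced by $A$ and $E$. Put $\beta_1^+(E,A)=\dim\operatorname{coker}[A]$, $\alpha_1(E,A)=\dim\ker[E]$, and for $k\ge1$, $\alpha_k(E,A)=\alpha_1(E^{(k-1)},A^{(k-1)})$, $\beta^+_k(E,A)=\beta^+_1(E^{(k-1)},A^{(k-1)})$.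 The dual system of $(E,A)$ is the pair of adjoint (transpose) maps $(E^*,A^* )$, $V^*\to M^*$; $(E^{(\infty)*},A^{(\infty)*})$ is the dual of $(E^{(\infty)},A^{(\infty)})$, and $\beta^-_k(E,A):=\beta^+_k(E^{(\infty)*},A^{(\infty)*})$ for $k\ge1$. Blocks: for $k\ge1$, $L_k^E$ and $L_k^A$ are the $k\times(k-1)$ matrices ($k$ rows, $k-1$ columns; $1\times 0$ for $k=1$) with $L_k^E$ having entries $1$ at positions $(j,j)$, $1\le j\le k-1$, and $0$ elsewhere, and $L_k^A$ having entries $1$ at positions $(j+1,j)$, $1\le j\le k-1$, and $0$ elsewhere. $N_k^E$ and $N_k^A$ are the $k\times k$ matrices with $N_k^E$ having $1$ at positions $(j,j+1)$, $1\le j\le k-1$, and $0$ elsewhere, and $N_k^A$ the identity matrix. A Kronecker decomposition of $(E,A)$ is a choice of bases of $M$ and $V$ in which $E$ and $A$ have matrices, partitioned into blocks of the same sizes, $$E=\begin{bmatrix} I&0\\0&\overline E\end{bmatrix},\qquad A=\begin{bmatrix}J&0\\0&\overline A\end{bmatrix},$$ where $I$ is an identity matrix, $J$ is block diagonal with Jordan blocks, and $\overline E$, $\overline A$ are block diagonal, with for a common list of indices $$\overline X=\operatorname{diag}\bigl(N_{k_1}^X,\dots,N_{k_m}^X,\,L_{l_1}^X,\dots,L_{l_p}^X,\,(L_{r_1}^X)^{\mathsf T},\dots,(L_{r_q}^X)^{\mathsf T}\bigr),\qquad X\in\{E,A\}.$$ "A block of type $N_k$" means a pair of corresponding blocks $(N_k^E,N_k^A)$;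 similarly for $L_k$ and $L_k^{\mathsf T}$. *)

theory Defs
  imports "HOL-Algebra.AbelCoset" "Jordan_Normal_Form.VS_Connect" "Jordan_Normal_Form.Jordan_Normal_Form"
begin

(* frees the record field names "mult" and "smult" of HOL-Algebra *)
hide_const (open) Multiset.mult Polynomial.smult

section \<open>Systems of linear maps\<close>

text \<open>
  Complex vector spaces are carrier-based (locale \<^locale>\<open>vectorspace\<close> over
  \<^term>\<open>class_ring :: complex ring\<close>), so subspaces, quotients and duals are vector spaces again,
  and the zero space is allowed. The values of the maps of a system outside the carrier of its
  domain are irrelevant.
\<close>

record ('a, 'b) lsys =
  ldom :: "(complex, 'a) module"
  lcod :: "(complex, 'b) module"
  lE :: "'a \<Rightarrow> 'b"
  lA :: "'a \<Rightarrow> 'b"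

definition linear_system :: "('a, 'b) lsys \<Rightarrow> bool" where
  "linear_system S \<longleftrightarrow>
     linear_map class_ring (ldom S) (lcod S) (lE S) \<and>
     linear_map class_ring (ldom S) (lcod S) (lA S) \<and>
     vectorspace.fin_dim class_ring (ldom S) \<and>
     vectorspace.fin_dim class_ring (lcod S)"

section \<open>Reduction\<close>

definition red_cod :: "('a, 'b) lsys \<Rightarrow> 'b set" where
  "red_cod S = lE S ` carrier (ldom S)"

definition red_dom :: "('a, 'b) lsys \<Rightarrow> 'a set" where
  "red_dom S = {x \<in> carrier (ldom S). lA S x \<in> red_cod S}"

text \<open>
  Restricting the maps only means shrinking the carriers. The functions themselves are left alone,
  so that two iterated reductions of one system are equal iff their domains and codomains are.
\<close>

definition reduce :: "('a, 'b) lsys \<Rightarrow> ('a, 'b) lsys" where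
  "reduce S = S\<lparr>ldom := (ldom S)\<lparr>carrier := red_dom S\<rparr>,
                lcod := (lcod S)\<lparr>carrier := red_cod S\<rparr>\<rparr>"

definition reduction :: "nat \<Rightarrow> ('a, 'b) lsys \<Rightarrow> ('a, 'b) lsys" where
  "reduction k S = (reduce ^^ k) S"

definition sys_index :: "('a, 'b) lsys \<Rightarrow> nat" where
  "sys_index S = (LEAST n. reduction (Suc n) S = reduction n S)"

definition reduction_inf :: "('a, 'b) lsys \<Rightarrow> ('a, 'b) lsys" where
  "reduction_inf S = reduction (sys_index S) S"

section \<open>Quotient spaces and induced maps\<close>

text \<open>
  If \<open>f\<close> maps \<open>U\<close> into \<open>W\<close>, then \<open>induced_map V W f\<close> sends the coset \<open>U + x\<close> to \<open>W + f x\<close>.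
\<close>

definition induced_map :: "(complex, 'b) module \<Rightarrow> 'b set \<Rightarrow> ('a \<Rightarrow> 'b) \<Rightarrow> 'a set \<Rightarrow> 'b set" where
  "induced_map V W f X = W <+>\<^bsub>V\<^esub> f ` X"

text \<open>The fields \<open>mult\<close> and \<open>one\<close> of a module record play no role.\<close>

definition quotient_space :: "(complex, 'b) module \<Rightarrow> 'b set \<Rightarrow> (complex, 'b set) module" where
  "quotient_space V W =
     \<lparr>carrier = a_rcosets\<^bsub>V\<^esub> W,
      mult = (\<lambda>X Y. W),
      one = W,
      zero = W,
      add = (\<lambda>X Y. X <+>\<^bsub>V\<^esub> Y),
      smult = (\<lambda>c. induced_map V W (\<lambda>x. c \<odot>\<^bsub>V\<^esub> x))\<rparr>"

definition coker :: "(complex, 'a) module \<Rightarrow> (complex, 'b) module \<Rightarrow> ('a \<Rightarrow> 'b)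
    \<Rightarrow> (complex, 'b set) module" where
  "coker U V f = quotient_space V (mod_hom.im U f)"

section \<open>Dual systems\<close>

definition scalar_space :: "(complex, complex) module" where
  "scalar_space = \<lparr>carrier = UNIV, mult = (*), one = 1, zero = 0, add = (+), smult = (*)\<rparr>"

text \<open>
  Functionals are functions on the carrier, made unique by the value \<^const>\<open>undefined\<close> elsewhere.
  The operations are the pointwise ones of the function space.
\<close>

definition dual_space :: "(complex, 'b) module \<Rightarrow> (complex, 'b \<Rightarrow> complex) module" where
  "dual_space V = (ring.func_space class_ring (carrier V))
     \<lparr>carrier := LinearCombinations.module_hom class_ring V scalar_space \<inter> extensional (carrier V)\<rparr>"

definition dual_map :: "(complex, 'a) module \<Rightarrow> ('a \<Rightarrow> 'b) \<Rightarrow> ('b \<Rightarrow> complex) \<Rightarrow> 'a \<Rightarrow> complex" where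
  "dual_map M f \<phi> = restrict (\<phi> \<circ> f) (carrier M)"

definition dual_system :: "('a, 'b) lsys \<Rightarrow> ('b \<Rightarrow> complex, 'a \<Rightarrow> complex) lsys" where
  "dual_system S =
     \<lparr>ldom = dual_space (lcod S),
      lcod = dual_space (ldom S),
      lE = dual_map (ldom S) (lE S),
      lA = dual_map (ldom S) (lA S)\<rparr>"

section \<open>Defects\<close>

text \<open>\<open>M/M'\<close>, \<open>V/V'\<close>, \<open>V'/V''\<close>, and the maps \<open>[A] : M/M' \<rightarrow> V/V'\<close> and \<open>[E] : M/M' \<rightarrow> V'/V''\<close>.\<close>

definition dom_quot :: "('a, 'b) lsys \<Rightarrow> (complex, 'a set) module" where
  "dom_quot S = quotient_space (ldom S) (red_dom S)"

definition cod_quot :: "('a, 'b) lsys \<Rightarrow> (complex, 'b set) module" where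
  "cod_quot S = quotient_space (lcod S) (red_cod S)"

definition A_ind :: "('a, 'b) lsys \<Rightarrow> 'a set \<Rightarrow> 'b set" where
  "A_ind S = induced_map (lcod S) (red_cod S) (lA S)"

definition E_ind :: "('a, 'b) lsys \<Rightarrow> 'a set \<Rightarrow> 'b set" where
  "E_ind S = induced_map (lcod (reduce S)) (red_cod (reduce S)) (lE S)"

definition beta_plus_1 :: "('a, 'b) lsys \<Rightarrow> nat" where
  "beta_plus_1 S = vectorspace.dim class_ring (coker (dom_quot S) (cod_quot S) (A_ind S))"

definition alpha_1 :: "('a, 'b) lsys \<Rightarrow> nat" where
  "alpha_1 S = vectorspace.dim class_ring
     ((dom_quot S)\<lparr>carrier := mod_hom.ker (dom_quot S) (cod_quot (reduce S)) (E_ind S)\<rparr>)"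

text \<open>The defects are meant for \<open>k \<ge> 1\<close> only.\<close>

definition alpha :: "nat \<Rightarrow> ('a, 'b) lsys \<Rightarrow> nat" where
  "alpha k S = alpha_1 (reduction (k - 1) S)"

definition beta_plus :: "nat \<Rightarrow> ('a, 'b) lsys \<Rightarrow> nat" where
  "beta_plus k S = beta_plus_1 (reduction (k - 1) S)"

definition beta_minus :: "nat \<Rightarrow> ('a, 'b) lsys \<Rightarrow> nat" where
  "beta_minus k S = beta_plus k (dual_system (reduction_inf S))"

section \<open>Kronecker decompositions\<close>

text \<open>Matrix indices start at 0.\<close>

definition L_E :: "nat \<Rightarrow> complex mat" where
  "L_E k = mat k (k - 1) (\<lambda>(i, j). if i = j then 1 else 0)"

definition L_A :: "nat \<Rightarrow> complex mat" where
  "L_A k = mat k (k - 1) (\<lambda>(i, j). if i = j + 1 then 1 else 0)"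

definition N_E :: "nat \<Rightarrow> complex mat" where
  "N_E k = mat k k (\<lambda>(i, j). if j = i + 1 then 1 else 0)"

definition N_A :: "nat \<Rightarrow> complex mat" where
  "N_A k = 1\<^sub>m k"

definition singular_part ::
  "(nat \<Rightarrow> complex mat) \<Rightarrow> (nat \<Rightarrow> complex mat) \<Rightarrow> nat list \<Rightarrow> nat list \<Rightarrow> nat list \<Rightarrow> complex mat" where
  "singular_part N L ks ls rs =
     diag_block_mat (map N ks @ map L ls @ map (\<lambda>r. transpose_mat (L r)) rs)"

definition block_diag2 :: "complex mat \<Rightarrow> complex mat \<Rightarrow> complex mat" where
  "block_diag2 B C =
     four_block_mat B (0\<^sub>m (dim_row B) (dim_col C)) (0\<^sub>m (dim_row C) (dim_col B)) C"

definition ordered_basis :: "(complex, 'a) module \<Rightarrow> 'a list \<Rightarrow> bool" where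
  "ordered_basis V bs \<longleftrightarrow> distinct bs \<and> vectorspace.basis class_ring V (set bs)"

text \<open>
  \<open>B\<close> is the matrix of \<open>f\<close> with respect to the basis \<open>bs\<close> of its domain and the basis \<open>cs\<close> of its
  codomain \<open>V\<close>.
\<close>

definition matrix_of_map ::
  "(complex, 'b) module \<Rightarrow> 'a list \<Rightarrow> 'b list \<Rightarrow> ('a \<Rightarrow> 'b) \<Rightarrow> complex mat \<Rightarrow> bool" where
  "matrix_of_map V bs cs f B \<longleftrightarrow>
     B \<in> carrier_mat (length cs) (length bs) \<and>
     (\<forall>j<length bs. f (bs ! j) = (\<Oplus>\<^bsub>V\<^esub>i\<in>{..<length cs}. B $$ (i, j) \<odot>\<^bsub>V\<^esub> cs ! i))"

text \<open>
  \<open>js\<close> lists the sizes and eigenvalues of the Jordan blocks of \<open>J\<close>; \<open>ks\<close>, \<open>ls\<close>, \<open>rs\<close> list the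
  indices of the blocks of types \<open>N\<close>, \<open>L\<close> and \<open>L\<^sup>T\<close>.
\<close>

definition kronecker_decomposition ::
  "('a, 'b) lsys \<Rightarrow> 'a list \<Rightarrow> 'b list \<Rightarrow> (nat \<times> complex) list
     \<Rightarrow> nat list \<Rightarrow> nat list \<Rightarrow> nat list \<Rightarrow> bool" where
  "kronecker_decomposition S bs cs js ks ls rs \<longleftrightarrow>
     ordered_basis (ldom S) bs \<and> ordered_basis (lcod S) cs \<and>
     0 \<notin> fst ` set js \<and> 0 \<notin> set ks \<and> 0 \<notin> set ls \<and> 0 \<notin> set rs \<and>
     matrix_of_map (lcod S) bs cs (lE S)
       (block_diag2 (1\<^sub>m (dim_row (jordan_matrix js))) (singular_part N_E L_E ks ls rs)) \<and>
     matrix_of_map (lcod S) bs cs (lA S)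
       (block_diag2 (jordan_matrix js) (singular_part N_A L_A ks ls rs))"

end

theory Submission
  imports Defs "HOL-Library.Function_Algebras" "Jordan_Normal_Form.Jordan_Normal_Form_Existence"
begin

text \<open>
  Reduction is undone one step at a time. Given chains forming bases of \<open>M'\<close> and \<open>V' = E M\<close>, the
  last vectors of the codomain parts of the \<open>N\<close> and \<open>L\<close> blocks span a complement of \<open>V'' = E M'\<close>
  in \<open>V'\<close>. Choosing preimages of them under \<open>E\<close> and applying \<open>A\<close> to these preimages makes each such
  chain longer by one. What is missing from \<open>M\<close> are vectors of \<open>ker E\<close>, which number \<open>dim ker [E]\<close>
  and start new blocks \<open>N\<^sub>1\<close>; what is then missing from \<open>V\<close> are \<open>dim coker [A]\<close> vectors, each a
  block \<open>L\<^sub>1\<close>. At the fixed point of the reduction \<open>E\<close> is onto, so \<open>E\<close> is injective in the dual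
  system. The same lifting, started from the bijective end of the reductions of the dual, thus yields
  only a regular part and \<open>L\<close> blocks there, and the dual bases turn these into \<open>L\<^sup>T\<close> blocks. Only at
  the end is the regular part put into Jordan form, by one change of basis.

  All this takes place in subspaces of types, where spans and dimensions are those of the
  distribution; a carrier-based space is the image of such a subspace under a linear map
  (\<open>presents\<close>), and quotients are handled as images with a larger kernel.
\<close>

section \<open>Bases and independence modulo a subspace\<close>

text \<open>The lifting works with arbitrary choices because of two facts about the induced maps:
  \<open>[A]\<close> is injective, since M' is the whole preimage of V' under A, and
  \<open>[E]\<close> maps onto V'/V'', since V' = E M. So M/M' splits into a lift of V'/V'' and ker
  \<open>[E]\<close>, and any basis of a complement of M' in M, once mapped by A, is independent
  modulo V'; no chosen vector has to be corrected afterwards. Each lifting lengthens every N and L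
  block by one and adds those of size one. This is the index shift
  \<open>\<alpha>_(k+1)(E,A) = \<alpha>_k((E,A)')\<close>, and likewise for
  \<open>\<beta>^+\<close>, so the defects count the blocks. A regular block or an L^T block equals
  its own reduction. The fixed point mixes the two kinds, and reduction cannot tell them apart;
  transposing turns L^T into L, which reduction does take apart. There injectivity of E makes every
  \<open>\<alpha>_k\<close> zero, so that no N block arises.\<close>

lemma mset_concat_butlast_last:
  "(\<And>p. p \<in> set C \<Longrightarrow> snd p \<noteq> []) \<Longrightarrow>
    mset (concat (map snd C)) = mset (concat (map (butlast \<circ> snd) C)) + mset (map (last \<circ> snd) C)"
proof (induction C)
  case (Cons p C)
  have "mset (snd p) = mset (butlast (snd p)) + {#last (snd p)#}"
    using Cons.prems[of p] by (metis append_butlast_last_id list.set_intros(1) mset.simps mset_append)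
  then show ?case
    using Cons by simp
qed simp

text \<open>
  A copy of \<^locale>\<open>vector_space\<close>: definitions made inside the original would be shadowed by their
  instances under the global interpretation for real vector spaces.
\<close>

locale ambient = vector_space
begin

text \<open>Finite dimension is asked of the subspace and not of the type: the function types that
  serve as ambient spaces later may have infinite dimension.\<close>

definition finitely_spanned :: "'b set \<Rightarrow> bool" where
  "finitely_spanned P \<longleftrightarrow> (\<exists>F. finite F \<and> P \<subseteq> span F)"

definition list_basis :: "'b list \<Rightarrow> 'b set \<Rightarrow> bool" where
  "list_basis bs P \<longleftrightarrow> distinct bs \<and> independent (set bs) \<and> span (set bs) = P"

text \<open>A lifting appends a vector to each chain, hence in the middle of the list for the whole
  basis, while independence is proved for the old vectors followed by all new ones. Only the
  multiset matters.\<close>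

lemma list_basis_mset_cong: "mset bs = mset cs \<Longrightarrow> list_basis bs P \<longleftrightarrow> list_basis cs P"
  unfolding list_basis_def by (metis mset_eq_imp_distinct_iff mset_eq_setD)

lemma list_basisI_partition:
  assumes "mset bs = mset (xs @ ys)" "distinct xs" "distinct ys" "set xs \<inter> set ys = {}"
    "independent (set xs \<union> set ys)" "span (set xs \<union> set ys) = P"
  shows "list_basis bs P"
  using list_basis_mset_cong[OF assms(1)] assms(2-) by (simp add: list_basis_def)

lemma finitely_spanned_mono: "finitely_spanned P \<Longrightarrow> S \<subseteq> P \<Longrightarrow> finitely_spanned S"
  unfolding finitely_spanned_def by blast

text \<open>\<open>Z\<close> is an arbitrary subset: the lifting takes the union of M' with the
  kernel of E, so that each added vector lies in one of these two and not merely in their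
  sum.\<close>

lemma independent_extend_within:
  assumes "finitely_spanned Z" "X \<subseteq> Z" "independent X"
  obtains Y where "finite Y" "Y \<subseteq> Z" "X \<inter> Y = {}" "independent (X \<union> Y)" "span (X \<union> Y) = span Z"
proof -
  obtain B where B: "X \<subseteq> B" "B \<subseteq> Z" "independent B" "Z \<subseteq> span B"
    using maximal_independent_subset_extend[OF assms(2,3)] by metis
  have "finite B"
    using assms(1) B(2,3) independent_span_bound unfolding finitely_spanned_def by (metis subset_trans)
  moreover have "span B = span Z"
    using B span_superset[of Z] by (simp add: span_eq)
  ultimately show thesis
    using that[of "B - X"] B by (auto simp: Un_absorb1)
qed

lemma independent_extend_subspace:
  assumes "finitely_spanned P" "subspace P" "X \<subseteq> P" "independent X"
  obtains Y where "finite Y" "Y \<subseteq> P" "X \<inter> Y = {}" "independent (X \<union> Y)" "span (X \<union> Y) = P"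
  by (rule independent_extend_within[OF assms(1,3,4)])
    (rule that, simp_all add: span_eq_iff[THEN iffD2, OF assms(2)])

lemma list_basis_exists:
  assumes "finitely_spanned P" "subspace P"
  obtains bs where "list_basis bs P"
proof -
  obtain Y where Y: "finite Y" "independent ({} \<union> Y)" "span ({} \<union> Y) = P"
    using independent_extend_subspace[OF assms, of "{}"] independent_empty by auto
  obtain bs where "set bs = Y" "distinct bs"
    using finite_distinct_list[OF Y(1)] by auto
  then show thesis
    using that Y unfolding list_basis_def by auto
qed

lemma list_basis_dim: "list_basis bs P \<Longrightarrow> dim P = length bs"
  using dim_span_eq_card_independent[of "set bs"] by (auto simp: list_basis_def distinct_card)

lemma finitely_spanned_dim_strict:
  assumes "finitely_spanned P" "subspace P" "subspace W" "W \<subset> P"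
  shows "dim W < dim P"
proof -
  obtain bs where bs: "list_basis bs W"
    using list_basis_exists[OF finitely_spanned_mono[OF assms(1)]] assms(3,4) by blast
  then have Y: "independent (set bs)" "span (set bs) = W"
    by (auto simp: list_basis_def)
  then obtain Y' where Y': "finite Y'" "set bs \<inter> Y' = {}" "independent (set bs \<union> Y')"
      "span (set bs \<union> Y') = P"
    using independent_extend_subspace[OF assms(1,2), of "set bs"] assms(4) span_superset[of "set bs"]
    by (metis psubset_imp_subset subset_trans)
  have "Y' \<noteq> {}"
    using Y(2) Y'(4) assms(4) by auto
  then have "card (set bs) < card (set bs \<union> Y')"
    using Y' by (simp add: card_Un_disjoint card_gt_0_iff)
  then show ?thesis
    using dim_span_eq_card_independent[OF Y(1)] dim_span_eq_card_independent[OF Y'(3)] Y(2) Y'(4)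
    by simp
qed

end

section \<open>Independence modulo subspaces along linear maps\<close>

locale ambient_pair = vs1: ambient s1 + vs2: ambient s2
  for s1 :: "'a::field \<Rightarrow> 'b \<Rightarrow> 'b :: ab_group_add" (infixr \<open>*a\<close> 75)
  and s2 :: "'a::field \<Rightarrow> 'c \<Rightarrow> 'c :: ab_group_add" (infixr \<open>*b\<close> 75)
begin

sublocale vector_space_pair s1 s2
  by unfold_locales

text \<open>By \<open>ker\<close>, a combination of \<open>X\<close> whose image falls into
  \<open>span C\<close> lies in \<open>span B\<close>, so it is trivial by the independence of
  \<open>B \<union> X\<close>. The case in mind is the injective map \<open>[A]\<close>, with bases
  \<open>B\<close> of M' and \<open>C\<close> of V'.\<close>

lemma independent_image_modulo:
  assumes f: "Vector_Spaces.linear s1 s2 f" and "finite X" "vs1.independent (B \<union> X)" "B \<inter> X = {}"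
    and C: "vs2.independent C"
    and ker: "\<And>u. u \<in> vs1.span X \<Longrightarrow> f u \<in> vs2.span C \<Longrightarrow> u \<in> vs1.span B"
  shows "vs2.independent (C \<union> f ` X) \<and> C \<inter> f ` X = {} \<and> inj_on f X"
  using assms(2-4) ker
proof (induction X rule: finite_induct)
  case empty
  then show ?case using C by simp
next
  case (insert x X)
  interpret f: Vector_Spaces.linear s1 s2 f by (rule f)
  have prems_X: "u \<in> vs1.span B" if "u \<in> vs1.span X" "f u \<in> vs2.span C" for u
    using insert.prems(3) that vs1.span_mono[OF subset_insertI] by blast
  have "vs1.independent (B \<union> X)"
    using insert.prems(1) by (rule vs1.independent_mono) blast
  moreover have "B \<inter> X = {}"
    using insert.prems(2) by blast
  ultimately have IH: "vs2.independent (C \<union> f ` X)" "C \<inter> f ` X = {}" "inj_on f X"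
    using insert.IH prems_X by blast+
  have x: "x \<notin> vs1.span (B \<union> X)"
    using insert.prems insert.hyps vs1.independent_insert[of x "B \<union> X"] by (auto split: if_splits)
  have "f x \<notin> vs2.span (C \<union> f ` X)"
  proof
    assume "f x \<in> vs2.span (C \<union> f ` X)"
    then obtain c u where cu: "c \<in> vs2.span C" "u \<in> vs1.span X" "f x = c + f u"
      unfolding vs2.span_Un f.span_image by auto
    have "x - u \<in> vs1.span (insert x X)"
      using cu(2) by (meson vs1.span_base vs1.span_diff vs1.span_mono insertI1 subset_insertI subsetD)
    moreover have "f (x - u) = c"
      using cu by (simp add: f.diff)
    ultimately have "x - u \<in> vs1.span B"
      using insert.prems cu by blast
    then have "(x - u) + u \<in> vs1.span (B \<union> X)"
      using cu(2) unfolding vs1.span_Un by blast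
    then show False using x by simp
  qed
  moreover from this have "f x \<notin> C \<union> f ` X"
    using vs2.span_superset[of "C \<union> f ` X"] by blast
  ultimately show ?case
    using IH insert.hyps by (auto simp: vs2.independent_insert)
qed

text \<open>The companion for \<open>[E]\<close>: as \<open>f\<close> maps \<open>span B\<close>
  into \<open>span C\<close>, a relation of \<open>X\<close> modulo \<open>span B\<close> would be
  mapped to a relation of the images modulo \<open>span C\<close>.\<close>

lemma independent_preimage_modulo:
  assumes f: "Vector_Spaces.linear s1 s2 f" and "finite X" "vs2.independent (C \<union> f ` X)" "C \<inter> f ` X = {}" "inj_on f X"
    and B: "vs1.independent B" "f ` B \<subseteq> vs2.span C"
  shows "vs1.independent (B \<union> X) \<and> B \<inter> X = {}"
  using assms(2-5)
proof (induction X rule: finite_induct)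
  case empty
  then show ?case using B by simp
next
  case (insert x X)
  interpret f: Vector_Spaces.linear s1 s2 f by (rule f)
  have "vs2.independent (C \<union> f ` X)"
    using insert.prems(1) by (rule vs2.independent_mono) blast
  moreover have "C \<inter> f ` X = {}" "inj_on f X"
    using insert.prems(2,3) by (auto simp: inj_on_def)
  ultimately have IH: "vs1.independent (B \<union> X)" "B \<inter> X = {}"
    using insert.IH by blast+
  have fx: "f x \<notin> vs2.span (C \<union> f ` X)"
    using insert.prems insert.hyps vs2.independent_insert[of "f x" "C \<union> f ` X"]
    by (auto split: if_splits)
  have "f ` vs1.span (B \<union> X) \<subseteq> vs2.span (C \<union> f ` X)"
    unfolding f.span_image[symmetric] image_Un
    using B(2) vs2.span_mono[of C "C \<union> f ` X"] vs2.span_superset[of "C \<union> f ` X"]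
    by (intro vs2.span_minimal) auto
  then have "x \<notin> vs1.span (B \<union> X)"
    using fx by blast
  moreover from this have "x \<notin> B \<union> X"
    using vs1.span_superset[of "B \<union> X"] by blast
  ultimately show ?case
    using IH insert.hyps by (auto simp: vs1.independent_insert)
qed

end

section \<open>Pencils and chains\<close>

locale pencil = ambient_pair s1 s2
  for s1 :: "'a::field \<Rightarrow> 'b \<Rightarrow> 'b :: ab_group_add" (infixr \<open>*a\<close> 75)
  and s2 :: "'a::field \<Rightarrow> 'c \<Rightarrow> 'c :: ab_group_add" (infixr \<open>*b\<close> 75) +
  fixes E A :: "'b \<Rightarrow> 'c"
  assumes linear_E: "Vector_Spaces.linear s1 s2 E" and linear_A: "Vector_Spaces.linear s1 s2 A"
begin

sublocale E: Vector_Spaces.linear s1 s2 E by (rule linear_E)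
sublocale A: Vector_Spaces.linear s1 s2 A by (rule linear_A)

definition red :: "'b set \<times> 'c set \<Rightarrow> 'b set \<times> 'c set" where
  "red PQ = ({x \<in> fst PQ. A x \<in> E ` fst PQ}, E ` fst PQ)"

text \<open>
  In the notation of the reduction, \<open>ker [E] = E\<^sup>-\<^sup>1 V'' / M'\<close> and \<open>coker [A] = V / (V' + A M)\<close>.
\<close>

definition alpha_dim :: "'b set \<times> 'c set \<Rightarrow> nat" where
  "alpha_dim PQ = vs1.dim {x \<in> fst PQ. E x \<in> E ` fst (red PQ)} - vs1.dim (fst (red PQ))"

definition beta_dim :: "'b set \<times> 'c set \<Rightarrow> nat" where
  "beta_dim PQ = vs2.dim (snd PQ) - vs2.dim {E x + A y | x y. x \<in> fst PQ \<and> y \<in> fst PQ}"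

definition subsystem :: "'b set \<times> 'c set \<Rightarrow> bool" where
  "subsystem PQ \<longleftrightarrow> vs1.subspace (fst PQ) \<and> vs2.subspace (snd PQ) \<and>
     vs1.finitely_spanned (fst PQ) \<and> vs2.finitely_spanned (snd PQ) \<and>
     E ` fst PQ \<subseteq> snd PQ \<and> A ` fst PQ \<subseteq> snd PQ"

lemma subsystem_red:
  assumes "subsystem PQ"
  shows "subsystem (red PQ)"
proof -
  have EP: "vs2.subspace (E ` fst PQ)"
    using assms by (simp add: subsystem_def E.subspace_image)
  have "vs1.subspace (fst PQ \<inter> {x. A x \<in> E ` fst PQ})"
    using assms EP unfolding subsystem_def
    by (intro vs1.subspace_inter A.subspace_linear_preimage) auto
  then show ?thesis
    using assms EP vs1.finitely_spanned_mono vs2.finitely_spanned_mono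
    unfolding subsystem_def red_def by (auto simp: Int_def)
qed

lemma subsystem_red_funpow: "subsystem PQ \<Longrightarrow> subsystem ((red ^^ k) PQ)"
  by (induction k) (auto intro: subsystem_red)

text \<open>
  A block is a pair of lists, the part \<open>u\<close> of the basis of the domain and the part \<open>v\<close> of the basis
  of the codomain that it occupies.
\<close>

definition N_chain :: "'b list \<times> 'c list \<Rightarrow> bool" where
  "N_chain = (\<lambda>(u, v). u \<noteq> [] \<and> length v = length u \<and> E (u ! 0) = 0 \<and>
     (\<forall>i. Suc i < length u \<longrightarrow> E (u ! Suc i) = v ! i) \<and> (\<forall>i<length u. A (u ! i) = v ! i))"

text \<open>An empty \<open>u\<close> with a single vector in \<open>v\<close> is the block
  \<open>L_1\<close>. The index of the block is \<open>length v\<close> here; for the other two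
  types it is \<open>length u\<close>.\<close>

definition L_chain :: "'b list \<times> 'c list \<Rightarrow> bool" where
  "L_chain = (\<lambda>(u, v). length v = Suc (length u) \<and>
     (\<forall>i<length u. E (u ! i) = v ! i \<and> A (u ! i) = v ! Suc i))"

definition T_chain :: "'b list \<times> 'c list \<Rightarrow> bool" where
  "T_chain = (\<lambda>(u, v). length u = Suc (length v) \<and> E (u ! length v) = 0 \<and> A (u ! 0) = 0 \<and>
     (\<forall>i<length v. E (u ! i) = v ! i \<and> A (u ! Suc i) = v ! i))"

text \<open>The regular part consists of \<open>xs\<close> and its images \<open>map E xs\<close>.
  With this choice E already has the identity matrix there, and only A remains to be brought to
  normal form.\<close>

definition chain_basis :: "'b set \<times> 'c set \<Rightarrow> 'b list \<Rightarrow> ('b list \<times> 'c list) list \<Rightarrow>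
    ('b list \<times> 'c list) list \<Rightarrow> ('b list \<times> 'c list) list \<Rightarrow> bool" where
  "chain_basis PQ xs Ns Ls Ts \<longleftrightarrow>
     vs1.list_basis (xs @ concat (map fst (Ns @ Ls @ Ts))) (fst PQ) \<and>
     vs2.list_basis (map E xs @ concat (map snd (Ns @ Ls @ Ts))) (snd PQ) \<and>
     A ` set xs \<subseteq> vs2.span (E ` set xs) \<and>
     list_all N_chain Ns \<and> list_all L_chain Ls \<and> list_all T_chain Ts"

lemma N_chain_E_image: "N_chain (u, v) \<Longrightarrow> E ` set u = insert 0 (set (butlast v))"
proof -
  assume N: "N_chain (u, v)"
  then obtain x u' where u: "u = x # u'"
    unfolding N_chain_def by (cases u) auto
  have "map E u = 0 # butlast v"
    using N by (intro nth_equalityI) (auto simp: N_chain_def nth_Cons nth_butlast split: nat.split)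
  then show ?thesis
    by (metis list.simps(15) list.set_map)
qed

lemma L_chain_E_image: "L_chain (u, v) \<Longrightarrow> E ` set u = set (butlast v)"
proof -
  assume L: "L_chain (u, v)"
  have "map E u = butlast v"
    using L by (intro nth_equalityI) (auto simp: L_chain_def nth_butlast)
  then show ?thesis
    by (metis list.set_map)
qed

lemma T_chain_E_image: "T_chain (u, v) \<Longrightarrow> E ` set u = insert 0 (set v)"
proof -
  assume T: "T_chain (u, v)"
  have "map E u = v @ [0]"
    using T by (intro nth_equalityI) (auto simp: T_chain_def nth_append less_Suc_eq)
  then show ?thesis
    by (metis list.set_map set_append list.set(1,2) Un_insert_right sup_bot_right)
qed

text \<open>E reaches every vector of the codomain basis except the last ones of the N and L chains.
  Applied to a basis for the reduced system, this describes V'' = E M' and shows what it misses in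
  V'.\<close>

lemma chain_basis_E_image:
  assumes "chain_basis PQ xs Ns Ls Ts"
  shows "vs2.span (E ` fst PQ) =
    vs2.span (set (map E xs @ concat (map (butlast \<circ> snd) (Ns @ Ls)) @ concat (map snd Ts)))"
    (is "_ = vs2.span ?R")
proof -
  \<comment> \<open>The zero images in N and L^T chains do not change a span; adjoining 0 on both
    sides lets the three types be treated alike.\<close>
  have N: "insert 0 (E ` set (fst p)) = insert 0 (set (butlast (snd p)))" if "p \<in> set Ns" for p
    using N_chain_E_image[of "fst p" "snd p"] assms that by (auto simp: chain_basis_def list_all_iff)
  have L: "insert 0 (E ` set (fst p)) = insert 0 (set (butlast (snd p)))" if "p \<in> set Ls" for p
    using L_chain_E_image[of "fst p" "snd p"] assms that by (auto simp: chain_basis_def list_all_iff)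
  have T: "insert 0 (E ` set (fst p)) = insert 0 (set (snd p))" if "p \<in> set Ts" for p
    using T_chain_E_image[of "fst p" "snd p"] assms that by (auto simp: chain_basis_def list_all_iff)
  define B where "B = set (xs @ concat (map fst (Ns @ Ls @ Ts)))"
  have "insert 0 (E ` B) = insert 0 (E ` set xs) \<union> (\<Union>p\<in>set Ns. insert 0 (E ` set (fst p))) \<union>
     (\<Union>p\<in>set Ls. insert 0 (E ` set (fst p))) \<union> (\<Union>p\<in>set Ts. insert 0 (E ` set (fst p)))"
    unfolding B_def by (simp add: image_Un image_UN) blast
  also have "\<dots> = insert 0 (E ` set xs) \<union> (\<Union>p\<in>set Ns. insert 0 (set (butlast (snd p)))) \<union>
     (\<Union>p\<in>set Ls. insert 0 (set (butlast (snd p)))) \<union> (\<Union>p\<in>set Ts. insert 0 (set (snd p)))"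
    by (simp only: SUP_cong[OF refl N] SUP_cong[OF refl L] SUP_cong[OF refl T])
  also have "\<dots> = insert 0 ?R"
    by simp blast
  finally have "vs2.span (E ` B) = vs2.span ?R"
    by (metis vs2.span_insert_0)
  moreover have "fst PQ = vs1.span B"
    using assms unfolding chain_basis_def vs1.list_basis_def B_def by simp
  ultimately show ?thesis
    by (simp add: E.span_image[symmetric])
qed

lemma chain_append_N:
  assumes "N_chain (u, v)" "E x = last v"
  shows "N_chain (u @ [x], v @ [A x])"
proof -
  have "last v = v ! i" if "Suc i = length u" for i
  proof -
    have "v \<noteq> []" "length v = Suc i"
      using assms(1) that by (auto simp: N_chain_def)
    then show ?thesis
      by (simp add: last_conv_nth)
  qed
  then show ?thesis
    using assms by (auto simp: N_chain_def nth_append less_Suc_eq)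
qed

lemma chain_append_L:
  assumes "L_chain (u, v)" "E x = last v"
  shows "L_chain (u @ [x], v @ [A x])"
proof -
  have "v \<noteq> []"
    using assms(1) by (auto simp: L_chain_def)
  then show ?thesis
    using assms by (auto simp: L_chain_def nth_append last_conv_nth less_Suc_eq)
qed

text \<open>The regular part and the L^T chains pass through unchanged, as E already covers their
  codomain vectors; only N and L chains have an end that E misses. The sizes are given as lists, so
  that counting them later is mere computation.\<close>

lemma chain_basis_lift:
  assumes S: "subsystem PQ" and D: "chain_basis (red PQ) xs Ns Ls Ts"
  obtains Ns' Ls' where "chain_basis PQ xs Ns' Ls' Ts"
    "map (length \<circ> fst) Ns' = replicate (alpha_dim PQ) 1 @ map (Suc \<circ> length \<circ> fst) Ns"
    "map (length \<circ> snd) Ls' = replicate (beta_dim PQ) 1 @ map (Suc \<circ> length \<circ> snd) Ls"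
proof -
  obtain P Q where PQ: "PQ = (P, Q)" by fastforce
  define P' where "P' = fst (red PQ)"
  define Q' where "Q' = snd (red PQ)"
  define C where "C = Ns @ Ls"
  define bs where "bs = xs @ concat (map fst (Ns @ Ls @ Ts))"
  define cs where "cs = map E xs @ concat (map snd (Ns @ Ls @ Ts))"
  \<comment> \<open>\<open>cs1\<close> is going to span V'' = E M', and \<open>lasts\<close> a
    complement of it in V'.\<close>
  define lasts where "lasts = map (last \<circ> snd) C"
  define cs1 where "cs1 = map E xs @ concat (map (butlast \<circ> snd) C) @ concat (map snd Ts)"
  have P'_eq: "P' = {x \<in> P. A x \<in> E ` P}" and Q'_eq: "Q' = E ` P"
    by (simp_all add: P'_def Q'_def red_def PQ)
  have sub: "vs1.subspace P" "vs2.subspace Q" and fin: "vs1.finitely_spanned P" "vs2.finitely_spanned Q"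
    and EP: "E ` P \<subseteq> Q" and AP: "A ` P \<subseteq> Q"
    using S by (auto simp: subsystem_def PQ)
  have sub': "vs1.subspace P'" "vs2.subspace Q'"
    using subsystem_red[OF S] by (auto simp: subsystem_def P'_def Q'_def)
  have P'P: "P' \<subseteq> P"
    by (auto simp: P'_eq)
  have bs: "distinct bs" "vs1.independent (set bs)" "vs1.span (set bs) = P'"
    and cs: "distinct cs" "vs2.independent (set cs)" "vs2.span (set cs) = Q'"
    using D by (auto simp: chain_basis_def vs1.list_basis_def vs2.list_basis_def bs_def cs_def P'_def Q'_def)
  have C_ne: "snd p \<noteq> []" if "p \<in> set C" for p
    using D that by (cases p) (auto simp: C_def chain_basis_def list_all_iff N_chain_def L_chain_def)
  have "mset cs = mset (cs1 @ lasts)"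
    using mset_concat_butlast_last[of C, OF C_ne] by (simp add: cs_def cs1_def C_def lasts_def)
  then have "vs2.list_basis (cs1 @ lasts) Q'"
    using cs vs2.list_basis_mset_cong unfolding vs2.list_basis_def by metis
  then have lasts: "distinct lasts" "set cs1 \<inter> set lasts = {}" "vs2.independent (set cs1 \<union> set lasts)"
      "vs2.span (set cs1 \<union> set lasts) = Q'"
    by (auto simp: vs2.list_basis_def)
  have EP': "E ` P' = vs2.span (set cs1)"
  proof -
    have "E ` P' = vs2.span (E ` P')"
      using E.subspace_image[OF sub'(1)] vs2.span_eq_iff by metis
    then show ?thesis
      using chain_basis_E_image[OF D] by (simp add: P'_def cs1_def C_def)
  qed
  define pre where "pre y = (SOME x. x \<in> P \<and> E x = y)" for y
  have pre: "pre y \<in> P" "E (pre y) = y" if "y \<in> Q'" for y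
    using that someI_ex[of "\<lambda>x. x \<in> P \<and> E x = y"] by (auto simp: pre_def Q'_eq)
  have lasts_Q': "set lasts \<subseteq> Q'"
    using lasts(4) vs2.span_superset by blast
  have E_pre: "E ` pre ` set lasts = set lasts"
    using pre lasts_Q' by (force simp: image_iff)
  have inj_E: "inj_on E (pre ` set lasts)" and inj_pre: "inj_on pre (set lasts)"
    using pre lasts_Q' by (auto simp: inj_on_def) (metis subsetD)+
  \<comment> \<open>M' + ker E is the preimage of V'', so completing \<open>bs\<close> to a basis of
    it gives representatives \<open>Z\<close> of a basis of ker \<open>[E]\<close>. Taking
    \<open>Z\<close> from the union puts it inside ker E, because a vector of M' would depend on
    \<open>bs\<close>.\<close>
  define Z0 where "Z0 = P' \<union> {x \<in> P. E x = 0}"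
  have "Z0 \<subseteq> P" "set bs \<subseteq> Z0"
    using P'P bs(3) vs1.span_superset[of "set bs"] by (auto simp: Z0_def)
  then obtain Z where Z: "finite Z" "Z \<subseteq> Z0" "set bs \<inter> Z = {}" "vs1.independent (set bs \<union> Z)"
      "vs1.span (set bs \<union> Z) = vs1.span Z0"
    using vs1.independent_extend_within[OF vs1.finitely_spanned_mono[OF fin(1)] _ bs(2)] by metis
  have E_Z: "E z = 0" if "z \<in> Z" for z
  proof (rule ccontr)
    assume "E z \<noteq> 0"
    then have "z \<in> vs1.span (set bs)"
      using that Z(2) bs(3) by (auto simp: Z0_def)
    moreover have "z \<notin> set bs"
      using Z(3) that by blast
    then have "z \<notin> vs1.span (set bs)"
      using Z(4) that vs1.independent_insert[of z "set bs"]
        vs1.independent_mono[of "set bs \<union> Z" "insert z (set bs)"] by auto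
    ultimately show False by simp
  qed
  \<comment> \<open>These vectors span a complement of M' in M: \<open>Z\<close> accounts for ker
    \<open>[E]\<close>, the preimages for its image V'/V''.\<close>
  let ?X = "Z \<union> pre ` set lasts"
  have E_bsZ: "E ` (set bs \<union> Z) \<subseteq> vs2.span (set cs1)"
    using E_Z EP' bs(3) vs1.span_superset[of "set bs"] vs2.span_zero by auto
  have "vs1.independent (set bs \<union> Z \<union> pre ` set lasts) \<and> (set bs \<union> Z) \<inter> pre ` set lasts = {}"
    by (rule independent_preimage_modulo[OF linear_E _ _ _ inj_E Z(4) E_bsZ])
      (use lasts E_pre in auto)
  then have ind: "vs1.independent (set bs \<union> ?X)" and disj: "(set bs \<union> Z) \<inter> pre ` set lasts = {}"
    by (simp_all add: Un_assoc)
  have XP: "?X \<subseteq> P" "set bs \<subseteq> P"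
    using Z(2) \<open>Z0 \<subseteq> P\<close> \<open>set bs \<subseteq> Z0\<close> pre(1) lasts_Q' by auto
  have ker: "x \<in> vs1.span (set bs \<union> Z)" if "x \<in> P" "E x = 0" for x
    using that Z(5) vs1.span_superset[of Z0] by (auto simp: Z0_def)
  have span_P: "vs1.span (set bs \<union> ?X) = P"
  proof
    show "vs1.span (set bs \<union> ?X) \<subseteq> P"
      using XP sub(1) by (intro vs1.span_minimal) auto
    show "P \<subseteq> vs1.span (set bs \<union> ?X)"
    proof
      fix x assume x: "x \<in> P"
      have "vs2.span (set cs1 \<union> set lasts) \<subseteq> E ` vs1.span (set bs \<union> ?X)"
      proof (rule vs2.span_minimal)
        have "set cs1 \<subseteq> E ` vs1.span (set bs \<union> ?X)"
          using EP' bs(3) vs2.span_superset[of "set cs1"] vs1.span_mono[of "set bs" "set bs \<union> ?X"] by blast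
        moreover have "set lasts \<subseteq> E ` vs1.span (set bs \<union> ?X)"
          using E_pre vs1.span_superset[of "set bs \<union> ?X"] by (metis Un_upper2 image_mono subset_trans)
        ultimately show "set cs1 \<union> set lasts \<subseteq> E ` vs1.span (set bs \<union> ?X)" by simp
      qed (simp add: E.subspace_image)
      then obtain y where y: "y \<in> vs1.span (set bs \<union> ?X)" "E x = E y"
        using x lasts(4) Q'_eq by blast
      then have "y \<in> P"
        using \<open>vs1.span (set bs \<union> ?X) \<subseteq> P\<close> by blast
      then have "x - y \<in> vs1.span (set bs \<union> Z)"
        using ker[of "x - y"] x y sub(1) by (simp add: vs1.subspace_diff E.diff)
      then have "x - y \<in> vs1.span (set bs \<union> ?X)"
        using vs1.span_mono[of "set bs \<union> Z" "set bs \<union> ?X"] by blast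
      then show "x \<in> vs1.span (set bs \<union> ?X)"
        using y(1) vs1.span_add by fastforce
    qed
  qed
  \<comment> \<open>This is the injectivity of \<open>[A]\<close>: if \<open>u\<close> in M has
    \<open>A u\<close> in V', then \<open>u\<close> is in M' by the definition of M'.\<close>
  have "vs2.independent (set cs \<union> A ` ?X) \<and> set cs \<inter> A ` ?X = {} \<and> inj_on A ?X"
  proof (rule independent_image_modulo[OF linear_A _ ind _ cs(2)])
    fix u assume "u \<in> vs1.span ?X" "A u \<in> vs2.span (set cs)"
    moreover from this have "u \<in> P"
      using span_P vs1.span_mono[of ?X "set bs \<union> ?X"] by auto
    ultimately show "u \<in> vs1.span (set bs)"
      using bs(3) cs(3) Q'_eq P'_eq by auto
  qed (use Z(1,3) disj in auto)
  then have indA: "vs2.independent (set cs \<union> A ` ?X)" and disjA: "set cs \<inter> A ` ?X = {}"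
    and injA: "inj_on A ?X" by auto
  have "set cs \<union> A ` ?X \<subseteq> Q"
    using AP XP cs(3) vs2.span_superset[of "set cs"] Q'_eq EP by blast
  \<comment> \<open>\<open>W\<close> is a basis of a complement of V' + A M in V, so it represents
    coker \<open>[A]\<close>.\<close>
  then obtain W where W: "finite W" "W \<subseteq> Q" "(set cs \<union> A ` ?X) \<inter> W = {}"
      "vs2.independent (set cs \<union> A ` ?X \<union> W)" "vs2.span (set cs \<union> A ` ?X \<union> W) = Q"
    using vs2.independent_extend_subspace[OF fin(2) sub(2) _ indA] by metis
  obtain zs ws where zs: "set zs = Z" "distinct zs" and ws: "set ws = W" "distinct ws"
    using finite_distinct_list Z(1) W(1) by metis
  define ext where "ext p = (fst p @ [pre (last (snd p))], snd p @ [A (pre (last (snd p)))])" for p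
  define Ns' where "Ns' = map (\<lambda>z. ([z], [A z])) zs @ map ext Ns"
  define Ls' where "Ls' = map (\<lambda>w. ([], [w])) ws @ map ext Ls"
  have mset1: "mset (concat (map fst (map ext C'))) =
      mset (concat (map fst C')) + mset (map pre (map (last \<circ> snd) C'))" for C'
    by (induction C') (auto simp: ext_def)
  have mset2: "mset (concat (map snd (map ext C'))) =
      mset (concat (map snd C')) + mset (map A (map pre (map (last \<circ> snd) C')))" for C'
    by (induction C') (auto simp: ext_def)
  have basis1: "vs1.list_basis (xs @ concat (map fst (Ns' @ Ls' @ Ts))) P"
  proof (rule vs1.list_basisI_partition)
    have "concat (map (fst \<circ> (\<lambda>z. ([z], [A z]))) zs) = zs" "concat (map (fst \<circ> (\<lambda>w. ([], [w]))) ws) = []"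
      by (induction zs) (auto simp: o_def)
    then show "mset (xs @ concat (map fst (Ns' @ Ls' @ Ts))) = mset (bs @ (zs @ map pre lasts))"
      using mset1[of Ns] mset1[of Ls] by (simp add: Ns'_def Ls'_def bs_def lasts_def C_def)
  qed (use bs(1) zs lasts(1) inj_pre disj Z(3) ind span_P in \<open>auto simp: distinct_map\<close>)
  have basis2: "vs2.list_basis (map E xs @ concat (map snd (Ns' @ Ls' @ Ts))) Q"
  proof (rule vs2.list_basisI_partition)
    have "concat (map (snd \<circ> (\<lambda>z. ([z], [A z]))) zs) = map A zs" "concat (map (snd \<circ> (\<lambda>w. ([] :: 'b list, [w]))) ws) = ws"
      by (induction zs, auto, induction ws, auto)
    then show "mset (map E xs @ concat (map snd (Ns' @ Ls' @ Ts))) = mset (cs @ (map A (zs @ map pre lasts) @ ws))"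
      using mset2[of Ns] mset2[of Ls] by (simp add: Ns'_def Ls'_def cs_def lasts_def C_def)
    have "distinct (zs @ map pre lasts)"
      using zs lasts(1) inj_pre disj by (auto simp: distinct_map)
    moreover have "set (zs @ map pre lasts) = ?X"
      using zs by simp
    ultimately have "distinct (map A (zs @ map pre lasts))" "set (map A (zs @ map pre lasts)) = A ` ?X"
      using injA by (simp_all only: distinct_map set_map)
    then show "distinct (map A (zs @ map pre lasts) @ ws)" "set cs \<inter> set (map A (zs @ map pre lasts) @ ws) = {}"
      "vs2.independent (set cs \<union> set (map A (zs @ map pre lasts) @ ws))"
      "vs2.span (set cs \<union> set (map A (zs @ map pre lasts) @ ws)) = Q"
      using ws W(3-5) disjA by (auto simp: Un_assoc simp del: map_append set_map)
  qed (rule cs(1))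
  have lastQ': "last (snd p) \<in> Q'" if "p \<in> set C" for p
    using lasts_Q' that by (auto simp: lasts_def)
  have chainsN: "N_chain (ext p)" if "p \<in> set Ns" for p
    using that D chain_append_N[of "fst p" "snd p"] pre(2)[OF lastQ'[of p]]
    by (auto simp: ext_def C_def chain_basis_def list_all_iff)
  have chainsL: "L_chain (ext p)" if "p \<in> set Ls" for p
    using that D chain_append_L[of "fst p" "snd p"] pre(2)[OF lastQ'[of p]]
    by (auto simp: ext_def C_def chain_basis_def list_all_iff)
  have chain: "chain_basis PQ xs Ns' Ls' Ts"
    unfolding chain_basis_def
  proof (intro conjI)
    show "list_all N_chain Ns'"
      unfolding Ns'_def list_all_iff set_append set_map zs(1)
      using chainsN E_Z by auto (simp add: N_chain_def)
    show "list_all L_chain Ls'"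
      unfolding Ls'_def list_all_iff set_append set_map
      using chainsL by auto (simp add: L_chain_def)
  qed (use basis1 basis2 D in \<open>auto simp: PQ chain_basis_def\<close>)
  have "{x \<in> P. E x \<in> E ` P'} = vs1.span (set bs \<union> Z)"
  proof
    show "{x \<in> P. E x \<in> E ` P'} \<subseteq> vs1.span (set bs \<union> Z)"
    proof clarify
      fix x y assume "x \<in> P" "y \<in> P'" "E x = E y"
      then have "x - y \<in> vs1.span (set bs \<union> Z)" "y \<in> vs1.span (set bs \<union> Z)"
        using ker[of "x - y"] P'P sub(1) bs(3) vs1.span_mono[of "set bs" "set bs \<union> Z"]
        by (auto simp: vs1.subspace_diff E.diff)
      then show "x \<in> vs1.span (set bs \<union> Z)"
        using vs1.span_add by fastforce
    qed
    have "E ` vs1.span (set bs \<union> Z) \<subseteq> E ` P'"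
      using E_bsZ EP' by (simp add: E.span_image[symmetric] vs2.span_minimal)
    moreover have "vs1.span (set bs \<union> Z) \<subseteq> P"
      using XP sub(1) by (intro vs1.span_minimal) auto
    ultimately show "vs1.span (set bs \<union> Z) \<subseteq> {x \<in> P. E x \<in> E ` P'}" by blast
  qed
  then have "alpha_dim PQ = card (set bs \<union> Z) - card (set bs)"
    using vs1.dim_span_eq_card_independent[OF Z(4)] vs1.dim_span_eq_card_independent[OF bs(2)] bs(3)
    by (simp add: alpha_dim_def PQ P'_def)
  then have a: "alpha_dim PQ = length zs"
    using Z(1,3) zs(1) distinct_card[OF zs(2)] by (simp add: card_Un_disjoint)
  have "{E x + A y | x y. x \<in> P \<and> y \<in> P} = vs2.span (set cs \<union> A ` ?X)"
  proof -
    have A_bs: "A ` set bs \<subseteq> Q'"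
      using bs(3) vs1.span_superset[of "set bs"] by (auto simp: P'_eq Q'_eq)
    have "{E x + A y | x y. x \<in> P \<and> y \<in> P} = {x + y | x y. x \<in> vs2.span (set cs) \<and> y \<in> A ` vs1.span (set bs \<union> ?X)}"
      unfolding span_P cs(3) Q'_eq by blast
    also have "\<dots> = vs2.span (set cs \<union> A ` (set bs \<union> ?X))"
      by (simp only: A.span_image[symmetric] vs2.span_Un)
    \<comment> \<open>The images of \<open>bs\<close> are redundant, since A maps M' into
      V'.\<close>
    also have "\<dots> = vs2.span (set cs \<union> A ` ?X)"
    proof (rule vs2.span_eq[THEN iffD2], intro conjI)
      have "A ` set bs \<subseteq> vs2.span (set cs \<union> A ` ?X)"
        using A_bs cs(3) vs2.span_mono[of "set cs" "set cs \<union> A ` ?X"] by blast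
      then show "set cs \<union> A ` (set bs \<union> ?X) \<subseteq> vs2.span (set cs \<union> A ` ?X)"
        using vs2.span_superset[of "set cs \<union> A ` ?X"] by (auto simp: image_Un)
      show "set cs \<union> A ` ?X \<subseteq> vs2.span (set cs \<union> A ` (set bs \<union> ?X))"
        using vs2.span_superset[of "set cs \<union> A ` (set bs \<union> ?X)"] by (auto simp: image_Un)
    qed
    finally show ?thesis .
  qed
  then have "beta_dim PQ = card (set cs \<union> A ` ?X \<union> W) - card (set cs \<union> A ` ?X)"
    using vs2.dim_span_eq_card_independent[OF W(4)] vs2.dim_span_eq_card_independent[OF indA] W(5)
    by (simp add: beta_dim_def PQ)
  then have b: "beta_dim PQ = length ws"
    using Z(1) W(1,3) ws(1) distinct_card[OF ws(2)] by (simp add: card_Un_disjoint)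
  show thesis
  proof (rule that[OF chain])
    show "map (length \<circ> fst) Ns' = replicate (alpha_dim PQ) 1 @ map (Suc \<circ> length \<circ> fst) Ns"
      by (simp add: a Ns'_def ext_def o_def map_replicate_const)
    show "map (length \<circ> snd) Ls' = replicate (beta_dim PQ) 1 @ map (Suc \<circ> length \<circ> snd) Ls"
      by (simp add: b Ls'_def ext_def o_def map_replicate_const)
  qed
qed

end

section \<open>Undoing all reductions and counting the blocks by size\<close>

lemma count_list_replicate: "count_list (replicate n x) y = (if x = y then n else 0)"
  by (induction n) auto

lemma count_list_map_Suc: "count_list (map Suc ns) (Suc m) = count_list ns m"
  by (induction ns) auto

context pencil
begin

text \<open>At the fixed point there are no N and L chains. The blocks of size k + 1 in the result
  are therefore those that the lifting from stage k + 1 to stage k creates with size 1 and the k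
  later liftings lengthen. At the fixed point itself both dimensions vanish, which is the base case
  and covers all k from \<open>n\<close> on.\<close>

lemma chain_basis_unreduce:
  assumes "subsystem PQ" "red ((red ^^ n) PQ) = (red ^^ n) PQ" "chain_basis ((red ^^ n) PQ) xs [] [] Ts"
  shows "\<exists>Ns Ls. chain_basis PQ xs Ns Ls Ts \<and>
    (\<forall>k. count_list (map (length \<circ> fst) Ns) (Suc k) = alpha_dim ((red ^^ k) PQ) \<and>
         count_list (map (length \<circ> snd) Ls) (Suc k) = beta_dim ((red ^^ k) PQ))"
  using assms
proof (induction n arbitrary: PQ)
  case 0
  have fix_k: "(red ^^ k) PQ = PQ" for k
    using 0(2) by (induction k) auto
  obtain P Q where PQ: "PQ = (P, Q)" by fastforce
  have red: "{x \<in> P. A x \<in> E ` P} = P" "E ` P = Q"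
    using 0(2) by (auto simp: red_def PQ)
  have "{x \<in> P. E x \<in> E ` P} = P"
    by auto
  then have "alpha_dim PQ = 0"
    using 0(2) unfolding alpha_dim_def by (simp add: PQ)
  moreover have "{E x + A y | x y. x \<in> P \<and> y \<in> P} = Q"
  proof
    show "{E x + A y | x y. x \<in> P \<and> y \<in> P} \<subseteq> Q"
    proof clarify
      fix x y assume "x \<in> P" "y \<in> P"
      then show "E x + A y \<in> Q"
        using 0(1) by (intro vs2.subspace_add) (auto simp: subsystem_def PQ)
    qed
    have "E x = E x + A 0" "0 \<in> P" for x
      using 0(1) vs1.subspace_0 by (auto simp: subsystem_def PQ)
    then show "Q \<subseteq> {E x + A y | x y. x \<in> P \<and> y \<in> P}"
      unfolding red(2)[symmetric] by blast
  qed
  then have "beta_dim PQ = 0"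
    unfolding beta_dim_def by (simp add: PQ)
  ultimately show ?case
    using 0(3) fix_k by (intro exI[of _ "[]"]) simp
next
  case (Suc n)
  have "subsystem (red PQ)" "red ((red ^^ n) (red PQ)) = (red ^^ n) (red PQ)"
    "chain_basis ((red ^^ n) (red PQ)) xs [] [] Ts"
    using Suc.prems subsystem_red by (simp_all add: funpow_swap1)
  then obtain Ns Ls where IH: "chain_basis (red PQ) xs Ns Ls Ts"
    "\<And>k. count_list (map (length \<circ> fst) Ns) (Suc k) = alpha_dim ((red ^^ k) (red PQ))"
    "\<And>k. count_list (map (length \<circ> snd) Ls) (Suc k) = beta_dim ((red ^^ k) (red PQ))"
    using Suc.IH[of "red PQ"] by blast
  obtain Ns' Ls' where lift: "chain_basis PQ xs Ns' Ls' Ts"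
    "map (length \<circ> fst) Ns' = replicate (alpha_dim PQ) 1 @ map Suc (map (length \<circ> fst) Ns)"
    "map (length \<circ> snd) Ls' = replicate (beta_dim PQ) 1 @ map Suc (map (length \<circ> snd) Ls)"
    using chain_basis_lift[OF Suc.prems(1) IH(1)] by (auto simp: o_assoc)
  \<comment> \<open>No chain has size 0, so after the shift none has size 1: the blocks of size 1
    are exactly the new ones.\<close>
  have pos: "count_list (map (length \<circ> fst) Ns) 0 = 0" "count_list (map (length \<circ> snd) Ls) 0 = 0"
    using IH(1) by (auto simp: chain_basis_def list_all_iff N_chain_def L_chain_def count_list_0_iff)
  have "count_list (map (length \<circ> fst) Ns') (Suc k) = alpha_dim ((red ^^ k) PQ) \<and>
      count_list (map (length \<circ> snd) Ls') (Suc k) = beta_dim ((red ^^ k) PQ)" for k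
    unfolding lift(2,3) count_list_append count_list_replicate count_list_map_Suc
    using IH(2,3) pos by (cases k) (simp_all add: funpow_swap1)
  then show ?case
    using lift(1) by blast
qed

lemma red_fixpoint: "subsystem PQ \<Longrightarrow> \<exists>n. red ((red ^^ n) PQ) = (red ^^ n) PQ"
proof (induction "vs1.dim (fst PQ) + vs2.dim (snd PQ)" arbitrary: PQ rule: less_induct)
  case less
  show ?case
  proof (cases "red PQ = PQ")
    case True
    then show ?thesis by (intro exI[of _ 0]) simp
  next
    case False
    have sub: "fst (red PQ) \<subseteq> fst PQ" "snd (red PQ) \<subseteq> snd PQ"
      using less.prems by (auto simp: red_def subsystem_def)
    have "vs1.dim (fst (red PQ)) < vs1.dim (fst PQ)" if "fst (red PQ) \<noteq> fst PQ"
      by (rule vs1.finitely_spanned_dim_strict)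
        (use sub that less.prems subsystem_red[OF less.prems] in \<open>auto simp: subsystem_def\<close>)
    moreover have "vs2.dim (snd (red PQ)) < vs2.dim (snd PQ)" if "snd (red PQ) \<noteq> snd PQ"
      by (rule vs2.finitely_spanned_dim_strict)
        (use sub that less.prems subsystem_red[OF less.prems] in \<open>auto simp: subsystem_def\<close>)
    moreover have "fst (red PQ) \<noteq> fst PQ \<or> snd (red PQ) \<noteq> snd PQ"
      using False by (simp add: prod_eq_iff)
    ultimately have "vs1.dim (fst (red PQ)) + vs2.dim (snd (red PQ)) < vs1.dim (fst PQ) + vs2.dim (snd PQ)"
      by (cases "fst (red PQ) = fst PQ"; cases "snd (red PQ) = snd PQ") auto
    then obtain n where "red ((red ^^ n) (red PQ)) = (red ^^ n) (red PQ)"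
      using less.hyps[OF _ subsystem_red[OF less.prems]] by auto
    then show ?thesis
      by (intro exI[of _ "Suc n"]) (simp add: funpow_swap1)
  qed
qed

lemma fst_red_funpow_subset: "fst ((red ^^ k) PQ) \<subseteq> fst PQ"
  by (induction k) (auto simp: red_def)

text \<open>At the fixed point an injective E is also onto, so any basis there together with its
  images is a regular part. There are no N chains because ker \<open>[E]\<close> vanishes at each
  stage: \<open>E x\<close> in E M' forces \<open>x\<close> in M'.\<close>

lemma chain_basis_E_injective:
  assumes S: "subsystem PQ" and inj: "inj_on E (fst PQ)"
  obtains xs Ls where "chain_basis PQ xs [] Ls []"
    "\<And>k. count_list (map (length \<circ> snd) Ls) (Suc k) = beta_dim ((red ^^ k) PQ)"
proof -
  obtain n where n: "red ((red ^^ n) PQ) = (red ^^ n) PQ"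
    using red_fixpoint[OF S] by blast
  obtain P Q where PQ: "(red ^^ n) PQ = (P, Q)" by fastforce
  have red: "{x \<in> P. A x \<in> E ` P} = P" "E ` P = Q"
    using n by (auto simp: red_def PQ)
  obtain xs where xs: "vs1.list_basis xs P"
    using vs1.list_basis_exists subsystem_red_funpow[OF S, of n] by (auto simp: subsystem_def PQ)
  have xsP: "vs1.span (set xs) = P" "set xs \<subseteq> P"
    using xs vs1.span_superset[of "set xs"] by (auto simp: vs1.list_basis_def)
  have injP: "inj_on E P"
    using inj_on_subset[OF inj fst_red_funpow_subset[of n]] by (simp add: PQ)
  have "vs2.list_basis (map E xs) Q"
    using xs xsP injP red(2) E.independent_injective_image[of "set xs"] inj_on_subset[OF injP xsP(2)]
    by (simp add: vs1.list_basis_def vs2.list_basis_def distinct_map E.span_image)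
  moreover have "A ` set xs \<subseteq> vs2.span (E ` set xs)"
    using xsP red by (auto simp: E.span_image)
  ultimately have "chain_basis ((red ^^ n) PQ) xs [] [] []"
    using xs by (simp add: chain_basis_def PQ)
  then obtain Ns Ls where D: "chain_basis PQ xs Ns Ls []"
    "\<And>k. count_list (map (length \<circ> fst) Ns) (Suc k) = alpha_dim ((red ^^ k) PQ)"
    "\<And>k. count_list (map (length \<circ> snd) Ls) (Suc k) = beta_dim ((red ^^ k) PQ)"
    using chain_basis_unreduce[OF S n] by blast
  have "alpha_dim ((red ^^ k) PQ) = 0" for k
  proof -
    define R where "R = fst ((red ^^ k) PQ)"
    have "{x \<in> R. E x \<in> E ` fst (red ((red ^^ k) PQ))} = fst (red ((red ^^ k) PQ))"
      using inj_on_subset[OF inj fst_red_funpow_subset[of k]] unfolding R_def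
      by (auto simp: red_def inj_on_def)
    then show ?thesis
      by (simp add: alpha_dim_def R_def)
  qed
  then have "Suc k \<notin> set (map (length \<circ> fst) Ns)" for k
    using D(2) by (simp only: count_list_0_iff[symmetric])
  moreover have "0 \<notin> set (map (length \<circ> fst) Ns)"
    using D(1) by (auto simp: chain_basis_def list_all_iff N_chain_def)
  ultimately have "set (map (length \<circ> fst) Ns) = {}"
    by (metis equals0I not0_implies_Suc)
  then show thesis
    using that D by simp
qed

end

section \<open>Functionals and dual bases\<close>

text \<open>Functions into the field are an ambient space in two roles: as the functionals of a dual
  pencil, and as the coordinate vectors of a carrier-based space.\<close>

definition fun_scale :: "'a::field \<Rightarrow> ('x \<Rightarrow> 'a) \<Rightarrow> 'x \<Rightarrow> 'a" where
  "fun_scale c f = (\<lambda>x. c * f x)"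

global_interpretation fun_space: ambient "fun_scale :: 'a::field \<Rightarrow> ('x \<Rightarrow> 'a) \<Rightarrow> 'x \<Rightarrow> 'a"
  by unfold_locales (auto simp: fun_scale_def algebra_simps fun_eq_iff)

lemma sum_fun_apply: "(\<Sum>i\<in>I. f i) x = (\<Sum>i\<in>I. f i x)" for f :: "_ \<Rightarrow> _ \<Rightarrow> 'a::comm_monoid_add"
  by (induction I rule: infinite_finite_induct) auto

context ambient
begin

text \<open>Functionals on \<open>P\<close> are made unique by the value 0 outside of \<open>P\<close>.\<close>

definition functionals :: "'b set \<Rightarrow> ('b \<Rightarrow> 'a) set" where
  "functionals P = {\<phi>. (\<forall>x\<in>P. \<forall>y\<in>P. \<phi> (x + y) = \<phi> x + \<phi> y) \<and>
     (\<forall>c. \<forall>x\<in>P. \<phi> (scale c x) = c * \<phi> x) \<and> (\<forall>x. x \<notin> P \<longrightarrow> \<phi> x = 0)}"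

text \<open>For a basis \<open>B\<close> these form the dual basis. As \<open>representation\<close>
  is 0 outside the span, they obey the convention for functionals without a further
  restriction.\<close>

definition coordinate :: "'b set \<Rightarrow> 'b \<Rightarrow> 'b \<Rightarrow> 'a" where
  "coordinate B b = (\<lambda>x. representation B x b)"

lemma functional_add: "\<phi> \<in> functionals P \<Longrightarrow> x \<in> P \<Longrightarrow> y \<in> P \<Longrightarrow> \<phi> (x + y) = \<phi> x + \<phi> y"
  by (auto simp: functionals_def)

lemma functional_scale: "\<phi> \<in> functionals P \<Longrightarrow> x \<in> P \<Longrightarrow> \<phi> (scale c x) = c * \<phi> x"
  by (auto simp: functionals_def)

lemma functional_outside: "\<phi> \<in> functionals P \<Longrightarrow> x \<notin> P \<Longrightarrow> \<phi> x = 0"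
  by (auto simp: functionals_def)

lemma functional_zero: "\<phi> \<in> functionals P \<Longrightarrow> subspace P \<Longrightarrow> \<phi> 0 = 0"
  using functional_scale[of \<phi> P 0 0] subspace_0[of P] by simp

lemma functional_sum:
  assumes "\<phi> \<in> functionals P" "subspace P" "\<And>i. i \<in> I \<Longrightarrow> g i \<in> P"
  shows "\<phi> (\<Sum>i\<in>I. scale (c i) (g i)) = (\<Sum>i\<in>I. c i * \<phi> (g i))"
  using assms(3)
proof (induction I rule: infinite_finite_induct)
  case (insert i I)
  have "(\<Sum>i\<in>I. scale (c i) (g i)) \<in> P" "scale (c i) (g i) \<in> P"
    using insert.prems assms(2) by (auto intro!: subspace_sum subspace_scale)
  then show ?case
    using insert assms(1) by (simp add: functional_add functional_scale)
qed (use functional_zero[OF assms(1,2)] in auto)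

lemma subspace_functionals: "fun_space.subspace (functionals P)"
  by (rule fun_space.subspaceI) (auto simp: functionals_def fun_scale_def algebra_simps)

context
  fixes B P
  assumes B: "finite B" "independent B" "span B = P"
begin

lemma coordinate_functional: "coordinate B b \<in> functionals P"
proof -
  have "representation B x b = 0" if "x \<notin> P" for x
    using that B(3) by (simp add: representation_def)
  moreover have "x + y \<in> P" "scale c x \<in> P" if "x \<in> P" "y \<in> P" for x y c
    using that B(3) span_add span_scale by auto
  ultimately show ?thesis
    using B(2,3) by (auto simp: functionals_def coordinate_def representation_add representation_scale)
qed

lemma coordinate_expansion:
  assumes "x \<in> P"
  shows "x = (\<Sum>b\<in>B. scale (coordinate B b x) b)"
  using sum_representation_eq[of B x B] B assms by (simp add: coordinate_def)

lemma functional_expansion: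
  assumes "\<phi> \<in> functionals P"
  shows "\<phi> = (\<Sum>b\<in>B. fun_scale (\<phi> b) (coordinate B b))"
proof
  fix x
  have sub: "subspace P" "\<And>b. b \<in> B \<Longrightarrow> b \<in> P"
    using B span_superset[of B] by auto
  show "\<phi> x = (\<Sum>b\<in>B. fun_scale (\<phi> b) (coordinate B b)) x"
  proof (cases "x \<in> P")
    case True
    have "\<phi> x = \<phi> (\<Sum>b\<in>B. scale (coordinate B b x) b)"
      using coordinate_expansion[OF True] by simp
    then show ?thesis
      using functional_sum[OF assms sub(1), of B "\<lambda>b. b"] sub(2)
      by (simp add: sum_fun_apply fun_scale_def mult.commute)
  next
    case False
    then show ?thesis
      using functional_outside[OF assms] functional_outside[OF coordinate_functional]
      by (simp add: sum_fun_apply fun_scale_def)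
  qed
qed

lemma finitely_spanned_functionals: "fun_space.finitely_spanned (functionals P)"
proof -
  have "functionals P \<subseteq> fun_space.span (coordinate B ` B)"
  proof
    fix \<phi> assume "\<phi> \<in> functionals P"
    then show "\<phi> \<in> fun_space.span (coordinate B ` B)"
      by (subst functional_expansion)
        (auto intro: fun_space.span_sum fun_space.span_scale fun_space.span_base)
  qed
  then show ?thesis
    using B(1) by (auto simp: fun_space.finitely_spanned_def)
qed

end

text \<open>Every basis of the dual of a finite-dimensional space is dual to a basis of that space.
  The latter is indexed by the functionals themselves, and \<open>w\<close> is total with values in
  \<open>P\<close>, so that chains of functionals can be translated entry by entry.\<close>

lemma predual_basis:
  assumes P: "finitely_spanned P" "subspace P" and ds: "fun_space.list_basis ds (functionals P)"
  shows "\<exists>w. (\<forall>\<delta>. w \<delta> \<in> P) \<and>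
    (\<forall>\<delta>\<in>set ds. \<forall>\<delta>'\<in>set ds. \<delta>' (w \<delta>) = (if \<delta>' = \<delta> then 1 else 0)) \<and>
    (\<forall>x\<in>P. x = (\<Sum>\<delta>\<in>set ds. scale (\<delta> x) (w \<delta>))) \<and> list_basis (map w ds) P"
proof -
  obtain qs where qs: "list_basis qs P"
    using list_basis_exists[OF P] .
  define B where "B = set qs"
  have B: "finite B" "independent B" "span B = P"
    using qs by (auto simp: B_def list_basis_def)
  have BP: "b \<in> P" if "b \<in> B" for b
    using B(3) that span_superset[of B] by auto
  have D: "finite (set ds)" "fun_space.independent (set ds)" "fun_space.span (set ds) = functionals P" "distinct ds"
    using ds by (auto simp: fun_space.list_basis_def)
  have dsP: "\<delta> \<in> functionals P" if "\<delta> \<in> set ds" for \<delta>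
    using D(3) that fun_space.span_superset[of "set ds"] by auto
  \<comment> \<open>Evaluation at \<open>w \<delta>\<close> is the \<open>\<delta>\<close>-coordinate of a functional with respect to \<open>ds\<close>.\<close>
  define w where "w \<delta> = (\<Sum>b\<in>B. scale (fun_space.representation (set ds) (coordinate B b) \<delta>) b)" for \<delta>
  have wP: "w \<delta> \<in> P" for \<delta>
    unfolding w_def using BP P(2) by (intro subspace_sum subspace_scale)
  have pair: "\<delta>' (w \<delta>) = (if \<delta>' = \<delta> then 1 else 0)" if "\<delta> \<in> set ds" "\<delta>' \<in> set ds" for \<delta> \<delta>'
  proof -
    have "\<delta>' (w \<delta>) = (\<Sum>b\<in>B. fun_space.representation (set ds) (coordinate B b) \<delta> * \<delta>' b)"
      unfolding w_def by (rule functional_sum[OF dsP[OF that(2)] P(2) BP])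
    also have "\<dots> = fun_space.representation (set ds) (\<Sum>b\<in>B. fun_scale (\<delta>' b) (coordinate B b)) \<delta>"
      using coordinate_functional[OF B] D(2,3)
      by (subst fun_space.representation_sum)
        (auto simp: fun_space.representation_scale fun_space.subspace_scale[OF subspace_functionals] mult.commute
          intro!: sum.cong)
    also have "\<dots> = fun_space.representation (set ds) \<delta>' \<delta>"
      using functional_expansion[OF B dsP[OF that(2)]] by simp
    finally show ?thesis
      using fun_space.representation_basis[OF D(2) that(2)] by simp
  qed
  have delta: "(\<Sum>\<delta>'\<in>set ds. c \<delta>' * \<delta> (w \<delta>')) = c \<delta>" if "\<delta> \<in> set ds" for c \<delta>
  proof -
    have "(\<Sum>\<delta>'\<in>set ds. c \<delta>' * \<delta> (w \<delta>')) = (\<Sum>\<delta>'\<in>set ds. if \<delta>' = \<delta> then c \<delta>' else 0)"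
      using pair[OF _ that] by (intro sum.cong) auto
    then show ?thesis
      using that D(1) by simp
  qed
  \<comment> \<open>The functionals in \<open>ds\<close> separate points because they span the
    coordinate functionals.\<close>
  have separate: "x = y" if "x \<in> P" "y \<in> P" "\<And>\<delta>. \<delta> \<in> set ds \<Longrightarrow> \<delta> x = \<delta> y" for x y
  proof -
    have "coordinate B b x = coordinate B b y" for b
    proof -
      have "(\<Sum>\<delta>\<in>set ds. fun_scale (fun_space.representation (set ds) (coordinate B b) \<delta>) \<delta>) = coordinate B b"
        using coordinate_functional[OF B, of b] D by (intro fun_space.sum_representation_eq) auto
      then have "coordinate B b z = (\<Sum>\<delta>\<in>set ds. fun_space.representation (set ds) (coordinate B b) \<delta> * \<delta> z)" for z
        by (metis (no_types, lifting) fun_scale_def sum.cong sum_fun_apply)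
      then show ?thesis
        by (simp only:) (intro sum.cong refl arg_cong2[of _ _ _ _ "(*)"] that(3))
    qed
    then show ?thesis
      using coordinate_expansion[OF B that(1)] coordinate_expansion[OF B that(2)] by simp
  qed
  have expand: "x = (\<Sum>\<delta>\<in>set ds. scale (\<delta> x) (w \<delta>))" if "x \<in> P" for x
  proof (rule separate[OF that])
    show "(\<Sum>\<delta>\<in>set ds. scale (\<delta> x) (w \<delta>)) \<in> P"
      using wP P(2) by (intro subspace_sum subspace_scale)
    show "\<delta> x = \<delta> (\<Sum>\<delta>\<in>set ds. scale (\<delta> x) (w \<delta>))" if "\<delta> \<in> set ds" for \<delta>
      using functional_sum[OF dsP[OF that] P(2), of "set ds" w] wP delta[OF that] by simp
  qed
  have inj: "inj_on w (set ds)"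
    using pair by (metis inj_onI zero_neq_one)
  have "independent (w ` set ds)"
  proof (rule independent_if_scalars_zero)
    fix f x assume *: "(\<Sum>x\<in>w ` set ds. scale (f x) x) = 0" "x \<in> w ` set ds"
    then obtain \<delta> where \<delta>: "\<delta> \<in> set ds" "x = w \<delta>" by blast
    have "0 = \<delta> (\<Sum>\<delta>\<in>set ds. scale (f (w \<delta>)) (w \<delta>))"
      using *(1) functional_zero[OF dsP[OF \<delta>(1)] P(2)] by (simp add: sum.reindex[OF inj])
    also have "\<dots> = f x"
      using functional_sum[OF dsP[OF \<delta>(1)] P(2), of "set ds" w] wP delta[OF \<delta>(1)] \<delta>(2) by simp
    finally show "f x = 0" ..
  qed simp
  moreover have "span (w ` set ds) = P"
  proof
    show "span (w ` set ds) \<subseteq> P"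
      using wP P(2) by (intro span_minimal) auto
    show "P \<subseteq> span (w ` set ds)"
    proof
      fix x assume "x \<in> P"
      then show "x \<in> span (w ` set ds)"
        by (subst expand) (auto intro: span_sum span_scale span_base)
    qed
  qed
  ultimately have "list_basis (map w ds) P"
    using D(4) inj by (simp add: list_basis_def distinct_map)
  then show ?thesis
    using wP pair expand by (intro exI[of _ w]) blast
qed

end

lemma distinct_concat_map_unique:
  assumes "distinct (concat (map f ps))" "p \<in> set ps" "q \<in> set ps" "x \<in> set (f p)" "x \<in> set (f q)"
  shows "p = q"
  using assms by (induction ps) auto

section \<open>Pencils with surjective \<open>E\<close> through the dual pencil\<close>

text \<open>The adjoint. The value 0 off \<open>P\<close> follows the convention for functionals on
  \<open>P\<close>; linearity holds on the whole function type, as \<open>pencil\<close>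
  requires.\<close>

definition transpose_on :: "'b set \<Rightarrow> ('b \<Rightarrow> 'c) \<Rightarrow> ('c \<Rightarrow> 'a::zero) \<Rightarrow> 'b \<Rightarrow> 'a" where
  "transpose_on P f \<phi> = (\<lambda>x. if x \<in> P then \<phi> (f x) else 0)"

lemma linear_transpose_on: "Vector_Spaces.linear fun_scale fun_scale (transpose_on P f)"
  by (simp add: Vector_Spaces.linear_iff fun_space.vector_space_axioms)
    (auto simp: transpose_on_def fun_scale_def fun_eq_iff)

lemma pencil_transpose_on: "pencil fun_scale fun_scale (transpose_on P f) (transpose_on P g)"
  by (intro pencil.intro ambient_pair.intro pencil_axioms.intro linear_transpose_on
      fun_space.ambient_axioms)

context pencil
begin

lemma subsystem_dual:
  assumes S: "subsystem (P, Q)"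
  shows "pencil.subsystem fun_scale fun_scale (transpose_on P E) (transpose_on P A)
    (vs2.functionals Q, vs1.functionals P)"
proof -
  interpret D: pencil fun_scale fun_scale "transpose_on P E" "transpose_on P A"
    by (rule pencil_transpose_on)
  have sub: "vs1.subspace P" "vs2.subspace Q" "E ` P \<subseteq> Q" "A ` P \<subseteq> Q"
    and fin: "vs1.finitely_spanned P" "vs2.finitely_spanned Q"
    using S by (auto simp: subsystem_def)
  obtain bs cs where "vs1.list_basis bs P" "vs2.list_basis cs Q"
    using vs1.list_basis_exists vs2.list_basis_exists sub fin by metis
  then have "fun_space.finitely_spanned (vs1.functionals P)" "fun_space.finitely_spanned (vs2.functionals Q)"
    using vs1.finitely_spanned_functionals[of "set bs"] vs2.finitely_spanned_functionals[of "set cs"]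
    by (auto simp: vs1.list_basis_def vs2.list_basis_def)
  moreover have "transpose_on P f \<phi> \<in> vs1.functionals P"
    if f: "Vector_Spaces.linear s1 s2 f" "f ` P \<subseteq> Q" and \<phi>: "\<phi> \<in> vs2.functionals Q" for f \<phi>
  proof -
    interpret f: Vector_Spaces.linear s1 s2 f by (rule f(1))
    have "f x \<in> Q" if "x \<in> P" for x
      using f(2) that by auto
    then show ?thesis
      using \<phi> sub(1) by (auto simp: vs1.functionals_def transpose_on_def f.add f.scale
          vs2.functional_add vs2.functional_scale vs1.subspace_add vs1.subspace_scale)
  qed
  ultimately show ?thesis
    using sub linear_E linear_A vs1.subspace_functionals vs2.subspace_functionals
    by (auto simp: D.subsystem_def)
qed

text \<open>Surjective E makes \<open>DE\<close> injective, so
  \<open>chain_basis_E_injective\<close> yields a regular part and L chains of functionals. There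
  \<open>DE\<close> and \<open>DA\<close> send \<open>u_i\<close> to \<open>v_i\<close> and to
  \<open>v_(i+1)\<close>. Hence E sends the predual vector of \<open>v_i\<close> to that of
  \<open>u_i\<close>, and that of the last entry of \<open>v\<close> to 0; A sends the predual
  vector of \<open>v_(i+1)\<close> to that of \<open>u_i\<close>, and that of \<open>v_0\<close> to
  0. This is an L^T chain with the roles of \<open>u\<close> and \<open>v\<close> exchanged and the
  same index.\<close>

lemma chain_basis_E_surjective:
  fixes P Q
  defines "DE \<equiv> transpose_on P E" and "DA \<equiv> transpose_on P A"
  assumes S: "subsystem (P, Q)" and surj: "E ` P = Q"
  obtains xs Ts where "chain_basis (P, Q) xs [] [] Ts"
    "\<And>k. count_list (map (length \<circ> fst) Ts) (Suc k) =
      pencil.beta_dim fun_scale DE DA ((pencil.red DE DA ^^ k) (vs2.functionals Q, vs1.functionals P))"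
proof -
  interpret D: pencil fun_scale fun_scale DE DA
    unfolding DE_def DA_def by (rule pencil_transpose_on)
  have sub: "vs1.subspace P" "vs2.subspace Q" "E ` P \<subseteq> Q" "A ` P \<subseteq> Q"
    and fin: "vs1.finitely_spanned P" "vs2.finitely_spanned Q"
    using S by (auto simp: subsystem_def)
  have DS: "D.subsystem (vs2.functionals Q, vs1.functionals P)"
    unfolding DE_def DA_def by (rule subsystem_dual[OF S])
  have inj: "inj_on DE (vs2.functionals Q)"
  proof (rule inj_onI)
    fix \<phi> \<psi> assume *: "\<phi> \<in> vs2.functionals Q" "\<psi> \<in> vs2.functionals Q" "DE \<phi> = DE \<psi>"
    show "\<phi> = \<psi>"
    proof
      fix y
      show "\<phi> y = \<psi> y"
      proof (cases "y \<in> Q")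
        case True
        then obtain x where x: "x \<in> P" "y = E x"
          using surj by blast
        then show ?thesis
          using fun_cong[OF *(3), of x] by (simp add: DE_def transpose_on_def)
      qed (use * vs2.functional_outside in metis)
    qed
  qed
  obtain us Ls where D: "D.chain_basis (vs2.functionals Q, vs1.functionals P) us [] Ls []"
    and counts: "\<And>k. count_list (map (length \<circ> snd) Ls) (Suc k) =
      D.beta_dim ((D.red ^^ k) (vs2.functionals Q, vs1.functionals P))"
    using D.chain_basis_E_injective[OF DS] inj by auto
  define ds where "ds = us @ concat (map fst Ls)"
  define es where "es = map DE us @ concat (map snd Ls)"
  have ds: "fun_space.list_basis ds (vs2.functionals Q)" and es: "fun_space.list_basis es (vs1.functionals P)"
    and DA_us: "DA ` set us \<subseteq> fun_space.span (DE ` set us)"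
    and L: "\<And>u v. (u, v) \<in> set Ls \<Longrightarrow> D.L_chain (u, v)"
    using D by (auto simp: D.chain_basis_def ds_def es_def list_all_iff)
  obtain wP where wP': "\<forall>\<epsilon>. wP \<epsilon> \<in> P"
    "\<forall>\<epsilon>\<in>set es. \<forall>\<epsilon>'\<in>set es. \<epsilon>' (wP \<epsilon>) = (if \<epsilon>' = \<epsilon> then 1 else 0)"
    "vs1.list_basis (map wP es) P"
    using vs1.predual_basis[OF fin(1) sub(1) es] by (elim exE conjE)
  note wP = wP'(1,2)[rule_format] wP'(3)
  obtain wQ where wQ': "\<forall>\<delta>. wQ \<delta> \<in> Q"
    "\<forall>\<delta>\<in>set ds. \<forall>\<delta>'\<in>set ds. \<delta>' (wQ \<delta>) = (if \<delta>' = \<delta> then 1 else 0)"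
    "\<forall>x\<in>Q. x = (\<Sum>\<delta>\<in>set ds. s2 (\<delta> x) (wQ \<delta>))"
    "vs2.list_basis (map wQ ds) Q"
    using vs2.predual_basis[OF fin(2) sub(2) ds] by (elim exE conjE)
  note wQ = wQ'(1-3)[rule_format] wQ'(4)
  \<comment> \<open>Vectors of \<open>Q\<close> are compared by the functionals in
    \<open>ds\<close>. With \<open>pairE\<close> and \<open>pairA\<close> below, each claim about E
    or A becomes one about \<open>DE\<close> or \<open>DA\<close>.\<close>
  have eqQ: "x = y" if "x \<in> Q" "y \<in> Q" "\<And>\<delta>. \<delta> \<in> set ds \<Longrightarrow> \<delta> x = \<delta> y" for x y
  proof -
    have "(\<Sum>\<delta>\<in>set ds. s2 (\<delta> x) (wQ \<delta>)) = (\<Sum>\<delta>\<in>set ds. s2 (\<delta> y) (wQ \<delta>))"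
      by (intro sum.cong refl arg_cong2[of _ _ _ _ s2] that(3))
    then show ?thesis
      using wQ(3)[OF that(1)] wQ(3)[OF that(2)] by simp
  qed
  have dsQ: "\<delta> \<in> vs2.functionals Q" if "\<delta> \<in> set ds" for \<delta>
    using ds that fun_space.span_superset[of "set ds"] by (auto simp: fun_space.list_basis_def)
  have zeroQ: "\<delta> 0 = 0" if "\<delta> \<in> set ds" for \<delta>
    using vs2.functional_zero[OF dsQ[OF that] sub(2)] .
  have Q0: "0 \<in> Q"
    using sub(2) vs2.subspace_0 by blast
  have memQ: "E (wP \<epsilon>) \<in> Q" "A (wP \<epsilon>) \<in> Q" for \<epsilon>
    using wP(1) sub(3,4) by auto
  have pairE: "\<delta> (E (wP \<epsilon>)) = DE \<delta> (wP \<epsilon>)" and pairA: "\<delta> (A (wP \<epsilon>)) = DA \<delta> (wP \<epsilon>)" for \<delta> \<epsilon>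
    using wP(1) by (auto simp: DE_def DA_def transpose_on_def)
  have ds_cases: "\<delta> \<in> set us \<or> (\<exists>u v i. (u, v) \<in> set Ls \<and> i < length u \<and> \<delta> = u ! i)" if "\<delta> \<in> set ds" for \<delta>
    using that by (fastforce simp: ds_def in_set_conv_nth)
  have mem_ds: "u ! i \<in> set ds" if "(u, v) \<in> set Ls" "i < length u" for u v i
    using that by (force simp: ds_def)
  have mem_es: "v ! i \<in> set es" if "(u, v) \<in> set Ls" "i < length v" for u v i
    using that by (force simp: es_def)
  have us_es: "DE \<delta> \<in> set es" if "\<delta> \<in> set us" for \<delta>
    using that by (simp add: es_def)
  have us_ds: "\<delta> \<in> set ds" if "\<delta> \<in> set us" for \<delta>
    using that by (simp add: ds_def)
  have DEu: "DE (u ! i) = v ! i" and DAu: "DA (u ! i) = v ! Suc i"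
    if "(u, v) \<in> set Ls" "i < length u" for u v i
    using L[OF that(1)] that(2) by (auto simp: D.L_chain_def)
  have len: "length v = Suc (length u)" if "(u, v) \<in> set Ls" for u v
    using L[OF that(1)] by (auto simp: D.L_chain_def)
  have dist: "distinct es"
    using es by (simp add: fun_space.list_basis_def)
  have v_us: "v ! i \<notin> DE ` set us" if "(u, v) \<in> set Ls" "i < length v" for u v i
    using dist that nth_mem[of i v] by (fastforce simp: es_def)
  have idx: "u = u' \<and> v = v' \<and> i = j"
    if "(u, v) \<in> set Ls" "i < length v" "(u', v') \<in> set Ls" "j < length v'" "v ! i = v' ! j" for u v u' v' i j
  proof -
    have "(u, v) = (u', v')"
      using dist that nth_mem[of i v] nth_mem[of j v']
      by (intro distinct_concat_map_unique[of snd Ls]) (auto simp: es_def)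
    moreover have "distinct v"
      using dist that(1) by (auto simp: es_def distinct_concat_iff)
    ultimately show ?thesis
      using that by (simp add: nth_eq_iff_index_eq)
  qed
  have DE_es: "DE \<delta> \<in> set es" if "\<delta> \<in> set ds" for \<delta>
    using ds_cases[OF that] us_es mem_es DEu len by (metis less_SucI)
  have inj_ds: "DE \<delta> = DE \<delta>' \<longleftrightarrow> \<delta> = \<delta>'" if "\<delta> \<in> set ds" "\<delta>' \<in> set ds" for \<delta> \<delta>'
    using inj dsQ that by (auto simp: inj_on_def)
  \<comment> \<open>For \<open>\<delta>\<close> in \<open>us\<close>, \<open>DA \<delta>\<close> is
    a combination of the images of \<open>us\<close> under \<open>DE\<close>, and these vanish on
    the predual vectors of all other functionals.\<close>
  have us_zero: "DA \<delta> (wP \<epsilon>) = 0" if "\<delta> \<in> set us" "\<epsilon> \<in> set es" "\<epsilon> \<notin> DE ` set us" for \<delta> \<epsilon>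
  proof -
    have "DA \<delta> \<in> fun_space.span (DE ` set us)"
      using DA_us that(1) by blast
    then show ?thesis
    proof (induction rule: fun_space.span_induct_alt)
      case (step c \<phi> \<psi>)
      then have "\<phi> \<in> set es" "\<phi> \<noteq> \<epsilon>"
        using us_es that(3) by auto
      then show ?case
        using wP(2)[OF that(2), of \<phi>] step by (simp add: fun_scale_def)
    qed simp
  qed
  \<comment> \<open>A functional \<open>\<delta>'\<close> of \<open>ds\<close> is 1 or 0 on the left
    according to \<open>DE \<delta>' = DE \<delta>\<close>, and on the right according to
    \<open>\<delta>' = \<delta>\<close>; the two conditions agree because \<open>DE\<close> is
    injective.\<close>
  have E_image: "E (wP (DE \<delta>)) = wQ \<delta>" if "\<delta> \<in> set ds" for \<delta>
    using inj_ds[OF _ that] wQ(2)[OF that] wP(2)[OF DE_es[OF that] DE_es]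
    by (intro eqQ memQ(1) wQ(1)) (simp add: pairE)
  \<comment> \<open>The last entry of \<open>v\<close> is not the image of any functional of
    \<open>ds\<close> under \<open>DE\<close>, so all of these vanish on the vector in
    question.\<close>
  have E_last: "E (wP (v ! length u)) = 0" if uv: "(u, v) \<in> set Ls" for u v
  proof (rule eqQ[OF memQ(1) Q0])
    fix \<delta> assume \<delta>: "\<delta> \<in> set ds"
    have v: "v ! length u \<in> set es" "length u < length v"
      using mem_es[OF uv] len[OF uv] by auto
    have "DE \<delta> \<noteq> v ! length u"
      using ds_cases[OF \<delta>]
    proof (elim disjE exE conjE)
      assume "\<delta> \<in> set us"
      then show ?thesis
        using v_us[OF uv v(2)] by (metis imageI)
    next
      fix u' v' i assume *: "(u', v') \<in> set Ls" "i < length u'" "\<delta> = u' ! i"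
      then show ?thesis
        using idx[OF uv v(2) *(1), of i] DEu[OF *(1,2)] len[OF *(1)] by auto
    qed
    then show "\<delta> (E (wP (v ! length u))) = \<delta> 0"
      using wP(2)[OF v(1) DE_es[OF \<delta>]] by (simp add: pairE zeroQ[OF \<delta>])
  qed
  have A_Suc: "A (wP (v ! Suc i)) = wQ (u ! i)" if uv: "(u, v) \<in> set Ls" "i < length u" for u v i
  proof (rule eqQ[OF memQ(2) wQ(1)])
    fix \<delta> assume \<delta>: "\<delta> \<in> set ds"
    have v: "v ! Suc i \<in> set es" "Suc i < length v"
      using mem_es[OF uv(1)] len[OF uv(1)] uv(2) by auto
    show "\<delta> (A (wP (v ! Suc i))) = \<delta> (wQ (u ! i))"
      using ds_cases[OF \<delta>]
    proof (elim disjE exE conjE)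
      assume us: "\<delta> \<in> set us"
      have "u ! i \<noteq> \<delta>"
        using us v_us[OF uv(1), of i] DEu[OF uv] len[OF uv(1)] uv(2) by force
      then show ?thesis
        using us_zero[OF us v(1) v_us[OF uv(1) v(2)]] wQ(2)[OF mem_ds[OF uv] \<delta>] by (simp add: pairA)
    next
      fix u' v' j assume *: "(u', v') \<in> set Ls" "j < length u'" "\<delta> = u' ! j"
      have v': "v' ! Suc j \<in> set es" "Suc j < length v'"
        using mem_es[OF *(1)] len[OF *(1)] *(2) by auto
      \<comment> \<open>The list \<open>es\<close> is distinct, so equal entries sit in the same
        chain at the same place. From right to left the comparison goes through \<open>DE\<close>:
        \<open>\<delta> = u ! i\<close> gives \<open>v' ! j = v ! i\<close>.\<close>
      have "v' ! Suc j = v ! Suc i \<longleftrightarrow> \<delta> = u ! i"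
      proof
        assume "v' ! Suc j = v ! Suc i"
        then show "\<delta> = u ! i"
          using idx[OF *(1) v'(2) uv(1) v(2)] *(3) by auto
      next
        assume "\<delta> = u ! i"
        then have "v' ! j = v ! i"
          using DEu[OF uv] DEu[OF *(1,2)] *(3) by simp
        then show "v' ! Suc j = v ! Suc i"
          using idx[OF *(1) _ uv(1), of j i] v v' by auto
      qed
      then show ?thesis
        using wP(2)[OF v(1) v'(1)] wQ(2)[OF mem_ds[OF uv] \<delta>] DAu[OF *(1,2)] *(3) by (simp add: pairA)
    qed
  qed
  have A_not_Suc: "\<delta> (A (wP \<epsilon>)) = 0"
    if asm: "\<epsilon> \<in> set es" "\<And>u v i. (u, v) \<in> set Ls \<Longrightarrow> i < length u \<Longrightarrow> v ! Suc i \<noteq> \<epsilon>" "\<delta> \<in> set ds" "\<delta> \<notin> set us" for \<delta> \<epsilon>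
  proof -
    obtain u v i where uv: "(u, v) \<in> set Ls" "i < length u" "\<delta> = u ! i"
      using ds_cases[OF asm(3)] asm(4) by blast
    then show ?thesis
      using wP(2)[OF that(1) mem_es[OF uv(1), of "Suc i"]] that(2)[OF uv(1,2)] DAu[OF uv(1,2)] len[OF uv(1)]
      by (simp add: pairA)
  qed
  have A_hd: "A (wP (v ! 0)) = 0" if uv: "(u, v) \<in> set Ls" for u v
  proof (rule eqQ[OF memQ(2) Q0])
    fix \<delta> assume \<delta>: "\<delta> \<in> set ds"
    have v: "v ! 0 \<in> set es" "0 < length v"
      using mem_es[OF uv] len[OF uv] by auto
    have "\<delta> (A (wP (v ! 0))) = 0"
    proof (cases "\<delta> \<in> set us")
      case True
      then show ?thesis
        using us_zero[OF True v(1) v_us[OF uv v(2)]] by (simp add: pairA)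
    next
      case False
      have "v' ! Suc i \<noteq> v ! 0" if "(u', v') \<in> set Ls" "i < length u'" for u' v' i
        using idx[OF that(1) _ uv v(2), of "Suc i"] len[OF that(1)] that(2) by auto
      then show ?thesis
        using A_not_Suc[OF v(1) _ \<delta> False] by blast
    qed
    then show "\<delta> (A (wP (v ! 0))) = \<delta> 0"
      by (simp add: zeroQ[OF \<delta>])
  qed
  \<comment> \<open>In the expansion by \<open>wQ\<close> only functionals in \<open>us\<close> can
    have a nonzero coefficient, since no \<open>DA (u ! i)\<close> is an image of \<open>us\<close>
    under \<open>DE\<close>.\<close>
  have A_us: "A (wP \<epsilon>) \<in> vs2.span (wQ ` set us)" if "\<epsilon> \<in> DE ` set us" for \<epsilon>
  proof -
    have \<epsilon>: "\<epsilon> \<in> set es"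
      using that us_es by auto
    have "v ! Suc i \<noteq> \<epsilon>" if "(u, v) \<in> set Ls" "i < length u" for u v i
      using v_us[OF that(1), of "Suc i"] len[OF that(1)] that(2) \<open>\<epsilon> \<in> DE ` set us\<close> by auto
    then have zero: "\<delta> (A (wP \<epsilon>)) = 0" if "\<delta> \<in> set ds" "\<delta> \<notin> set us" for \<delta>
      using A_not_Suc[OF \<epsilon> _ that] by blast
    have "s2 (\<delta> (A (wP \<epsilon>))) (wQ \<delta>) \<in> vs2.span (wQ ` set us)" if "\<delta> \<in> set ds" for \<delta>
    proof (cases "\<delta> \<in> set us")
      case True
      then show ?thesis
        by (intro vs2.span_scale vs2.span_base imageI)
    next
      case False
      show ?thesis
        unfolding zero[OF that False] by (simp add: vs2.span_zero)
    qed
    then show ?thesis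
      by (subst wQ(3)[OF memQ(2)]) (rule vs2.span_sum)
  qed
  define xs where "xs = map (wP \<circ> DE) us"
  define Ts where "Ts = map (\<lambda>(u, v). (map wP v, map wQ u)) Ls"
  have E_xs: "map E xs = map wQ us"
    using E_image us_ds by (simp add: xs_def)
  have "concat (map fst Ts) = map wP (concat (map snd Ls))" "concat (map snd Ts) = map wQ (concat (map fst Ls))"
    by (auto simp: Ts_def map_concat o_def split_beta)
  then have "vs1.list_basis (xs @ concat (map fst Ts)) P" "vs2.list_basis (map E xs @ concat (map snd Ts)) Q"
    using wP(3) wQ(4) by (simp_all add: E_xs, simp_all add: xs_def ds_def es_def)
  moreover have "A ` set xs \<subseteq> vs2.span (E ` set xs)"
  proof -
    have "E ` set xs = wQ ` set us"
      using arg_cong[OF E_xs, of set] by simp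
    then show ?thesis
      using A_us by (auto simp: xs_def)
  qed
  moreover have "T_chain (map wP v, map wQ u)" if uv: "(u, v) \<in> set Ls" for u v
  proof -
    have "E (wP (v ! i)) = wQ (u ! i)" if "i < length u" for i
      using E_image[OF mem_ds[OF uv that]] DEu[OF uv that] by simp
    then show ?thesis
      using E_last[OF uv] A_hd[OF uv] A_Suc[OF uv] len[OF uv] by (simp add: T_chain_def del: nth_map add: nth_map)
  qed
  then have "list_all T_chain Ts"
    by (auto simp: Ts_def list_all_iff)
  ultimately have "chain_basis (P, Q) xs [] [] Ts"
    by (simp add: chain_basis_def)
  moreover have "map (length \<circ> fst) Ts = map (length \<circ> snd) Ls"
    by (auto simp: Ts_def)
  ultimately show thesis
    using that counts by metis
qed

end

section \<open>Presentations of carrier-based spaces\<close>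

context ambient
begin

text \<open>No law is assumed of \<open>V\<close>: the vector space axioms are inherited from
  \<open>P\<close> through the surjection \<open>g\<close>, so presenting a quotient or a dual also
  shows that it is a vector space.\<close>

definition presents :: "('a, 'v) module \<Rightarrow> 'b set \<Rightarrow> ('b \<Rightarrow> 'v) \<Rightarrow> bool" where
  "presents V P g \<longleftrightarrow> subspace P \<and> g ` P = carrier V \<and> g 0 = \<zero>\<^bsub>V\<^esub> \<and>
     (\<forall>x\<in>P. \<forall>y\<in>P. g (x + y) = g x \<oplus>\<^bsub>V\<^esub> g y) \<and> (\<forall>c. \<forall>x\<in>P. g (scale c x) = c \<odot>\<^bsub>V\<^esub> g x)"

context
  fixes V :: "('a, 'v) module" and P g
  assumes pres: "presents V P g"
begin

lemma presents_subspace: "subspace P"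
  using pres by (simp add: presents_def)

lemma presents_carrier: "carrier V = g ` P"
  using pres by (simp add: presents_def)

lemma presents_zero: "g 0 = \<zero>\<^bsub>V\<^esub>"
  using pres by (simp add: presents_def)

lemma presents_add: "x \<in> P \<Longrightarrow> y \<in> P \<Longrightarrow> g (x + y) = g x \<oplus>\<^bsub>V\<^esub> g y"
  using pres by (simp add: presents_def)

lemma presents_smult: "x \<in> P \<Longrightarrow> g (scale c x) = c \<odot>\<^bsub>V\<^esub> g x"
  using pres by (simp add: presents_def)

lemma presents_vectorspace: "vectorspace class_ring V"
proof (rule vs_criteria)
  note mem = subspace_0[OF presents_subspace] subspace_add[OF presents_subspace]
    subspace_scale[OF presents_subspace] subspace_neg[OF presents_subspace]
  note conv = presents_add[symmetric] presents_smult[symmetric] presents_zero[symmetric]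
  show "\<forall>v\<in>carrier V. \<exists>w\<in>carrier V. v \<oplus>\<^bsub>V\<^esub> w = \<zero>\<^bsub>V\<^esub>"
    unfolding presents_carrier
  proof clarify
    fix x assume "x \<in> P"
    then show "\<exists>w\<in>g ` P. g x \<oplus>\<^bsub>V\<^esub> w = \<zero>\<^bsub>V\<^esub>"
      using mem by (intro bexI[of _ "g (- x)"]) (auto simp: conv)
  qed
  show "field (class_ring :: 'a ring)"
    by (rule class_field)
qed (use subspace_0[OF presents_subspace] subspace_add[OF presents_subspace]
    subspace_scale[OF presents_subspace] presents_carrier in
    \<open>auto simp: presents_add[symmetric] presents_smult[symmetric] presents_zero[symmetric] algebra_simps\<close>)

lemma presents_lincomb:
  assumes "finite X" "X \<subseteq> P" "inj_on g X"
  shows "module.lincomb V a (g ` X) = g (\<Sum>x\<in>X. scale (a (g x)) x)"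
proof -
  interpret V: vectorspace class_ring V by (rule presents_vectorspace)
  show ?thesis
    using assms
  proof (induction X rule: finite_induct)
    case empty
    then show ?case by (simp add: V.lincomb_def presents_zero)
  next
    case (insert x X)
    have mem: "g y \<in> carrier V" if "y \<in> insert x X" for y
      using insert.prems that presents_carrier by auto
    have "(\<Sum>x\<in>X. scale (a (g x)) x) \<in> P" "scale (a (g x)) x \<in> P" "x \<in> P"
      using insert.prems presents_subspace by (auto intro!: subspace_sum subspace_scale)
    moreover have "V.lincomb a (g ` insert x X) = a (g x) \<odot>\<^bsub>V\<^esub> g x \<oplus>\<^bsub>V\<^esub> V.lincomb a (g ` X)"
      using insert mem unfolding V.lincomb_def image_insert
      by (subst V.finsum_insert) auto
    ultimately show ?case
      using insert by (simp add: presents_add presents_smult)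
  qed
qed

text \<open>\<open>B\<close> is a basis of the kernel of \<open>g\<close> and \<open>X\<close> one
  of a complement. On that complement \<open>g\<close> is injective, and it still maps onto
  \<open>V\<close>.\<close>

lemma presents_basis_modulo:
  assumes X: "finite X" "independent (B \<union> X)" "B \<inter> X = {}" "span (B \<union> X) = P"
    and B: "span B = {x \<in> P. g x = \<zero>\<^bsub>V\<^esub>}"
  shows "inj_on g X" and "vectorspace.basis class_ring V (g ` X)"
proof -
  interpret V: vectorspace class_ring V by (rule presents_vectorspace)
  have XP: "X \<subseteq> P"
    using X(4) span_superset[of "B \<union> X"] by auto
  have indep: "x \<notin> span ((B \<union> X) - {x})" if "x \<in> X" for x
    using X(2) that by (auto simp: dependent_def)
  show inj: "inj_on g X"
  proof (rule inj_onI, rule ccontr)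
    fix x y assume xy: "x \<in> X" "y \<in> X" "g x = g y" "x \<noteq> y"
    \<comment> \<open>The difference is rewritten because \<open>presents\<close> relates
      \<open>g\<close> to addition and scaling only.\<close>
    have "x - y = x + scale (- 1) y"
      by simp
    then have "g (x - y) = g x \<oplus>\<^bsub>V\<^esub> (- 1) \<odot>\<^bsub>V\<^esub> g y"
      using xy XP presents_add presents_smult subspace_scale[OF presents_subspace] by (metis subsetD)
    also have "\<dots> = g x \<oplus>\<^bsub>V\<^esub> (- 1) \<odot>\<^bsub>V\<^esub> g x"
      using xy by simp
    also have "\<dots> = g (x + scale (- 1) x)"
      using xy XP presents_add presents_smult subspace_scale[OF presents_subspace] by (metis subsetD)
    finally have "x - y \<in> span B"
      unfolding B using xy(1,2) XP presents_zero presents_add[of x "scale (- 1) x"]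
        subspace_diff[OF presents_subspace] by auto
    then have "x - y \<in> span ((B \<union> X) - {x})"
      using X(3) xy span_mono[of B "(B \<union> X) - {x}"] by blast
    moreover have "y \<in> span ((B \<union> X) - {x})"
      using xy by (intro span_base) auto
    ultimately have "(x - y) + y \<in> span ((B \<union> X) - {x})"
      by (rule span_add)
    then show False
      using indep[OF xy(1)] by simp
  qed
  have gX: "finite (g ` X)" "g ` X \<subseteq> carrier V"
    using X(1) XP presents_carrier by auto
  have "V.lin_indpt (g ` X)"
  proof (rule V.finite_lin_indpt2[OF gX])
    fix a assume 0: "V.lincomb a (g ` X) = \<zero>\<^bsub>V\<^esub>"
    define s where "s = (\<Sum>x\<in>X. scale (a (g x)) x)"
    have "s \<in> P"
      unfolding s_def using XP presents_subspace by (auto intro!: subspace_sum subspace_scale)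
    then have s: "s \<in> span B"
      using 0 presents_lincomb[OF X(1) XP inj] B by (simp add: s_def)
    show "\<forall>v\<in>g ` X. a v = \<zero>\<^bsub>class_ring\<^esub>"
    proof (clarsimp, rule ccontr)
      fix x assume x: "x \<in> X" "a (g x) \<noteq> 0"
      let ?R = "span ((B \<union> X) - {x})"
      have "s = scale (a (g x)) x + (\<Sum>x\<in>X - {x}. scale (a (g x)) x)"
        unfolding s_def using X(1) x(1) by (rule sum.remove)
      then have "scale (a (g x)) x = s - (\<Sum>x\<in>X - {x}. scale (a (g x)) x)"
        by simp
      moreover have "s \<in> ?R"
        using s X(3) x span_mono[of B "(B \<union> X) - {x}"] by blast
      moreover have "(\<Sum>x\<in>X - {x}. scale (a (g x)) x) \<in> ?R"
        by (intro span_sum span_scale span_base) auto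
      ultimately have "scale (a (g x)) x \<in> ?R"
        by (simp add: span_diff)
      then have "scale (1 / a (g x)) (scale (a (g x)) x) \<in> ?R"
        by (rule span_scale)
      then show False
        using x indep by simp
    qed
  qed
  moreover have "carrier V \<subseteq> V.span (g ` X)"
  proof
    fix v assume "v \<in> carrier V"
    then obtain p where p: "p \<in> P" "v = g p"
      using presents_carrier by auto
    then obtain b y where yb: "b \<in> span B" "y \<in> span X" "p = b + y"
      using X(4) by (auto simp: span_Un)
    obtain c where c: "y = (\<Sum>x\<in>X. scale (c x) x)"
      using yb(2) X(1) span_finite by blast
    define a where "a = c \<circ> the_inv_into X g"
    have "y = (\<Sum>x\<in>X. scale (a (g x)) x)"
      unfolding c a_def using the_inv_into_f_f[OF inj] by (intro sum.cong) auto
    moreover have "y \<in> P"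
      unfolding c using XP presents_subspace by (auto intro!: subspace_sum subspace_scale)
    moreover from this have "g p = g b \<oplus>\<^bsub>V\<^esub> g y"
      using yb B presents_add by simp
    moreover have "g b = \<zero>\<^bsub>V\<^esub>"
      using yb(1) B by simp
    ultimately have "v = V.lincomb a (g ` X)"
      using presents_lincomb[OF X(1) XP inj, of a] p presents_carrier by simp
    then show "v \<in> V.span (g ` X)"
      unfolding V.span_def using gX by auto
  qed
  moreover have "V.span (g ` X) \<subseteq> carrier V"
    using V.span_is_subset2[OF gX(2)] .
  ultimately show "V.basis (g ` X)"
    using gX(2) by (auto simp: V.basis_def)
qed

lemma presents_kernel_subspace: "subspace {x \<in> P. g x = \<zero>\<^bsub>V\<^esub>}"
proof -
  interpret V: vectorspace class_ring V by (rule presents_vectorspace)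
  have "g (scale c x) = \<zero>\<^bsub>V\<^esub>" if "x \<in> P" "g x = \<zero>\<^bsub>V\<^esub>" for c x
    using presents_smult[OF that(1)] that(2) by simp
  moreover have "g (x + y) = \<zero>\<^bsub>V\<^esub>" if "x \<in> P" "g x = \<zero>\<^bsub>V\<^esub>" "y \<in> P" "g y = \<zero>\<^bsub>V\<^esub>" for x y
    using presents_add[OF that(1,3)] that by simp
  ultimately show ?thesis
    using subspace_0[OF presents_subspace] subspace_add[OF presents_subspace]
      subspace_scale[OF presents_subspace] presents_zero
    by (auto intro!: subspaceI)
qed

text \<open>Rank and nullity of \<open>g\<close>. The kernel lies in \<open>P\<close>, so the
  subtraction truncates nothing; \<open>alpha_dim\<close> and \<open>beta_dim\<close> owe their form
  to this formula.\<close>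

lemma presents_dim:
  assumes "finitely_spanned P"
  shows "vectorspace.dim class_ring V = dim P - dim {x \<in> P. g x = \<zero>\<^bsub>V\<^esub>}"
proof -
  interpret V: vectorspace class_ring V by (rule presents_vectorspace)
  let ?K = "{x \<in> P. g x = \<zero>\<^bsub>V\<^esub>}"
  obtain bs where bs: "list_basis bs ?K"
    using list_basis_exists[OF finitely_spanned_mono[OF assms] presents_kernel_subspace] by auto
  have "set bs \<subseteq> P"
    using bs span_superset[of "set bs"] by (auto simp: list_basis_def)
  then obtain X where X: "finite X" "set bs \<inter> X = {}" "independent (set bs \<union> X)" "span (set bs \<union> X) = P"
    using independent_extend_subspace[OF assms presents_subspace, of "set bs"] bs
    unfolding list_basis_def by metis
  have span_bs: "span (set bs) = ?K"
    using bs by (simp add: list_basis_def)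
  note basis = presents_basis_modulo[OF X(1,3,2,4) span_bs]
  have "V.dim = card X"
    using V.dim_basis[OF _ basis(2)] X(1) card_image[OF basis(1)] by simp
  moreover have "dim P = card (set bs) + card X"
    using dim_span_eq_card_independent[OF X(3)] X by (simp add: card_Un_disjoint)
  moreover have "dim ?K = card (set bs)"
    using dim_span_eq_card_independent[of "set bs"] bs unfolding span_bs by (simp add: list_basis_def)
  ultimately show ?thesis by simp
qed

lemma presents_list_basis:
  assumes inj: "inj_on g P" and bs: "list_basis bs P"
  shows "distinct (map g bs)" "vectorspace.basis class_ring V (set (map g bs))"
proof -
  have "{x \<in> P. g x = \<zero>\<^bsub>V\<^esub>} = {0}"
    using inj subspace_0[OF presents_subspace] presents_zero by (auto simp: inj_on_def)
  then have "span {} = {x \<in> P. g x = \<zero>\<^bsub>V\<^esub>}"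
    by simp
  then have "inj_on g (set bs)" "vectorspace.basis class_ring V (g ` set bs)"
    using presents_basis_modulo[of "set bs" "{}"] bs by (auto simp: list_basis_def)
  then show "distinct (map g bs)" "vectorspace.basis class_ring V (set (map g bs))"
    using bs by (auto simp: distinct_map list_basis_def)
qed

end

lemma presents_subset: "presents V P g \<Longrightarrow> subspace W \<Longrightarrow> W \<subseteq> P \<Longrightarrow> presents (V\<lparr>carrier := g ` W\<rparr>) W g"
  unfolding presents_def by (simp add: subset_iff)

end

text \<open>\<open>mod_hom.ker\<close> and \<open>mod_hom.im\<close> can be unfolded only for an
  actual homomorphism, so the induced maps in the defects have to be recognized as such.\<close>

lemma (in ambient_pair) presents_mod_hom:
  assumes f: "Vector_Spaces.linear s1 s2 f" "f ` P \<subseteq> Q"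
    and M: "vs1.presents M P p" and N: "vs2.presents N Q q"
    and T: "\<And>x. x \<in> P \<Longrightarrow> T (p x) = q (f x)"
  shows "mod_hom class_ring M N T"
proof -
  interpret f: Vector_Spaces.linear s1 s2 f by (rule f(1))
  interpret M: vectorspace class_ring M by (rule vs1.presents_vectorspace[OF M])
  interpret N: vectorspace class_ring N by (rule vs2.presents_vectorspace[OF N])
  have fQ: "f x \<in> Q" if "x \<in> P" for x
    using f(2) that by blast
  have "T (p x \<oplus>\<^bsub>M\<^esub> p y) = T (p x) \<oplus>\<^bsub>N\<^esub> T (p y)" if "x \<in> P" "y \<in> P" for x y
    using that T[of "x + y"] vs1.subspace_add[OF vs1.presents_subspace[OF M]]
    by (simp add: vs1.presents_add[OF M, symmetric] T vs2.presents_add[OF N, symmetric] fQ f.add)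
  moreover have "T (c \<odot>\<^bsub>M\<^esub> p x) = c \<odot>\<^bsub>N\<^esub> T (p x)" if "x \<in> P" for c x
    using that T[of "s1 c x"] vs1.subspace_scale[OF vs1.presents_subspace[OF M]]
    by (simp add: vs1.presents_smult[OF M, symmetric] T vs2.presents_smult[OF N, symmetric] fQ f.scale)
  ultimately have "T \<in> LinearCombinations.module_hom class_ring M N"
    using T fQ by (auto simp: LinearCombinations.module_hom_def vs1.presents_carrier[OF M] vs2.presents_carrier[OF N])
  then show ?thesis
    by (intro mod_hom.intro mod_hom_axioms.intro M.module_axioms N.module_axioms)
qed

text \<open>As \<open>f\<close> maps \<open>U\<close> into \<open>H\<close>, adding \<open>H\<close>
  absorbs what comes from \<open>U\<close>. The scalar multiplication of
  \<open>quotient_space\<close> is itself an \<open>induced_map\<close>, so this serves quotients as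
  well as \<open>A_ind\<close> and \<open>E_ind\<close>.\<close>

lemma induced_map_coset:
  assumes M: "abelian_group M" and V: "abelian_group V"
    and U: "additive_subgroup U M" and H: "additive_subgroup H V"
    and v: "v \<in> carrier M" "f v \<in> carrier V"
    and f: "\<And>u. u \<in> U \<Longrightarrow> f u \<in> H" "\<And>u. u \<in> U \<Longrightarrow> f (u \<oplus>\<^bsub>M\<^esub> v) = f u \<oplus>\<^bsub>V\<^esub> f v"
  shows "induced_map V H f (U +>\<^bsub>M\<^esub> v) = H +>\<^bsub>V\<^esub> f v"
proof -
  interpret M: abelian_group M by (rule M)
  interpret V: abelian_group V by (rule V)
  interpret U: additive_subgroup U M by (rule U)
  interpret H: additive_subgroup H V by (rule H)
  have U0: "\<zero>\<^bsub>M\<^esub> \<in> U"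
    by (rule U.zero_closed)
  have shift: "h \<oplus>\<^bsub>V\<^esub> f (u \<oplus>\<^bsub>M\<^esub> v) = (h \<oplus>\<^bsub>V\<^esub> f u) \<oplus>\<^bsub>V\<^esub> f v" "h \<oplus>\<^bsub>V\<^esub> f u \<in> H"
    if "h \<in> H" "u \<in> U" for h u
    using that f v(2) H.a_Hcarr by (simp_all add: V.a_assoc)
  show ?thesis
    unfolding induced_map_def set_add_def' a_r_coset_def'
  proof (intro equalityI subsetI)
    fix y assume "y \<in> (\<Union>h\<in>H. \<Union>k\<in>f ` (\<Union>u\<in>U. {u \<oplus>\<^bsub>M\<^esub> v}). {h \<oplus>\<^bsub>V\<^esub> k})"
    then obtain h u where "h \<in> H" "u \<in> U" "y = h \<oplus>\<^bsub>V\<^esub> f (u \<oplus>\<^bsub>M\<^esub> v)"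
      by auto
    then show "y \<in> (\<Union>h\<in>H. {h \<oplus>\<^bsub>V\<^esub> f v})"
      using shift[of h u] by auto
  next
    fix y assume "y \<in> (\<Union>h\<in>H. {h \<oplus>\<^bsub>V\<^esub> f v})"
    then obtain h where h: "h \<in> H" "y = h \<oplus>\<^bsub>V\<^esub> f v"
      by auto
    have "f v = f (\<zero>\<^bsub>M\<^esub> \<oplus>\<^bsub>M\<^esub> v)"
      using v by simp
    then have "f v \<in> f ` (\<Union>u\<in>U. {u \<oplus>\<^bsub>M\<^esub> v})"
      using U0 by (intro image_eqI) auto
    then show "y \<in> (\<Union>h\<in>H. \<Union>k\<in>f ` (\<Union>u\<in>U. {u \<oplus>\<^bsub>M\<^esub> v}). {h \<oplus>\<^bsub>V\<^esub> k})"
      using h by blast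
  qed
qed

text \<open>\<open>g x\<close> lies in the image of \<open>W\<close> iff \<open>x\<close> lies in
  \<open>W\<close> plus the kernel of \<open>g\<close>; the hypothesis \<open>ker\<close> makes this
  \<open>W\<close> itself. Since \<open>g\<close> may have a kernel, a quotient of a quotient such
  as \<open>coker\<close> is covered.\<close>

lemma presents_quotient:
  fixes s :: "complex \<Rightarrow> 'b::ab_group_add \<Rightarrow> 'b"
  assumes s: "ambient s" and pres: "ambient.presents s V P g"
    and W: "module.subspace s W" "W \<subseteq> P" and ker: "{x \<in> P. g x = \<zero>\<^bsub>V\<^esub>} \<subseteq> W"
  shows "ambient.presents s (quotient_space V (g ` W)) P (\<lambda>x. g ` W +>\<^bsub>V\<^esub> g x)"
    and "\<And>x. x \<in> P \<Longrightarrow> g ` W +>\<^bsub>V\<^esub> g x = g ` W \<longleftrightarrow> x \<in> W"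
    and "abelian_subgroup (g ` W) V"
proof -
  interpret ambient s by (rule s)
  interpret V: vectorspace class_ring V by (rule presents_vectorspace[OF pres])
  interpret VW: vectorspace class_ring "V\<lparr>carrier := g ` W\<rparr>"
    by (rule presents_vectorspace[OF presents_subset[OF pres W]])
  note carr = presents_carrier[OF pres]
  have mem: "g x \<in> carrier V" if "x \<in> P" for x
    using that carr by simp
  have sub: "additive_subgroup (g ` W) V"
  proof (rule additive_subgroup.intro, rule subgroup.intro)
    show "inv\<^bsub>add_monoid V\<^esub> x \<in> g ` W" if x: "x \<in> g ` W" for x
    proof -
      obtain w where w: "w \<in> W" "x = g w" using x by blast
      have "w \<in> P" "- w \<in> P"
        using w W(2) subspace_neg[OF W(1) w(1)] by auto
      then have "g w \<oplus>\<^bsub>V\<^esub> g (- w) = \<zero>\<^bsub>V\<^esub>"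
        using presents_add[OF pres, of w "- w"] presents_zero[OF pres] by simp
      then have "\<ominus>\<^bsub>V\<^esub> x = g (- w)"
        using w W subspace_neg[OF W(1) w(1)] mem V.a_comm[of "g (- w)" "g w"]
        by (intro V.minus_equality) auto
      then show ?thesis
        using w W subspace_neg by (simp add: a_inv_def)
    qed
  qed (use W mem VW.zero_closed VW.a_closed in auto)
  show H: "abelian_subgroup (g ` W) V"
    by (rule abelian_subgroupI3[OF sub]) (rule V.abelian_group_axioms)
  interpret H: abelian_subgroup "g ` W" V by (rule H)
  show kernel: "g ` W +>\<^bsub>V\<^esub> g x = g ` W \<longleftrightarrow> x \<in> W" if x: "x \<in> P" for x
  proof
    assume "x \<in> W"
    then show "g ` W +>\<^bsub>V\<^esub> g x = g ` W"
      using H.a_rcos_const by simp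
  next
    assume "g ` W +>\<^bsub>V\<^esub> g x = g ` W"
    then have "g x \<in> g ` W"
      using H.a_rcos_self[OF mem[OF x]] by simp
    then obtain w where w: "w \<in> W" "g x = g w" by blast
    have "x - w \<in> P"
      using x w W subspace_diff[OF presents_subspace[OF pres]] by auto
    have "g x = g (x - w) \<oplus>\<^bsub>V\<^esub> g w"
      using presents_add[OF pres \<open>x - w \<in> P\<close>, of w] w W by auto
    then have "g (x - w) = \<zero>\<^bsub>V\<^esub>"
      using w W(2) mem[OF \<open>x - w \<in> P\<close>] mem[of w] V.add.r_cancel_one[of "g w" "g (x - w)"] by auto
    then have "x - w \<in> W"
      using ker \<open>x - w \<in> P\<close> by blast
    then show "x \<in> W"
      using subspace_add[OF W(1) _ w(1)] by fastforce
  qed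
  show "presents (quotient_space V (g ` W)) P (\<lambda>x. g ` W +>\<^bsub>V\<^esub> g x)"
    unfolding presents_def
  proof (intro conjI ballI allI)
    show "(\<lambda>x. g ` W +>\<^bsub>V\<^esub> g x) ` P = carrier (quotient_space V (g ` W))"
      by (auto simp: quotient_space_def A_RCOSETS_def' carr)
    show "g ` W +>\<^bsub>V\<^esub> g 0 = \<zero>\<^bsub>quotient_space V (g ` W)\<^esub>"
      using kernel[of 0] W subspace_0 by (auto simp: quotient_space_def)
    show "g ` W +>\<^bsub>V\<^esub> g (x + y) = (g ` W +>\<^bsub>V\<^esub> g x) \<oplus>\<^bsub>quotient_space V (g ` W)\<^esub> (g ` W +>\<^bsub>V\<^esub> g y)"
      if "x \<in> P" "y \<in> P" for x y
      using H.a_rcos_sum[OF mem mem, OF that] presents_add[OF pres that] by (simp add: quotient_space_def)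
    show "g ` W +>\<^bsub>V\<^esub> g (s c x) = c \<odot>\<^bsub>quotient_space V (g ` W)\<^esub> (g ` W +>\<^bsub>V\<^esub> g x)"
      if x: "x \<in> P" for c x
    proof -
      have "induced_map V (g ` W) (\<lambda>v. c \<odot>\<^bsub>V\<^esub> v) (g ` W +>\<^bsub>V\<^esub> g x) = g ` W +>\<^bsub>V\<^esub> c \<odot>\<^bsub>V\<^esub> g x"
        using x mem VW.smult_closed W
        by (intro induced_map_coset V.abelian_group_axioms sub) (auto simp: V.smult_r_distr)
      then show ?thesis
        using presents_smult[OF pres x] by (simp add: quotient_space_def)
    qed
  qed (rule presents_subspace[OF pres])
qed

section \<open>Realizations of systems\<close>

locale complex_pencil = pencil s1 s2 E A
  for s1 :: "complex \<Rightarrow> 'b \<Rightarrow> 'b :: ab_group_add"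
  and s2 :: "complex \<Rightarrow> 'c \<Rightarrow> 'c :: ab_group_add"
  and E A :: "'b \<Rightarrow> 'c"
begin

text \<open>Like the functions \<open>lE\<close> and \<open>lA\<close> under \<open>reduce\<close>,
  the maps \<open>g\<close> and \<open>h\<close> stay the same through all reductions. Agreement is
  asked on \<open>fst PQ\<close> only, as \<open>lE\<close> and \<open>lA\<close> are arbitrary
  outside the carrier.\<close>

definition realizes :: "('v, 'w) lsys \<Rightarrow> 'b set \<times> 'c set \<Rightarrow> ('b \<Rightarrow> 'v) \<Rightarrow> ('c \<Rightarrow> 'w) \<Rightarrow> bool" where
  "realizes S PQ g h \<longleftrightarrow> subsystem PQ \<and>
     vs1.presents (ldom S) (fst PQ) g \<and> inj_on g (fst PQ) \<and>
     vs2.presents (lcod S) (snd PQ) h \<and> inj_on h (snd PQ) \<and>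
     (\<forall>x\<in>fst PQ. lE S (g x) = h (E x) \<and> lA S (g x) = h (A x))"

context
  fixes S :: "('v, 'w) lsys" and PQ g h
  assumes real: "realizes S PQ g h"
begin

lemma realizes_subsystem: "subsystem PQ"
  using real by (simp add: realizes_def)

lemma realizes_dom: "vs1.presents (ldom S) (fst PQ) g" "inj_on g (fst PQ)"
  and realizes_cod: "vs2.presents (lcod S) (snd PQ) h" "inj_on h (snd PQ)"
  using real by (auto simp: realizes_def)

lemma realizes_maps:
  assumes "x \<in> fst PQ"
  shows "lE S (g x) = h (E x)" "lA S (g x) = h (A x)" "E x \<in> snd PQ" "A x \<in> snd PQ"
  using assms real by (auto simp: realizes_def subsystem_def)

lemma realizes_red_cod: "red_cod S = h ` snd (red PQ)"
  using realizes_maps(1) by (auto simp: red_cod_def vs1.presents_carrier[OF realizes_dom(1)] red_def image_image)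

lemma realizes_red_dom: "red_dom S = g ` fst (red PQ)"
proof -
  have "lA S (g x) \<in> h ` E ` fst PQ \<longleftrightarrow> A x \<in> E ` fst PQ" if "x \<in> fst PQ" for x
    unfolding realizes_maps(2)[OF that]
    using inj_on_image_mem_iff[OF realizes_cod(2), of "A x" "E ` fst PQ"] realizes_maps(3,4) that by blast
  then have "{x \<in> fst PQ. lA S (g x) \<in> h ` E ` fst PQ} = {x \<in> fst PQ. A x \<in> E ` fst PQ}"
    by blast
  moreover have "red_dom S = g ` {x \<in> fst PQ. lA S (g x) \<in> h ` E ` fst PQ}"
    by (auto simp: red_dom_def realizes_red_cod vs1.presents_carrier[OF realizes_dom(1)] red_def)
  ultimately show ?thesis
    by (simp add: red_def)
qed

lemma realizes_reduce: "realizes (reduce S) (red PQ) g h"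
proof -
  note sub = subsystem_red[OF realizes_subsystem]
  have le: "fst (red PQ) \<subseteq> fst PQ" "snd (red PQ) \<subseteq> snd PQ"
    using realizes_maps(3) by (auto simp: red_def)
  show ?thesis
    unfolding realizes_def
  proof (intro conjI ballI)
    show "vs1.presents (ldom (reduce S)) (fst (red PQ)) g"
      using vs1.presents_subset[OF realizes_dom(1) _ le(1)] sub
      by (simp add: reduce_def realizes_red_dom subsystem_def)
    show "vs2.presents (lcod (reduce S)) (snd (red PQ)) h"
      using vs2.presents_subset[OF realizes_cod(1) _ le(2)] sub
      by (simp add: reduce_def realizes_red_cod subsystem_def)
  qed (use sub le inj_on_subset[OF realizes_dom(2)] inj_on_subset[OF realizes_cod(2)] realizes_maps
      in \<open>auto simp: reduce_def\<close>)
qed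

text \<open>\<open>sys_index\<close> is defined through equality of records. As
  \<open>reduce\<close> changes nothing but carriers, and \<open>g\<close> and \<open>h\<close> are
  injective, this comes down to fixed points of \<open>red\<close>.\<close>

lemma reduce_eq_iff: "reduce S = S \<longleftrightarrow> red PQ = PQ"
proof
  assume "reduce S = S"
  then have "carrier (ldom (reduce S)) = carrier (ldom S)" "carrier (lcod (reduce S)) = carrier (lcod S)"
    by simp_all
  then have "g ` fst (red PQ) = g ` fst PQ" "h ` snd (red PQ) = h ` snd PQ"
    using realizes_red_dom realizes_red_cod vs1.presents_carrier[OF realizes_dom(1)]
      vs2.presents_carrier[OF realizes_cod(1)] by (simp_all add: reduce_def)
  moreover have "fst (red PQ) \<subseteq> fst PQ" "snd (red PQ) \<subseteq> snd PQ"
    using realizes_maps(3) by (auto simp: red_def)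
  ultimately show "red PQ = PQ"
    using inj_on_image_eq_iff[OF realizes_dom(2)] inj_on_image_eq_iff[OF realizes_cod(2)]
    by (simp add: prod_eq_iff)
next
  assume "red PQ = PQ"
  then have "red_dom S = carrier (ldom S)" "red_cod S = carrier (lcod S)"
    using realizes_red_dom realizes_red_cod vs1.presents_carrier[OF realizes_dom(1)]
      vs2.presents_carrier[OF realizes_cod(1)] by simp_all
  then show "reduce S = S"
    by (simp add: reduce_def)
qed

text \<open>M/M' is presented by M with kernel M'. Hence ker \<open>[E]\<close> is presented by the
  preimage \<open>K\<close> of V'', again with kernel M', and its dimension is the difference of the
  two.\<close>

lemma alpha_1_eq: "alpha_1 S = alpha_dim PQ"
proof -
  define P where "P = fst PQ"
  define P' where "P' = fst (red PQ)"
  define Q' where "Q' = snd (red PQ)"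
  define K where "K = {x \<in> P. E x \<in> E ` P'}"
  define f where "f x = g ` P' +>\<^bsub>ldom S\<^esub> g x" for x
  have sub: "vs1.subspace P" "vs1.finitely_spanned P" "vs1.subspace P'" "P' \<subseteq> P"
    using realizes_subsystem subsystem_red[OF realizes_subsystem]
    by (auto simp: subsystem_def P_def P'_def red_def)
  have sub': "vs2.subspace (E ` P')" "E ` P' \<subseteq> Q'" "vs2.subspace Q'"
    using subsystem_red[OF realizes_subsystem] E.subspace_image[of P'] by (auto simp: subsystem_def P'_def Q'_def)
  have K: "vs1.subspace K" "K \<subseteq> P" "P' \<subseteq> K"
  proof -
    have "K = P \<inter> {x. E x \<in> E ` P'}"
      by (auto simp: K_def)
    then show "vs1.subspace K"
      using sub(1) sub'(1) by (simp add: vs1.subspace_inter E.subspace_linear_preimage)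
  qed (use sub(4) in \<open>auto simp: K_def\<close>)
  have kerg: "{x \<in> P. g x = \<zero>\<^bsub>ldom S\<^esub>} \<subseteq> P'"
    using realizes_dom vs1.presents_zero[OF realizes_dom(1)] vs1.subspace_0[OF sub(1)] vs1.subspace_0[OF sub(3)]
    by (auto simp: P_def inj_on_def)
  note quot = presents_quotient[OF vs1.ambient_axioms realizes_dom(1)[folded P_def] sub(3,4) kerg]
  have dq: "vs1.presents (dom_quot S) P f"
    using quot(1) by (simp add: dom_quot_def f_def[abs_def] realizes_red_dom P'_def)
  note real' = realizes_reduce
  have cod': "vs2.presents (lcod (reduce S)) Q' h"
    using real' by (simp add: realizes_def Q'_def)
  have injh: "inj_on h Q'"
    using real' by (simp add: realizes_def Q'_def)
  have kerh: "{x \<in> Q'. h x = \<zero>\<^bsub>lcod (reduce S)\<^esub>} \<subseteq> E ` P'"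
    using injh vs2.presents_zero[OF cod'] vs2.subspace_0[OF sub'(1)] vs2.subspace_0[OF sub'(3)]
    by (auto simp: inj_on_def)
  note quot' = presents_quotient[OF vs2.ambient_axioms cod' sub'(1,2) kerh]
  have rc: "red_cod (reduce S) = h ` E ` P'"
    using realizes_red_dom realizes_maps(1) sub(4)
    by (auto simp: red_cod_def reduce_def P'_def P_def image_image intro!: image_cong)
  have Eind: "E_ind S (f x) = h ` E ` P' +>\<^bsub>lcod (reduce S)\<^esub> h (E x)" if x: "x \<in> P" for x
  proof -
    interpret V1: vectorspace class_ring "ldom S" by (rule vs1.presents_vectorspace[OF realizes_dom(1)])
    interpret V2: vectorspace class_ring "lcod (reduce S)" by (rule vs2.presents_vectorspace[OF cod'])
    have Ex: "E y \<in> Q'" if "y \<in> P" for y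
      using that by (auto simp: Q'_def P_def red_def)
    have "induced_map (lcod (reduce S)) (h ` E ` P') (lE S) (g ` P' +>\<^bsub>ldom S\<^esub> g x)
        = h ` E ` P' +>\<^bsub>lcod (reduce S)\<^esub> lE S (g x)"
    proof (rule induced_map_coset[OF V1.abelian_group_axioms V2.abelian_group_axioms])
      show "additive_subgroup (g ` P') (ldom S)" "additive_subgroup (h ` E ` P') (lcod (reduce S))"
        using quot(3) quot'(3) by (auto simp: abelian_subgroup_def)
      show "g x \<in> carrier (ldom S)"
        using x vs1.presents_carrier[OF realizes_dom(1)] by (simp add: P_def)
      show "lE S (g x) \<in> carrier (lcod (reduce S))"
        using x Ex vs2.presents_carrier[OF cod'] realizes_maps(1) by (simp add: P_def)
      fix u assume "u \<in> g ` P'"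
      then obtain p where p: "p \<in> P'" "u = g p" by blast
      then show "lE S u \<in> h ` E ` P'"
        using sub(4) realizes_maps(1) by (auto simp: P_def)
      have "p \<in> P"
        using p sub(4) by blast
      then have "p + x \<in> P"
        using vs1.subspace_add[OF sub(1)] x by simp
      then have "lE S (g p \<oplus>\<^bsub>ldom S\<^esub> g x) = h (E p + E x)"
        using \<open>p \<in> P\<close> x vs1.presents_add[OF realizes_dom(1), of p x] realizes_maps(1)[of "p + x"]
        by (simp add: P_def E.add)
      then show "lE S (u \<oplus>\<^bsub>ldom S\<^esub> g x) = lE S u \<oplus>\<^bsub>lcod (reduce S)\<^esub> lE S (g x)"
        using \<open>p \<in> P\<close> x p(2) vs2.presents_add[OF cod' Ex Ex, of p x] realizes_maps(1) by (simp add: P_def)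
    qed
    then show ?thesis
      using x realizes_maps(1) by (simp add: E_ind_def rc f_def P_def)
  qed
  have zero': "\<zero>\<^bsub>cod_quot (reduce S)\<^esub> = h ` E ` P'"
    by (simp add: cod_quot_def quotient_space_def rc)
  have "mod_hom.ker (dom_quot S) (cod_quot (reduce S)) (E_ind S) = f ` K"
  proof -
    have "E_ind S (f x) = \<zero>\<^bsub>cod_quot (reduce S)\<^esub> \<longleftrightarrow> E x \<in> E ` P'" if "x \<in> P" for x
      using Eind[OF that] quot'(2)[of "E x"] that by (auto simp: zero' Q'_def P_def red_def)
    moreover have "E ` P \<subseteq> Q'"
      by (auto simp: Q'_def P_def red_def)
    then have "mod_hom class_ring (dom_quot S) (cod_quot (reduce S)) (E_ind S)"
      using Eind quot'(1) by (intro presents_mod_hom[OF linear_E _ dq]) (auto simp: cod_quot_def rc)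
    ultimately show ?thesis
      using vs1.presents_carrier[OF dq] by (auto simp: mod_hom.ker_def K_def)
  qed
  then have pres_K: "vs1.presents ((dom_quot S)\<lparr>carrier := mod_hom.ker (dom_quot S) (cod_quot (reduce S)) (E_ind S)\<rparr>) K f"
    using vs1.presents_subset[OF dq K(1,2)] by simp
  have "alpha_1 S = vs1.dim K - vs1.dim {x \<in> K. f x = \<zero>\<^bsub>dom_quot S\<^esub>}"
    using vs1.presents_dim[OF pres_K vs1.finitely_spanned_mono[OF sub(2) K(2)]] by (simp add: alpha_1_def)
  moreover have "{x \<in> K. f x = \<zero>\<^bsub>dom_quot S\<^esub>} = P'"
    using quot(2) K by (auto simp: f_def dom_quot_def quotient_space_def realizes_red_dom P'_def)
  ultimately show ?thesis
    by (simp add: alpha_dim_def K_def P_def P'_def)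
qed

text \<open>The cokernel is a quotient of V/V'. As \<open>f\<close> kills V', the image of
  \<open>[A]\<close> is also the image of \<open>W\<close> = V' + A M, which contains the kernel of
  \<open>f\<close>; so a second use of \<open>presents_quotient\<close> presents the cokernel by V
  with kernel \<open>W\<close>.\<close>

lemma beta_plus_1_eq: "beta_plus_1 S = beta_dim PQ"
proof -
  define P where "P = fst PQ"
  define Q where "Q = snd PQ"
  define P' where "P' = fst (red PQ)"
  define Q' where "Q' = snd (red PQ)"
  define W where "W = {E x + A y | x y. x \<in> P \<and> y \<in> P}"
  define f where "f x = h ` Q' +>\<^bsub>lcod S\<^esub> h x" for x
  have sub: "vs1.subspace P" "vs1.subspace P'" "P' \<subseteq> P"
      "vs2.subspace Q" "vs2.finitely_spanned Q" "vs2.subspace Q'" "Q' \<subseteq> Q"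
    using realizes_subsystem subsystem_red[OF realizes_subsystem]
    by (auto simp: subsystem_def P_def P'_def Q_def Q'_def red_def)
  have Q'_eq: "Q' = E ` P"
    by (simp add: Q'_def P_def red_def)
  have W: "vs2.subspace W" "W \<subseteq> Q" "Q' \<subseteq> W"
  proof -
    have "W = {u + v | u v. u \<in> E ` P \<and> v \<in> A ` P}"
      by (auto simp: W_def)
    then show "vs2.subspace W"
      using vs2.subspace_sums[OF E.subspace_image[OF sub(1)] A.subspace_image[OF sub(1)]] by simp
    show "W \<subseteq> Q"
      using realizes_maps(3,4) vs2.subspace_add[OF sub(4)] by (auto simp: W_def P_def Q_def)
    have "E x = E x + A 0" "0 \<in> P" for x
      using vs1.subspace_0[OF sub(1)] by auto
    then show "Q' \<subseteq> W"
      unfolding W_def Q'_eq by blast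
  qed
  have kerh: "{x \<in> Q. h x = \<zero>\<^bsub>lcod S\<^esub>} \<subseteq> Q'"
    using realizes_cod vs2.presents_zero[OF realizes_cod(1)] vs2.subspace_0[OF sub(4)] vs2.subspace_0[OF sub(6)]
    by (auto simp: Q_def inj_on_def)
  have kerg: "{x \<in> P. g x = \<zero>\<^bsub>ldom S\<^esub>} \<subseteq> P'"
    using realizes_dom vs1.presents_zero[OF realizes_dom(1)] vs1.subspace_0[OF sub(1)] vs1.subspace_0[OF sub(2)]
    by (auto simp: P_def inj_on_def)
  note quot = presents_quotient[OF vs2.ambient_axioms realizes_cod(1)[folded Q_def] sub(6,7) kerh]
  note quotd = presents_quotient[OF vs1.ambient_axioms realizes_dom(1)[folded P_def] sub(2,3) kerg]
  have cq: "vs2.presents (cod_quot S) Q f"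
    using quot(1) by (simp add: cod_quot_def f_def[abs_def] realizes_red_cod Q'_def)
  have zero: "\<zero>\<^bsub>cod_quot S\<^esub> = h ` Q'"
    by (simp add: cod_quot_def quotient_space_def realizes_red_cod Q'_def)
  have Aind: "A_ind S (g ` P' +>\<^bsub>ldom S\<^esub> g x) = f (A x)" if x: "x \<in> P" for x
  proof -
    interpret V1: vectorspace class_ring "ldom S" by (rule vs1.presents_vectorspace[OF realizes_dom(1)])
    interpret V2: vectorspace class_ring "lcod S" by (rule vs2.presents_vectorspace[OF realizes_cod(1)])
    have "induced_map (lcod S) (h ` Q') (lA S) (g ` P' +>\<^bsub>ldom S\<^esub> g x) = h ` Q' +>\<^bsub>lcod S\<^esub> lA S (g x)"
    proof (rule induced_map_coset[OF V1.abelian_group_axioms V2.abelian_group_axioms])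
      show "additive_subgroup (g ` P') (ldom S)" "additive_subgroup (h ` Q') (lcod S)"
        using quot(3) quotd(3) by (auto simp: abelian_subgroup_def)
      show "g x \<in> carrier (ldom S)"
        using x vs1.presents_carrier[OF realizes_dom(1)] by (simp add: P_def)
      show "lA S (g x) \<in> carrier (lcod S)"
        using x vs2.presents_carrier[OF realizes_cod(1)] realizes_maps(2,4) by (simp add: P_def)
      fix u assume "u \<in> g ` P'"
      then obtain p where p: "p \<in> P'" "u = g p" by blast
      then have "A p \<in> Q'" "p \<in> P"
        by (auto simp: P'_def Q'_def red_def P_def)
      then show "lA S u \<in> h ` Q'"
        using p realizes_maps(2) by (auto simp: P_def)
      have "p + x \<in> P"
        using vs1.subspace_add[OF sub(1)] x \<open>p \<in> P\<close> by simp
      then have "lA S (g p \<oplus>\<^bsub>ldom S\<^esub> g x) = h (A p + A x)"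
        using \<open>p \<in> P\<close> x vs1.presents_add[OF realizes_dom(1), of p x] realizes_maps(2)[of "p + x"]
        by (simp add: P_def A.add)
      then show "lA S (u \<oplus>\<^bsub>ldom S\<^esub> g x) = lA S u \<oplus>\<^bsub>lcod S\<^esub> lA S (g x)"
        using \<open>p \<in> P\<close> x p(2) vs2.presents_add[OF realizes_cod(1), of "A p" "A x"] realizes_maps(2,4)
        by (simp add: P_def)
    qed
    then show ?thesis
      using x realizes_maps(2) by (simp add: A_ind_def realizes_red_cod f_def P_def Q'_def)
  qed
  have "carrier (dom_quot S) = (\<lambda>x. g ` P' +>\<^bsub>ldom S\<^esub> g x) ` P"
    using vs1.presents_carrier[OF quotd(1)] by (simp add: dom_quot_def realizes_red_dom P'_def)
  moreover have "mod_hom class_ring (dom_quot S) (cod_quot S) (A_ind S)"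
  proof (rule presents_mod_hom[OF linear_A _ _ cq])
    show "A ` P \<subseteq> Q"
      using realizes_maps(4) by (auto simp: P_def Q_def)
    show "vs1.presents (dom_quot S) P (\<lambda>x. g ` P' +>\<^bsub>ldom S\<^esub> g x)"
      using quotd(1) by (simp add: dom_quot_def realizes_red_dom P'_def)
  qed (rule Aind)
  ultimately have im: "mod_hom.im (dom_quot S) (A_ind S) = f ` A ` P"
    using Aind by (simp add: mod_hom.im_def image_image)
  have fQ': "f u = \<zero>\<^bsub>cod_quot S\<^esub>" if "u \<in> Q'" for u
    using quot(2)[of u] that sub(7) zero by (auto simp: f_def)
  interpret CQ: vectorspace class_ring "cod_quot S" by (rule vs2.presents_vectorspace[OF cq])
  have "f ` A ` P = f ` W"
  proof
    have "A y = E 0 + A y" "0 \<in> P" for y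
      using vs1.subspace_0[OF sub(1)] by auto
    then show "f ` A ` P \<subseteq> f ` W"
      unfolding W_def by blast
    show "f ` W \<subseteq> f ` A ` P"
    proof
      fix z assume "z \<in> f ` W"
      then obtain x y where xy: "x \<in> P" "y \<in> P" "z = f (E x + A y)"
        by (auto simp: W_def)
      then have "z = f (E x) \<oplus>\<^bsub>cod_quot S\<^esub> f (A y)"
        using vs2.presents_add[OF cq, of "E x" "A y"] realizes_maps(3,4) by (simp add: P_def Q_def)
      moreover have "f (E x) = \<zero>\<^bsub>cod_quot S\<^esub>"
        using fQ' xy Q'_eq by blast
      moreover have "f (A y) \<in> carrier (cod_quot S)"
        using vs2.presents_carrier[OF cq] realizes_maps(4) xy by (simp add: P_def Q_def)
      ultimately show "z \<in> f ` A ` P"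
        using xy by simp
    qed
  qed
  moreover have kerf: "{x \<in> Q. f x = \<zero>\<^bsub>cod_quot S\<^esub>} \<subseteq> W"
    using quot(2) zero W(3) by (auto simp: f_def)
  note quot2 = presents_quotient[OF vs2.ambient_axioms cq W(1,2) kerf]
  ultimately have "vs2.presents (coker (dom_quot S) (cod_quot S) (A_ind S)) Q (\<lambda>x. f ` W +>\<^bsub>cod_quot S\<^esub> f x)"
    using quot2(1) by (simp add: coker_def im)
  then have "beta_plus_1 S = vs2.dim Q -
      vs2.dim {x \<in> Q. f ` W +>\<^bsub>cod_quot S\<^esub> f x = \<zero>\<^bsub>coker (dom_quot S) (cod_quot S) (A_ind S)\<^esub>}"
    unfolding beta_plus_1_def by (rule vs2.presents_dim[OF _ sub(5)])
  moreover have "{x \<in> Q. f ` W +>\<^bsub>cod_quot S\<^esub> f x = \<zero>\<^bsub>coker (dom_quot S) (cod_quot S) (A_ind S)\<^esub>} = W"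
    using quot2(2) W(2) im \<open>f ` A ` P = f ` W\<close> by (auto simp: coker_def quotient_space_def)
  ultimately show ?thesis
    by (simp add: beta_dim_def W_def P_def Q_def)
qed

end

lemma realizes_reduction:
  "realizes S PQ g h \<Longrightarrow> realizes (reduction k S) ((red ^^ k) PQ) g h"
  by (induction k) (auto simp: reduction_def intro: realizes_reduce)

lemma realizes_reduction_inf:
  assumes "realizes S PQ g h"
  obtains n where "realizes (reduction_inf S) ((red ^^ n) PQ) g h" "red ((red ^^ n) PQ) = (red ^^ n) PQ"
proof -
  have iff: "reduction (Suc n) S = reduction n S \<longleftrightarrow> red ((red ^^ n) PQ) = (red ^^ n) PQ" for n
    using reduce_eq_iff[OF realizes_reduction[OF assms, of n]] by (simp add: reduction_def)
  obtain n where "reduction (Suc n) S = reduction n S"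
    using red_fixpoint[OF realizes_subsystem[OF assms]] iff by blast
  then have "reduction (Suc (sys_index S)) S = reduction (sys_index S) S"
    unfolding sys_index_def by (rule LeastI)
  then show thesis
    using that[of "sys_index S"] iff realizes_reduction[OF assms] by (simp add: reduction_inf_def)
qed

lemma alpha_eq: "realizes S PQ g h \<Longrightarrow> alpha (Suc k) S = alpha_dim ((red ^^ k) PQ)"
  by (simp add: alpha_def alpha_1_eq[OF realizes_reduction])

lemma beta_plus_eq: "realizes S PQ g h \<Longrightarrow> beta_plus (Suc k) S = beta_dim ((red ^^ k) PQ)"
  by (simp add: beta_plus_def beta_plus_1_eq[OF realizes_reduction])

end

text \<open>The carrier type itself supplies the indices of the coordinates: vectors become
  functions on it that vanish off a finite basis, which works in every dimension. \<open>g\<close>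
  ignores the values off the basis and is linear on all functions; this later gives maps that are
  linear on the whole type.\<close>

lemma vectorspace_coordinates:
  fixes V :: "('a::field, 'v) module"
  assumes V: "vectorspace class_ring V" and fin: "vectorspace.fin_dim class_ring V"
  shows "\<exists>P (g :: ('v \<Rightarrow> 'a) \<Rightarrow> 'v). fun_space.presents V P g \<and> inj_on g P \<and> fun_space.finitely_spanned P \<and>
    (\<forall>f. g f \<in> carrier V) \<and> (\<forall>f f'. g (f + f') = g f \<oplus>\<^bsub>V\<^esub> g f') \<and>
    (\<forall>c f. g (fun_scale c f) = c \<odot>\<^bsub>V\<^esub> g f)"
proof -
  interpret V: vectorspace class_ring V by (rule V)
  obtain B where B: "finite B" "V.basis B"
    using V.finite_basis_exists[OF fin] by blast
  then have BV: "B \<subseteq> carrier V" "V.lin_indpt B" "V.span B = carrier V"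
    by (auto simp: V.basis_def)
  define g where "g f = V.lincomb f B" for f
  define P where "P = {f :: 'v \<Rightarrow> 'a. \<forall>x. x \<notin> B \<longrightarrow> f x = 0}"
  have closed: "g f \<in> carrier V" for f
    unfolding g_def using BV(1) by (rule V.lincomb_closed) auto
  have add: "g (f + f') = g f \<oplus>\<^bsub>V\<^esub> g f'" for f f'
    using V.lincomb_sum[OF B(1) BV(1), of f f'] by (simp add: g_def plus_fun_def)
  have smult: "g (fun_scale c f) = c \<odot>\<^bsub>V\<^esub> g f" for c f
    using V.lincomb_smult[OF BV(1), of f c] by (simp add: g_def fun_scale_def)
  have zero: "g 0 = \<zero>\<^bsub>V\<^esub>"
    using smult[of 0 0] V.lmult_0[OF closed] by (simp add: fun_scale_def zero_fun_def)
  have sub: "fun_space.subspace P"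
    by (rule fun_space.subspaceI) (auto simp: P_def fun_scale_def)
  have "g ` P = carrier V"
  proof
    show "carrier V \<subseteq> g ` P"
    proof
      fix v assume "v \<in> carrier V"
      then obtain a where a: "v = V.lincomb a B"
        using V.finite_span[OF B(1) BV(1)] BV(3) by auto
      define f where "f = (\<lambda>x. if x \<in> B then a x else 0)"
      have "g f = v"
        unfolding a g_def V.lincomb_def using BV(1) by (intro V.finsum_cong') (auto simp: f_def)
      moreover have "f \<in> P"
        by (simp add: P_def f_def)
      ultimately show "v \<in> g ` P" by blast
    qed
  qed (use closed in auto)
  then have pres: "fun_space.presents V P g"
    using sub add smult zero by (simp add: fun_space.presents_def)
  have inj: "inj_on g P"
  proof (rule inj_onI)
    fix f f' assume ff': "f \<in> P" "f' \<in> P" "g f = g f'"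
    have diff: "f - f' = f + fun_scale (- 1) f'"
      by (auto simp: fun_scale_def)
    have "g (f - f') = g f' \<oplus>\<^bsub>V\<^esub> (- 1) \<odot>\<^bsub>V\<^esub> g f'"
      unfolding diff by (simp only: add smult ff'(3))
    also have "\<dots> = g (f' + fun_scale (- 1) f')"
      by (simp only: add smult)
    also have "f' + fun_scale (- 1) f' = 0"
      by (auto simp: fun_scale_def)
    finally have "g (f - f') = \<zero>\<^bsub>V\<^esub>"
      by (simp only: zero)
    moreover define e where "e = f - f'"
    ultimately have "V.lincomb e B = \<zero>\<^bsub>V\<^esub>"
      by (simp only: g_def)
    then have "\<forall>v\<in>B. e v = 0"
      using BV(2) B(1) unfolding V.lin_dep_def by auto
    then show "f = f'"
      using ff'(1,2) by (auto simp: P_def fun_eq_iff e_def)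
  qed
  have "P \<subseteq> fun_space.span ((\<lambda>b x. if x = b then 1 else 0) ` B)"
  proof
    fix f assume "f \<in> P"
    then have "f = (\<Sum>b\<in>B. fun_scale (f b) (\<lambda>x. if x = b then 1 else 0))"
      using B(1) by (auto simp: fun_eq_iff sum_fun_apply fun_scale_def P_def if_distrib[of "\<lambda>t. _ * t"] cong: if_cong)
    also have "\<dots> \<in> fun_space.span ((\<lambda>b x. if x = b then 1 else 0) ` B)"
      by (intro fun_space.span_sum fun_space.span_scale fun_space.span_base imageI)
    finally show "f \<in> fun_space.span ((\<lambda>b x. if x = b then 1 else 0) ` B)" .
  qed
  then have fin_P: "fun_space.finitely_spanned P"
    using B(1) unfolding fun_space.finitely_spanned_def by blast
  show ?thesis
    by (rule exI[of _ P], rule exI[of _ g], intro conjI allI)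
      (rule pres inj fin_P closed add smult)+
qed

text \<open>Two conventions for functionals meet here: value 0 off \<open>Q\<close>, and value
  \<open>undefined\<close> off the carrier. \<open>d\<close> carries a functional along
  \<open>h\<close> and exchanges the default values.\<close>

lemma presents_dual:
  fixes s :: "complex \<Rightarrow> 'b::ab_group_add \<Rightarrow> 'b"
  assumes s: "ambient s" and pres: "ambient.presents s V Q h" and inj: "inj_on h Q"
  defines "d \<equiv> (\<lambda>\<phi>. restrict (\<phi> \<circ> inv_into Q h) (carrier V))"
  shows "fun_space.presents (dual_space V) (ambient.functionals s Q) d"
    and "inj_on d (ambient.functionals s Q)"
proof -
  interpret ambient s by (rule s)
  note sub = presents_subspace[OF pres] and carr = presents_carrier[OF pres]
  have ring: "ring (class_ring :: complex ring)" ..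
  have hi: "inv_into Q h (h x) = x" if "x \<in> Q" for x
    using inj that by simp
  have d: "d \<phi> (h x) = \<phi> x" if "x \<in> Q" for \<phi> x
    using that by (simp add: d_def carr hi)
  have d_out: "d \<phi> v = undefined" if "v \<notin> h ` Q" for \<phi> v
    using that by (simp add: d_def carr)
  show inj_d: "inj_on d (functionals Q)"
  proof (rule inj_onI)
    fix \<phi> \<psi> assume *: "\<phi> \<in> functionals Q" "\<psi> \<in> functionals Q" "d \<phi> = d \<psi>"
    show "\<phi> = \<psi>"
    proof
      fix x show "\<phi> x = \<psi> x"
        using *(3) d[of x \<phi>] d[of x \<psi>] functional_outside[OF *(1), of x] functional_outside[OF *(2), of x]
        by (cases "x \<in> Q") auto
    qed
  qed
  have dual_carr: "carrier (dual_space V) =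
      LinearCombinations.module_hom class_ring V scalar_space \<inter> extensional (carrier V)"
    by (simp add: dual_space_def)
  have "d ` functionals Q = carrier (dual_space V)"
  proof (intro equalityI subsetI)
    fix \<psi> assume "\<psi> \<in> d ` functionals Q"
    then obtain \<phi> where \<phi>: "\<phi> \<in> functionals Q" "\<psi> = d \<phi>" by blast
    have "\<psi> (h x \<oplus>\<^bsub>V\<^esub> h y) = \<psi> (h x) + \<psi> (h y)" if "x \<in> Q" "y \<in> Q" for x y
      using that \<phi> d subspace_add[OF sub] by (simp add: presents_add[OF pres, symmetric] functional_add)
    moreover have "\<psi> (c \<odot>\<^bsub>V\<^esub> h x) = c * \<psi> (h x)" if "x \<in> Q" for c x
      using that \<phi> d subspace_scale[OF sub] by (simp add: presents_smult[OF pres, symmetric] functional_scale)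
    ultimately have "\<psi> \<in> LinearCombinations.module_hom class_ring V scalar_space"
      by (auto simp: LinearCombinations.module_hom_def scalar_space_def carr)
    moreover have "\<psi> \<in> extensional (carrier V)"
      using \<phi>(2) by (simp add: d_def)
    ultimately show "\<psi> \<in> carrier (dual_space V)"
      by (simp add: dual_carr)
  next
    fix \<psi> assume "\<psi> \<in> carrier (dual_space V)"
    then have add: "\<psi> (v \<oplus>\<^bsub>V\<^esub> w) = \<psi> v + \<psi> w" if "v \<in> carrier V" "w \<in> carrier V" for v w
      using that by (auto simp: dual_carr LinearCombinations.module_hom_def scalar_space_def)
    have smult: "\<psi> (c \<odot>\<^bsub>V\<^esub> v) = c * \<psi> v" if "v \<in> carrier V" for v c
      using that \<open>\<psi> \<in> carrier (dual_space V)\<close>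
      by (auto simp: dual_carr LinearCombinations.module_hom_def scalar_space_def)
    have ext: "\<psi> \<in> extensional (carrier V)"
      using \<open>\<psi> \<in> carrier (dual_space V)\<close> by (simp add: dual_carr)
    define \<phi> where "\<phi> = (\<lambda>x. if x \<in> Q then \<psi> (h x) else 0)"
    have "\<phi> \<in> functionals Q"
      using subspace_add[OF sub] subspace_scale[OF sub] add smult carr
      by (auto simp: functionals_def \<phi>_def presents_add[OF pres] presents_smult[OF pres])
    moreover have "d \<phi> = \<psi>"
    proof
      fix v show "d \<phi> v = \<psi> v"
      proof (cases "v \<in> h ` Q")
        case True
        then show ?thesis by (auto simp: d \<phi>_def)
      next
        case False
        then show ?thesis
          using d_out ext carr by (simp add: extensional_def)
      qed
    qed
    ultimately show "\<psi> \<in> d ` functionals Q" by blast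
  qed
  then show "fun_space.presents (dual_space V) (functionals Q) d"
    unfolding fun_space.presents_def
    using subspace_functionals
    by (auto simp: dual_space_def ring.func_space_def[OF ring] d_def fun_scale_def restrict_def)
qed

section \<open>The dual of a realization, and chains for a given system\<close>

context complex_pencil
begin

lemma realizes_dual:
  assumes real: "realizes S (P, Q) g h"
  shows "complex_pencil.realizes fun_scale fun_scale (transpose_on P E) (transpose_on P A)
    (dual_system S) (vs2.functionals Q, vs1.functionals P)
    (\<lambda>\<phi>. restrict (\<phi> \<circ> inv_into Q h) (carrier (lcod S)))
    (\<lambda>\<phi>. restrict (\<phi> \<circ> inv_into P g) (carrier (ldom S)))"
proof -
  interpret D: complex_pencil fun_scale fun_scale "transpose_on P E" "transpose_on P A"
    by (rule complex_pencil.intro[OF pencil_transpose_on])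
  note dom = realizes_dom[OF real, simplified] and cod = realizes_cod[OF real, simplified]
    and maps = realizes_maps[OF real, simplified]
  \<comment> \<open>At a point \<open>g x\<close> both sides are \<open>\<phi> (f x)\<close>; off
    the carrier both are \<open>undefined\<close>.\<close>
  have dual_map: "dual_map (ldom S) F (restrict (\<phi> \<circ> inv_into Q h) (carrier (lcod S))) =
      restrict (transpose_on P f \<phi> \<circ> inv_into P g) (carrier (ldom S))"
    if "\<And>x. x \<in> P \<Longrightarrow> F (g x) = h (f x)" "\<And>x. x \<in> P \<Longrightarrow> f x \<in> Q" for F f and \<phi> :: "'c \<Rightarrow> complex"
  proof
    fix m
    show "dual_map (ldom S) F (restrict (\<phi> \<circ> inv_into Q h) (carrier (lcod S))) m =
      restrict (transpose_on P f \<phi> \<circ> inv_into P g) (carrier (ldom S)) m"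
    proof (cases "m \<in> g ` P")
      case True
      then obtain x where x: "x \<in> P" "m = g x" by blast
      then show ?thesis
        using that[of x] inv_into_f_f[OF dom(2) x(1)] inv_into_f_f[OF cod(2), of "f x"]
        by (simp add: dual_map_def vs1.presents_carrier[OF dom(1)] vs2.presents_carrier[OF cod(1)]
            transpose_on_def)
    next
      case False
      then show ?thesis
        by (simp add: dual_map_def vs1.presents_carrier[OF dom(1)])
    qed
  qed
  show ?thesis
    unfolding D.realizes_def
    using subsystem_dual[OF realizes_subsystem[OF real]]
      presents_dual[OF vs1.ambient_axioms dom] presents_dual[OF vs2.ambient_axioms cod]
      dual_map[of "lE S" E] dual_map[of "lA S" A] maps
    by (simp add: dual_system_def)
qed

lemma chain_basis_exists:
  assumes real: "realizes S PQ g h"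
  shows "\<exists>xs Ns Ls Ts. chain_basis PQ xs Ns Ls Ts \<and>
    (\<forall>k. count_list (map (length \<circ> fst) Ns) (Suc k) = alpha (Suc k) S \<and>
         count_list (map (length \<circ> snd) Ls) (Suc k) = beta_plus (Suc k) S \<and>
         count_list (map (length \<circ> fst) Ts) (Suc k) = beta_minus (Suc k) S)"
proof -
  obtain n where n: "realizes (reduction_inf S) ((red ^^ n) PQ) g h" "red ((red ^^ n) PQ) = (red ^^ n) PQ"
    using realizes_reduction_inf[OF real] .
  obtain P Q where PQ: "(red ^^ n) PQ = (P, Q)" by fastforce
  have surj: "E ` P = Q"
    using n(2) by (simp add: PQ red_def)
  interpret D: complex_pencil fun_scale fun_scale "transpose_on P E" "transpose_on P A"
    by (rule complex_pencil.intro[OF pencil_transpose_on])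
  obtain xs Ts where Ts: "chain_basis (P, Q) xs [] [] Ts"
    "\<And>k. count_list (map (length \<circ> fst) Ts) (Suc k) =
      D.beta_dim ((D.red ^^ k) (vs2.functionals Q, vs1.functionals P))"
    using chain_basis_E_surjective[OF _ surj] realizes_subsystem[OF n(1)] unfolding PQ by blast
  \<comment> \<open>The transposed pencil that gave the L^T chains also realizes the dual of
    \<open>reduction_inf S\<close>, so its dimensions are the defects
    \<open>beta_minus\<close>.\<close>
  have minus: "beta_minus (Suc k) S = D.beta_dim ((D.red ^^ k) (vs2.functionals Q, vs1.functionals P))" for k
    unfolding beta_minus_def using D.beta_plus_eq[OF realizes_dual[OF n(1)[unfolded PQ]]] .
  obtain Ns Ls where "chain_basis PQ xs Ns Ls Ts"
    "\<And>k. count_list (map (length \<circ> fst) Ns) (Suc k) = alpha_dim ((red ^^ k) PQ)"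
    "\<And>k. count_list (map (length \<circ> snd) Ls) (Suc k) = beta_dim ((red ^^ k) PQ)"
    using chain_basis_unreduce[OF realizes_subsystem[OF real] n(2), of xs Ts] Ts(1) unfolding PQ by blast
  then show ?thesis
    using Ts(2) minus alpha_eq[OF real] beta_plus_eq[OF real] by metis
qed

end

text \<open>E and A are the given maps in coordinates. A \<open>pencil\<close> asks for linearity on
  the whole function type; it holds because \<open>g\<close> is linear everywhere and the inverse
  \<open>hi\<close> of \<open>h\<close> is linear on the carrier.\<close>

lemma linear_system_realized:
  fixes S :: "('v, 'w) lsys"
  assumes "linear_system S"
  shows "\<exists>E A PQ g h. complex_pencil fun_scale fun_scale E A \<and>
    complex_pencil.realizes fun_scale fun_scale E A S PQ
      (g :: ('v \<Rightarrow> complex) \<Rightarrow> 'v) (h :: ('w \<Rightarrow> complex) \<Rightarrow> 'w)"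
proof -
  interpret LE: linear_map class_ring "ldom S" "lcod S" "lE S"
    using assms by (simp add: linear_system_def)
  interpret LA: linear_map class_ring "ldom S" "lcod S" "lA S"
    using assms by (simp add: linear_system_def)
  have fin: "vectorspace.fin_dim class_ring (ldom S)" "vectorspace.fin_dim class_ring (lcod S)"
    using assms by (simp_all add: linear_system_def)
  obtain P and g :: "('v \<Rightarrow> complex) \<Rightarrow> 'v" where g: "fun_space.presents (ldom S) P g" "inj_on g P"
      "fun_space.finitely_spanned P" "\<forall>f. g f \<in> carrier (ldom S)"
      "\<forall>f f'. g (f + f') = g f \<oplus>\<^bsub>ldom S\<^esub> g f'" "\<forall>c f. g (fun_scale c f) = c \<odot>\<^bsub>ldom S\<^esub> g f"
    using vectorspace_coordinates[OF LE.V.vectorspace_axioms fin(1)] by (elim exE conjE)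
  obtain Q and h :: "('w \<Rightarrow> complex) \<Rightarrow> 'w" where h: "fun_space.presents (lcod S) Q h" "inj_on h Q"
      "fun_space.finitely_spanned Q"
    using vectorspace_coordinates[OF LE.W.vectorspace_axioms fin(2)] by (elim exE conjE)
  note subQ = fun_space.presents_subspace[OF h(1)]
  define hi where "hi = inv_into Q h"
  have hi: "hi v \<in> Q" "h (hi v) = v" if "v \<in> carrier (lcod S)" for v
    using that fun_space.presents_carrier[OF h(1)] by (auto simp: hi_def inv_into_into f_inv_into_f)
  have hi_eq: "hi (h x) = x" if "x \<in> Q" for x
    using h(2) that by (simp add: hi_def)
  have lin: "Vector_Spaces.linear fun_scale fun_scale (\<lambda>f. hi (F (g f)))"
    if F: "F \<in> LinearCombinations.module_hom class_ring (ldom S) (lcod S)" for F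
  proof -
    have mem: "F (g f) \<in> carrier (lcod S)" for f
      using F g(4) by (auto simp: LinearCombinations.module_hom_def)
    have "F (g (f + f')) = h (hi (F (g f)) + hi (F (g f')))" for f f'
      using F g(4,5) mem hi by (simp add: LinearCombinations.module_hom_def fun_space.presents_add[OF h(1)])
    moreover have "F (g (fun_scale c f)) = h (fun_scale c (hi (F (g f))))" for c f
      using F g(4,6) mem hi by (simp add: LinearCombinations.module_hom_def fun_space.presents_smult[OF h(1)])
    ultimately show ?thesis
      using hi_eq hi(1)[OF mem] fun_space.subspace_add[OF subQ] fun_space.subspace_scale[OF subQ]
      by (simp add: Vector_Spaces.linear_iff fun_space.vector_space_axioms)
  qed
  define E where "E = (\<lambda>f. hi (lE S (g f)))"
  define A where "A = (\<lambda>f. hi (lA S (g f)))"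
  interpret complex_pencil fun_scale fun_scale E A
    unfolding E_def A_def
    by (intro complex_pencil.intro pencil.intro ambient_pair.intro pencil_axioms.intro lin
        fun_space.ambient_axioms LE.f_hom LA.f_hom)
  have mem: "lE S (g f) \<in> carrier (lcod S)" "lA S (g f) \<in> carrier (lcod S)" for f
    using LE.f_hom LA.f_hom g(4) by (auto simp: LinearCombinations.module_hom_def)
  have "realizes S (P, Q) g h"
    unfolding realizes_def subsystem_def
    using g h mem hi subQ fun_space.presents_subspace[OF g(1)] by (auto simp: E_def A_def)
  then show ?thesis
    using complex_pencil_axioms by blast
qed

section \<open>Matrices and Jordan form\<close>

lemma sum_lessThan_add: "(\<Sum>i<m + n. f i) = (\<Sum>i<m. f i) + (\<Sum>i<n. f (m + i))"
  for f :: "nat \<Rightarrow> 'a::comm_monoid_add"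
  by (induction n) (auto simp: add.assoc)

context ambient
begin

definition lin_comb :: "'b list \<Rightarrow> 'a mat \<Rightarrow> nat \<Rightarrow> 'b" where
  "lin_comb cs B j = (\<Sum>i<length cs. scale (B $$ (i, j)) (cs ! i))"

lemma lin_comb_unit:
  assumes "p < length cs" "\<And>i. i < length cs \<Longrightarrow> B $$ (i, j) = (if i = p then 1 else 0)"
  shows "lin_comb cs B j = cs ! p"
proof -
  have "lin_comb cs B j = (\<Sum>i<length cs. if i = p then cs ! i else 0)"
    unfolding lin_comb_def using assms(2) by (intro sum.cong) auto
  then show ?thesis
    using assms(1) by simp
qed

lemma lin_comb_zero: "(\<And>i. i < length cs \<Longrightarrow> B $$ (i, j) = 0) \<Longrightarrow> lin_comb cs B j = 0"
  unfolding lin_comb_def by (intro sum.neutral) auto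

lemma lin_comb_in_span: "lin_comb cs B j \<in> span (set cs)"
  unfolding lin_comb_def by (intro span_sum span_scale span_base) auto

lemma lin_comb_mult:
  assumes B: "B \<in> carrier_mat (length cs) m" and C: "C \<in> carrier_mat m l" and j: "j < l"
  shows "lin_comb (map (lin_comb cs B) [0..<m]) C j = lin_comb cs (B * C) j"
proof -
  have "lin_comb (map (lin_comb cs B) [0..<m]) C j =
      (\<Sum>k<m. \<Sum>i<length cs. scale (C $$ (k, j) * B $$ (i, k)) (cs ! i))"
    by (simp add: lin_comb_def[of "map _ _"] lin_comb_def[of cs] scale_sum_right)
  also have "\<dots> = (\<Sum>i<length cs. \<Sum>k<m. scale (C $$ (k, j) * B $$ (i, k)) (cs ! i))"
    by (rule sum.swap)
  also have "\<dots> = lin_comb cs (B * C) j"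
    unfolding lin_comb_def
  proof (rule sum.cong[OF refl])
    fix i assume "i \<in> {..<length cs}"
    then have "(B * C) $$ (i, j) = (\<Sum>k<m. C $$ (k, j) * B $$ (i, k))"
      using B C j by (simp add: scalar_prod_def mult.commute lessThan_atLeast0)
    then show "(\<Sum>k<m. scale (C $$ (k, j) * B $$ (i, k)) (cs ! i)) = scale ((B * C) $$ (i, j)) (cs ! i)"
      by (simp add: scale_sum_left)
  qed
  finally show ?thesis .
qed

lemma lin_comb_one: "j < length cs \<Longrightarrow> lin_comb cs (1\<^sub>m (length cs)) j = cs ! j"
  by (rule lin_comb_unit) auto

lemma span_lin_comb_invertible:
  assumes B: "B \<in> carrier_mat (length cs) (length cs)" and C: "C \<in> carrier_mat (length cs) (length cs)"
    and BC: "B * C = 1\<^sub>m (length cs)"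
  shows "span (set (map (lin_comb cs B) [0..<length cs])) = span (set cs)"
  unfolding span_eq
proof
  show "set (map (lin_comb cs B) [0..<length cs]) \<subseteq> span (set cs)"
    using lin_comb_in_span by auto
  show "set cs \<subseteq> span (set (map (lin_comb cs B) [0..<length cs]))"
  proof
    fix c assume "c \<in> set cs"
    then obtain j where j: "j < length cs" "c = cs ! j"
      by (auto simp: in_set_conv_nth)
    then have "c = lin_comb (map (lin_comb cs B) [0..<length cs]) C j"
      using lin_comb_mult[OF B C j(1)] BC lin_comb_one[OF j(1)] by simp
    then show "c \<in> span (set (map (lin_comb cs B) [0..<length cs]))"
      using lin_comb_in_span by metis
  qed
qed

lemma list_basisI_spanning:
  assumes "span (set bs) = P" "length bs = dim P"
  shows "list_basis bs P"
proof -
  obtain B where B: "B \<subseteq> set bs" "independent B" "set bs \<subseteq> span B"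
    using maximal_independent_subset[of "set bs"] by metis
  then have "span B = P"
    using assms(1) span_eq[of B "set bs"] span_superset[of "set bs"] by auto
  then have "card B = length bs"
    using dim_span_eq_card_independent[OF B(2)] assms(2) by simp
  then have "card B = card (set bs)" "card (set bs) = length bs"
    using card_mono[OF _ B(1)] card_length[of bs] by auto
  then show ?thesis
    using B assms(1) card_subset_eq[OF _ B(1)] card_distinct[of bs] by (auto simp: list_basis_def)
qed

text \<open>A spanning list of the right length is a basis, so independence and distinctness of the
  new vectors come from counting.\<close>

lemma list_basis_change:
  assumes "list_basis (xs @ ys) P" "span (set xs') = span (set xs)" "length xs' = length xs"
  shows "list_basis (xs' @ ys) P"
proof (rule list_basisI_spanning)
  show "span (set (xs' @ ys)) = P"
    using assms(1,2) by (simp add: list_basis_def span_Un)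
  show "length (xs' @ ys) = dim P"
    using list_basis_dim[OF assms(1)] assms(3) by simp
qed

end

context ambient_pair
begin

definition has_matrix :: "('b \<Rightarrow> 'c) \<Rightarrow> 'b list \<Rightarrow> 'c list \<Rightarrow> 'a mat \<Rightarrow> bool" where
  "has_matrix f bs cs B \<longleftrightarrow> B \<in> carrier_mat (length cs) (length bs) \<and>
     (\<forall>j<length bs. f (bs ! j) = vs2.lin_comb cs B j)"

lemma has_matrix_four_block:
  assumes B: "has_matrix f bs cs B" and B': "has_matrix f bs' cs' B'"
  shows "has_matrix f (bs @ bs') (cs @ cs')
    (four_block_mat B (0\<^sub>m (dim_row B) (dim_col B')) (0\<^sub>m (dim_row B') (dim_col B)) B')"
  unfolding has_matrix_def
proof (intro conjI allI impI)
  let ?F = "four_block_mat B (0\<^sub>m (dim_row B) (dim_col B')) (0\<^sub>m (dim_row B') (dim_col B)) B'"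
  have dims: "dim_row B = length cs" "dim_col B = length bs" "dim_row B' = length cs'" "dim_col B' = length bs'"
    using B B' by (auto simp: has_matrix_def)
  show "?F \<in> carrier_mat (length (cs @ cs')) (length (bs @ bs'))"
    using B B' by (simp add: has_matrix_def)
  fix j assume j: "j < length (bs @ bs')"
  have split: "vs2.lin_comb (cs @ cs') ?F j = (\<Sum>i<length cs. s2 (?F $$ (i, j)) (cs ! i)) +
      (\<Sum>i<length cs'. s2 (?F $$ (length cs + i, j)) (cs' ! i))"
    by (simp add: vs2.lin_comb_def sum_lessThan_add nth_append)
  show "f ((bs @ bs') ! j) = vs2.lin_comb (cs @ cs') ?F j"
  proof (cases "j < length bs")
    case True
    have "vs2.lin_comb (cs @ cs') ?F j = vs2.lin_comb cs B j + 0"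
      unfolding split unfolding vs2.lin_comb_def using j True dims
      by (intro arg_cong2[of _ _ _ _ "(+)"] sum.cong sum.neutral) auto
    then show ?thesis
      using B True by (simp add: has_matrix_def nth_append)
  next
    case False
    have "vs2.lin_comb (cs @ cs') ?F j = 0 + vs2.lin_comb cs' B' (j - length bs)"
      unfolding split unfolding vs2.lin_comb_def using j False dims
      by (intro arg_cong2[of _ _ _ _ "(+)"] sum.cong sum.neutral) auto
    then show ?thesis
      using B' False j by (simp add: has_matrix_def nth_append)
  qed
qed

lemma has_matrix_diag_block:
  assumes "list_all2 (\<lambda>p B. has_matrix f (fst p) (snd p) B) ps Bs"
  shows "has_matrix f (concat (map fst ps)) (concat (map snd ps)) (diag_block_mat Bs)"
  using assms
proof (induction rule: list_all2_induct)
  case Nil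
  show ?case by (simp add: has_matrix_def)
next
  case (Cons p ps B Bs)
  then show ?case
    using has_matrix_four_block[of f "fst p" "snd p" B] by (simp add: Let_def)
qed

end

section \<open>Matrices of the chains and Jordan form of the regular part\<close>

context complex_pencil
begin

lemma N_chain_matrices:
  assumes "N_chain (u, v)"
  shows "has_matrix E u v (N_E (length u))" "has_matrix A u v (N_A (length u))"
proof -
  show "has_matrix A u v (N_A (length u))"
    using assms vs2.lin_comb_one[of _ v] by (simp add: has_matrix_def N_A_def N_chain_def)
  have "E (u ! j) = vs2.lin_comb v (N_E (length u)) j" if "j < length u" for j
  proof (cases j)
    case 0
    then show ?thesis
      using assms by (subst vs2.lin_comb_zero) (auto simp: N_chain_def N_E_def)
  next
    case (Suc i)
    then show ?thesis
      using assms that by (subst vs2.lin_comb_unit[of i]) (auto simp: N_chain_def N_E_def)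
  qed
  then show "has_matrix E u v (N_E (length u))"
    using assms by (auto simp: has_matrix_def N_E_def N_chain_def)
qed

lemma L_chain_matrices:
  assumes "L_chain (u, v)"
  shows "has_matrix E u v (L_E (length v))" "has_matrix A u v (L_A (length v))"
proof -
  have len: "length v = Suc (length u)"
    using assms by (simp add: L_chain_def)
  have "E (u ! j) = vs2.lin_comb v (L_E (length v)) j" "A (u ! j) = vs2.lin_comb v (L_A (length v)) j"
    if "j < length u" for j
  proof -
    show "E (u ! j) = vs2.lin_comb v (L_E (length v)) j"
      using assms that len by (subst vs2.lin_comb_unit[of j]) (auto simp: L_chain_def L_E_def)
    show "A (u ! j) = vs2.lin_comb v (L_A (length v)) j"
      using assms that len by (subst vs2.lin_comb_unit[of "Suc j"]) (auto simp: L_chain_def L_A_def)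
  qed
  then show "has_matrix E u v (L_E (length v))" "has_matrix A u v (L_A (length v))"
    using len by (auto simp: has_matrix_def L_E_def L_A_def)
qed

lemma T_chain_matrices:
  assumes "T_chain (u, v)"
  shows "has_matrix E u v (transpose_mat (L_E (length u)))" "has_matrix A u v (transpose_mat (L_A (length u)))"
proof -
  have len: "length u = Suc (length v)"
    using assms by (simp add: T_chain_def)
  have "E (u ! j) = vs2.lin_comb v (transpose_mat (L_E (length u))) j" if "j < length u" for j
  proof (cases "j < length v")
    case True
    then show ?thesis
      using assms len by (subst vs2.lin_comb_unit[of j]) (auto simp: T_chain_def L_E_def)
  next
    case False
    then have "j = length v"
      using that len by simp
    then show ?thesis
      using assms len by (subst vs2.lin_comb_zero) (auto simp: T_chain_def L_E_def)
  qed
  moreover have "A (u ! j) = vs2.lin_comb v (transpose_mat (L_A (length u))) j" if "j < length u" for j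
  proof (cases j)
    case 0
    then show ?thesis
      using assms len by (subst vs2.lin_comb_zero) (auto simp: T_chain_def L_A_def)
  next
    case (Suc i)
    then show ?thesis
      using assms len that by (subst vs2.lin_comb_unit[of i]) (auto simp: T_chain_def L_A_def)
  qed
  ultimately show "has_matrix E u v (transpose_mat (L_E (length u)))"
    "has_matrix A u v (transpose_mat (L_A (length u)))"
    using len by (auto simp: has_matrix_def L_E_def L_A_def)
qed

lemma regular_part_matrix:
  assumes ys: "distinct (map E xs)" and A: "A ` set xs \<subseteq> vs2.span (E ` set xs)"
  shows "\<exists>B. has_matrix A xs (map E xs) B"
proof -
  let ?n = "length xs"
  have "\<exists>c. A (xs ! j) = (\<Sum>i<?n. s2 (c i) (map E xs ! i))" if "j < ?n" for j
  proof -
    have "A (xs ! j) \<in> vs2.span (set (map E xs))"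
      using A that by auto
    then obtain c where c: "A (xs ! j) = (\<Sum>y\<in>set (map E xs). s2 (c y) y)"
      using vs2.span_finite[of "set (map E xs)"] by auto
    have bij: "bij_betw ((!) (map E xs)) {..<?n} (set (map E xs))"
      using ys by (intro bij_betw_nth) simp_all
    have "(\<Sum>y\<in>set (map E xs). s2 (c y) y) = (\<Sum>i<?n. s2 (c (map E xs ! i)) (map E xs ! i))"
      by (rule sum.reindex_bij_betw[OF bij, of "\<lambda>y. s2 (c y) y", symmetric])
    then show ?thesis
      using c by (intro exI[of _ "\<lambda>i. c (map E xs ! i)"]) simp
  qed
  then obtain c where c: "\<And>j. j < ?n \<Longrightarrow> A (xs ! j) = (\<Sum>i<?n. s2 (c j i) (map E xs ! i))"
    by metis
  have "has_matrix A xs (map E xs) (mat ?n ?n (\<lambda>(i, j). c j i))"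
    unfolding has_matrix_def vs2.lin_comb_def by (auto simp: c)
  then show ?thesis ..
qed

text \<open>The codomain basis is kept equal to the image of the domain basis under E, so the same
  matrix \<open>P\<close> changes both: E keeps the identity matrix, while the matrix
  \<open>B\<close> of A becomes its conjugate by \<open>P\<close>, which is the Jordan
  matrix.\<close>

lemma regular_part_jordan:
  assumes ys: "distinct (map E xs)" and A: "A ` set xs \<subseteq> vs2.span (E ` set xs)"
  obtains xs' js where "length xs' = length xs" "vs1.span (set xs') = vs1.span (set xs)"
    "vs2.span (E ` set xs') = vs2.span (E ` set xs)" "0 \<notin> fst ` set js"
    "has_matrix E xs' (map E xs') (1\<^sub>m (dim_row (jordan_matrix js)))"
    "has_matrix A xs' (map E xs') (jordan_matrix js)"
proof -
  let ?n = "length xs" and ?ys = "map E xs"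
  obtain B where B: "has_matrix A xs ?ys B"
    using regular_part_matrix[OF assms] by blast
  then have Bc: "B \<in> carrier_mat ?n ?n" and AB: "\<And>j. j < ?n \<Longrightarrow> A (xs ! j) = vs2.lin_comb ?ys B j"
    by (auto simp: has_matrix_def)
  \<comment> \<open>Over the complex numbers the characteristic polynomial splits, as the existence
    of a Jordan form requires.\<close>
  obtain as where "char_poly B = (\<Prod>a\<leftarrow>as. [:- a, 1:])"
    using char_poly_factorized[OF Bc] by blast
  then obtain js where "jordan_nf B js"
    using jordan_nf_exists[OF Bc] by blast
  then obtain P Q where js: "0 \<notin> fst ` set js" and wit: "similar_mat_wit B (jordan_matrix js) P Q"
    unfolding jordan_nf_def similar_mat_def by blast
  define J where "J = jordan_matrix js"
  have mats: "P \<in> carrier_mat ?n ?n" "Q \<in> carrier_mat ?n ?n" "J \<in> carrier_mat ?n ?n"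
    "P * Q = 1\<^sub>m ?n" "Q * P = 1\<^sub>m ?n" "B = P * J * Q"
    using similar_mat_witD2[OF Bc wit] by (simp_all add: J_def)
  \<comment> \<open>The columns of \<open>B * P\<close> describe the images of the new vectors under
    A, those of \<open>P * J\<close> the combinations of the new codomain basis prescribed by
    \<open>J\<close>.\<close>
  have BP: "B * P = P * J"
    unfolding mats(6) using mats(1-5) by (simp add: assoc_mult_mat[of _ ?n ?n _ ?n _ ?n])
  define xs' where "xs' = map (vs1.lin_comb xs P) [0..<?n]"
  have ys': "map E xs' = map (vs2.lin_comb ?ys P) [0..<length ?ys]"
    by (auto simp: xs'_def vs1.lin_comb_def vs2.lin_comb_def E.sum E.scale)
  have span1: "vs1.span (set xs') = vs1.span (set xs)"
    unfolding xs'_def using mats by (intro vs1.span_lin_comb_invertible)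
  have "vs2.span (set (map E xs')) = vs2.span (set ?ys)"
    unfolding ys' using mats by (intro vs2.span_lin_comb_invertible[of _ _ Q]) simp_all
  then have span2: "vs2.span (E ` set xs') = vs2.span (E ` set xs)"
    by simp
  have len: "length xs' = ?n"
    by (simp add: xs'_def)
  have dimJ: "dim_row (jordan_matrix js) = ?n"
    using mats(3) unfolding J_def by (rule carrier_matD(1))
  have E1: "has_matrix E xs' (map E xs') (1\<^sub>m (dim_row (jordan_matrix js)))"
    using vs2.lin_comb_one[of _ "map E xs'"] unfolding dimJ by (simp add: has_matrix_def len)
  have "A (xs' ! j) = vs2.lin_comb (map E xs') J j" if j: "j < ?n" for j
  proof -
    have "A (xs' ! j) = (\<Sum>i<?n. s2 (P $$ (i, j)) (vs2.lin_comb ?ys B i))"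
      using j by (simp add: xs'_def vs1.lin_comb_def A.sum A.scale AB)
    also have "\<dots> = vs2.lin_comb (map (vs2.lin_comb ?ys B) [0..<?n]) P j"
      by (simp add: vs2.lin_comb_def[of "map _ [0..<?n]"])
    also have "\<dots> = vs2.lin_comb ?ys (B * P) j"
      using Bc mats(1) j by (intro vs2.lin_comb_mult) simp_all
    also have "\<dots> = vs2.lin_comb (map (vs2.lin_comb ?ys P) [0..<?n]) J j"
      unfolding BP using mats(1,3) j by (intro vs2.lin_comb_mult[symmetric]) simp_all
    finally show ?thesis
      by (simp add: ys')
  qed
  then have "has_matrix A xs' (map E xs') (jordan_matrix js)"
    using mats(3) by (simp add: has_matrix_def len J_def)
  then show thesis
    using that len span1 span2 js E1 by blast
qed

lemma matrix_of_map_has_matrix: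
  assumes real: "realizes S PQ g h" and bs: "set bs \<subseteq> fst PQ" and cs: "set cs \<subseteq> snd PQ"
    and B: "has_matrix f bs cs B" and F: "\<And>x. x \<in> fst PQ \<Longrightarrow> F (g x) = h (f x)"
  shows "matrix_of_map (lcod S) (map g bs) (map h cs) F B"
proof -
  note cod = realizes_cod[OF real]
  note subQ = vs2.presents_subspace[OF cod(1)]
  interpret V: vectorspace class_ring "lcod S"
    by (rule vs2.presents_vectorspace[OF cod(1)])
  have sum: "h (\<Sum>i\<in>I. s2 (c i) (z i)) = (\<Oplus>\<^bsub>lcod S\<^esub>i\<in>I. c i \<odot>\<^bsub>lcod S\<^esub> h (z i))"
    if "finite I" "\<And>i. i \<in> I \<Longrightarrow> z i \<in> snd PQ" for I :: "nat set" and c z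
    using that
  proof (induction I rule: finite_induct)
    case empty
    then show ?case
      by (simp add: vs2.presents_zero[OF cod(1)])
  next
    case (insert i I)
    have "(\<Sum>i\<in>I. s2 (c i) (z i)) \<in> snd PQ" "s2 (c i) (z i) \<in> snd PQ"
      using insert.prems subQ by (auto intro!: vs2.subspace_sum vs2.subspace_scale)
    moreover have "c k \<odot>\<^bsub>lcod S\<^esub> h (z k) \<in> carrier (lcod S)" if "k \<in> insert i I" for k
      using insert.prems[OF that] vs2.presents_carrier[OF cod(1)] by (intro V.smult_closed) auto
    ultimately show ?case
      using insert by (simp add: vs2.presents_add[OF cod(1)] vs2.presents_smult[OF cod(1)])
  qed
  have "F (g (bs ! j)) = (\<Oplus>\<^bsub>lcod S\<^esub>i\<in>{..<length cs}. B $$ (i, j) \<odot>\<^bsub>lcod S\<^esub> h (cs ! i))" if j: "j < length bs" for j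
    using F[of "bs ! j"] B bs cs j sum[of "{..<length cs}" "\<lambda>i. cs ! i" "\<lambda>i. B $$ (i, j)"]
    by (auto simp: has_matrix_def vs2.lin_comb_def subset_iff)
  moreover have "B $$ (i, j) \<odot>\<^bsub>lcod S\<^esub> h (cs ! i) \<in> carrier (lcod S)" if "i < length cs" for i j
  proof (intro V.smult_closed)
    have "cs ! i \<in> snd PQ"
      using that cs nth_mem by blast
    then show "h (cs ! i) \<in> carrier (lcod S)"
      using vs2.presents_carrier[OF cod(1)] by simp
  qed simp
  then have "(\<Oplus>\<^bsub>lcod S\<^esub>i\<in>{..<length cs}. B $$ (i, j) \<odot>\<^bsub>lcod S\<^esub> h (cs ! i)) =
      (\<Oplus>\<^bsub>lcod S\<^esub>i\<in>{..<length cs}. B $$ (i, j) \<odot>\<^bsub>lcod S\<^esub> map h cs ! i)" for j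
    by (intro V.finsum_cong') auto
  ultimately show ?thesis
    using B by (simp add: matrix_of_map_def has_matrix_def)
qed

lemma chain_basis_kronecker:
  assumes real: "realizes S PQ g h" and D: "chain_basis PQ xs Ns Ls Ts"
  shows "\<exists>bs cs js. kronecker_decomposition S bs cs js
    (map (length \<circ> fst) Ns) (map (length \<circ> snd) Ls) (map (length \<circ> fst) Ts)"
proof -
  define bs0 where "bs0 = concat (map fst (Ns @ Ls @ Ts))"
  define cs0 where "cs0 = concat (map snd (Ns @ Ls @ Ts))"
  define ks where "ks = map (length \<circ> fst) Ns"
  define ls where "ls = map (length \<circ> snd) Ls"
  define rs where "rs = map (length \<circ> fst) Ts"
  have bs: "vs1.list_basis (xs @ bs0) (fst PQ)" and cs: "vs2.list_basis (map E xs @ cs0) (snd PQ)"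
    and A: "A ` set xs \<subseteq> vs2.span (E ` set xs)"
    and N: "list_all N_chain Ns" and L: "list_all L_chain Ls" and T: "list_all T_chain Ts"
    using D by (simp_all add: chain_basis_def bs0_def cs0_def)
  obtain xs' js where J: "length xs' = length xs" "vs1.span (set xs') = vs1.span (set xs)"
    "vs2.span (E ` set xs') = vs2.span (E ` set xs)" "0 \<notin> fst ` set js"
    "has_matrix E xs' (map E xs') (1\<^sub>m (dim_row (jordan_matrix js)))"
    "has_matrix A xs' (map E xs') (jordan_matrix js)"
    using regular_part_jordan[OF _ A] cs by (auto simp: vs2.list_basis_def)
  have bs': "vs1.list_basis (xs' @ bs0) (fst PQ)"
    using vs1.list_basis_change[OF bs J(2,1)] .
  have cs': "vs2.list_basis (map E xs' @ cs0) (snd PQ)"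
    using J(1,3) by (intro vs2.list_basis_change[OF cs]) simp_all
  have all2: "list_all2 (\<lambda>p. has_matrix f (fst p) (snd p)) (Ns @ Ls @ Ts)
      (map M ks @ map M' ls @ map (\<lambda>r. transpose_mat (M' r)) rs)"
    if "\<And>p. p \<in> set Ns \<Longrightarrow> has_matrix f (fst p) (snd p) (M (length (fst p)))"
      "\<And>p. p \<in> set Ls \<Longrightarrow> has_matrix f (fst p) (snd p) (M' (length (snd p)))"
      "\<And>p. p \<in> set Ts \<Longrightarrow> has_matrix f (fst p) (snd p) (transpose_mat (M' (length (fst p))))" for f M M'
    using that
    by (intro list_all2_appendI) (auto simp: ks_def ls_def rs_def list_all2_map2 intro!: list.rel_refl_strong)
  have sE: "has_matrix E bs0 cs0 (singular_part N_E L_E ks ls rs)"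
    unfolding bs0_def cs0_def singular_part_def
    using N L T N_chain_matrices(1) L_chain_matrices(1) T_chain_matrices(1)
    by (intro has_matrix_diag_block all2) (auto simp: list_all_iff)
  have sA: "has_matrix A bs0 cs0 (singular_part N_A L_A ks ls rs)"
    unfolding bs0_def cs0_def singular_part_def
    using N L T N_chain_matrices(2) L_chain_matrices(2) T_chain_matrices(2)
    by (intro has_matrix_diag_block all2) (auto simp: list_all_iff)
  have sub: "set (xs' @ bs0) \<subseteq> fst PQ" "set (map E xs' @ cs0) \<subseteq> snd PQ"
    using bs' cs' vs1.span_superset vs2.span_superset unfolding vs1.list_basis_def vs2.list_basis_def by blast+
  have "kronecker_decomposition S (map g (xs' @ bs0)) (map h (map E xs' @ cs0)) js ks ls rs"
    unfolding kronecker_decomposition_def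
  proof (intro conjI)
    show "ordered_basis (ldom S) (map g (xs' @ bs0))"
      using vs1.presents_list_basis[OF realizes_dom[OF real] bs'] by (simp add: ordered_basis_def)
    show "ordered_basis (lcod S) (map h (map E xs' @ cs0))"
      using vs2.presents_list_basis[OF realizes_cod[OF real] cs'] by (simp add: ordered_basis_def)
    show "0 \<notin> set ks" "0 \<notin> set ls" "0 \<notin> set rs"
      using N L T by (auto simp: ks_def ls_def rs_def list_all_iff N_chain_def L_chain_def T_chain_def)
    show "matrix_of_map (lcod S) (map g (xs' @ bs0)) (map h (map E xs' @ cs0)) (lE S)
       (block_diag2 (1\<^sub>m (dim_row (jordan_matrix js))) (singular_part N_E L_E ks ls rs))"
      unfolding block_diag2_def
      by (rule matrix_of_map_has_matrix[OF real sub has_matrix_four_block[OF J(5) sE]])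
        (rule realizes_maps(1)[OF real])
    show "matrix_of_map (lcod S) (map g (xs' @ bs0)) (map h (map E xs' @ cs0)) (lA S)
       (block_diag2 (jordan_matrix js) (singular_part N_A L_A ks ls rs))"
      unfolding block_diag2_def
      by (rule matrix_of_map_has_matrix[OF real sub has_matrix_four_block[OF J(6) sA]])
        (rule realizes_maps(2)[OF real])
  qed (rule J(4))
  then show ?thesis
    unfolding ks_def ls_def rs_def by blast
qed

end

theorem theorem8p5:
  fixes S :: "('a, 'b) lsys"
  assumes "linear_system S"
  shows "\<exists>bs cs js ks ls rs.
    kronecker_decomposition S bs cs js ks ls rs \<and>
    (\<forall>k\<ge>1. count_list ks k = alpha k S \<and>
            count_list ls k = beta_plus k S \<and>
            count_list rs k = beta_minus k S)"
proof -
  obtain E A PQ g h where "complex_pencil fun_scale fun_scale E A"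
    and real: "complex_pencil.realizes fun_scale fun_scale E A S PQ
      (g :: ('a \<Rightarrow> complex) \<Rightarrow> 'a) (h :: ('b \<Rightarrow> complex) \<Rightarrow> 'b)"
    using linear_system_realized[OF assms] by blast
  interpret complex_pencil fun_scale fun_scale E A by fact
  obtain xs Ns Ls Ts where D: "chain_basis PQ xs Ns Ls Ts"
    and count: "\<forall>k. count_list (map (length \<circ> fst) Ns) (Suc k) = alpha (Suc k) S \<and>
      count_list (map (length \<circ> snd) Ls) (Suc k) = beta_plus (Suc k) S \<and>
      count_list (map (length \<circ> fst) Ts) (Suc k) = beta_minus (Suc k) S"
    using chain_basis_exists[OF real] by blast
  obtain bs cs js where "kronecker_decomposition S bs cs js
      (map (length \<circ> fst) Ns) (map (length \<circ> snd) Ls) (map (length \<circ> fst) Ts)"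
    using chain_basis_kronecker[OF real D] by blast
  moreover have "\<forall>k\<ge>1. count_list (map (length \<circ> fst) Ns) k = alpha k S \<and>
      count_list (map (length \<circ> snd) Ls) k = beta_plus k S \<and>
      count_list (map (length \<circ> fst) Ts) k = beta_minus k S"
    using count by (metis One_nat_def Suc_le_D)
  ultimately show ?thesis
    by blast
qed

end
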